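(* Let $S\subseteq\{\neg,\overline{\ \ },\wedge,\vee,\Box,\Diamond,\mathit{true},\mathit{false}\}$. (1) If $S\subseteq\{\neg,\overline{\ \ },\wedge,\vee,\mathit{true},\mathit{false}\}$ and $S$ contains $\{\neg,\vee\}$ or $\{\neg,\wedge\}$, then $\mathcal{L}(S)$ satisfiability is NP-complete. (2) If $S$ contains $\{\overline{\ \ },\wedge,\vee\}$ and $S$ is a subset of $\{\overline{\ \ },\wedge,\vee,\Box,\mathit{true},\mathit{false}\}$ or of $\{\overline{\ \ },\wedge,\vee,\Diamond,\mathit{true},\mathit{false}\}$, then $\mathcal{L}(S)$ satisfiability is NP-complete.
   Context: For $S$ a subset of the operators $\{\neg,\overline{\ \ },\wedge,\vee,\Box,\Diamond,\mathit{true},\mathit{false}\}$, $\mathcal{L}(S)$ is the set of modal formulas built from a countably infinite set of propositional variables using only operators in $S$. Here $\neg$ is general negation (applicable to any formula), $\overline{\ \ }$ is atomic negation (applicable only to propositional variables, giving $\overline{p}$), and $\mathit{true},\mathit{false}$ are constants. Semantics is standard Kripke semantics: a model $\langle W,R,\pi\rangle$ with $W$ non-empty, $R\subseteq W\times W$, $\pi$ a valuation; $\Box\phi$ holds at $w$ iff $\phi$ holds at all $R$-successors of $w$, $\Diamond\phi$ iff at some $R$-successor. $\mathcal{L}(S)$ satisfiability is the problem of deciding, given an $\mathcal{L}(S)$ formula, whether it is true at some world of some model (over the class of all frames). *)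

theory Defs
  imports Main "HOL-Computational_Algebra.Polynomial"
begin

section \<open>Modal formulas and Kripke semantics\<close>

datatype oper = OpNeg | OpAtNeg | OpConj | OpDisj | OpBox | OpDia | OpTrue | OpFalse

datatype fm =
    Atom nat
  | NAtom nat
  | Top
  | Bot
  | Neg fm
  | Conj fm fm
  | Disj fm fm
  | Box fm
  | Dia fm

fun opers :: "fm \<Rightarrow> oper set" where
  "opers (Atom p) = {}"
| "opers (NAtom p) = {OpAtNeg}"
| "opers Top = {OpTrue}"
| "opers Bot = {OpFalse}"
| "opers (Neg a) = insert OpNeg (opers a)"
| "opers (Conj a b) = insert OpConj (opers a \<union> opers b)"
| "opers (Disj a b) = insert OpDisj (opers a \<union> opers b)"
| "opers (Box a) = insert OpBox (opers a)"
| "opers (Dia a) = insert OpDia (opers a)"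

definition lang :: "oper set \<Rightarrow> fm set" where
  "lang S = {a. opers a \<subseteq> S}"

definition kripke_model :: "'w set \<Rightarrow> ('w \<times> 'w) set \<Rightarrow> (nat \<Rightarrow> 'w set) \<Rightarrow> bool" where
  "kripke_model W R V \<longleftrightarrow> W \<noteq> {} \<and> R \<subseteq> W \<times> W \<and> (\<forall>p. V p \<subseteq> W)"

fun holds :: "('w \<times> 'w) set \<Rightarrow> (nat \<Rightarrow> 'w set) \<Rightarrow> 'w \<Rightarrow> fm \<Rightarrow> bool" where
  "holds R V w (Atom p) \<longleftrightarrow> w \<in> V p"
| "holds R V w (NAtom p) \<longleftrightarrow> w \<notin> V p"
| "holds R V w Top \<longleftrightarrow> True"
| "holds R V w Bot \<longleftrightarrow> False"
| "holds R V w (Neg a) \<longleftrightarrow> \<not> holds R V w a"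
| "holds R V w (Conj a b) \<longleftrightarrow> holds R V w a \<and> holds R V w b"
| "holds R V w (Disj a b) \<longleftrightarrow> holds R V w a \<or> holds R V w b"
| "holds R V w (Box a) \<longleftrightarrow> (\<forall>v. (w, v) \<in> R \<longrightarrow> holds R V v a)"
| "holds R V w (Dia a) \<longleftrightarrow> (\<exists>v. (w, v) \<in> R \<and> holds R V v a)"

text \<open>
  A definition cannot quantify over the type of worlds, so worlds are taken from \<^typ>\<open>nat\<close>.
  This is no restriction: by \<open>satisfiableI\<close> below, a formula true at some world of a model
  over an arbitrary type is satisfiable in this sense.
\<close>

definition satisfiable :: "fm \<Rightarrow> bool" where
  "satisfiable a \<longleftrightarrow>
     (\<exists>(W :: nat set) R V w. kripke_model W R V \<and> w \<in> W \<and> holds R V w a)"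

fun subfms :: "fm \<Rightarrow> fm set" where
  "subfms (Neg a) = insert (Neg a) (subfms a)"
| "subfms (Conj a b) = insert (Conj a b) (subfms a \<union> subfms b)"
| "subfms (Disj a b) = insert (Disj a b) (subfms a \<union> subfms b)"
| "subfms (Box a) = insert (Box a) (subfms a)"
| "subfms (Dia a) = insert (Dia a) (subfms a)"
| "subfms a = {a}"

lemma finite_subfms: "finite (subfms a)"
  by (induction a) auto

lemma self_subfms: "a \<in> subfms a"
  by (cases a) auto

lemma satisfiableI:
  fixes W :: "'w set"
  assumes M: "kripke_model W R V" and w: "w \<in> W" and a: "holds R V w a"
  shows "satisfiable a"
proof -
  define h where "h v = {b \<in> subfms a. holds R V v b}" for v
  have "finite (Pow (subfms a))"
    by (simp add: finite_subfms)
  then obtain g :: "fm set \<Rightarrow> nat" where g: "inj_on g (Pow (subfms a))"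
    using finite_imp_inj_to_nat_seg by blast
  define f where "f v = g (h v)" for v
  have f: "holds R V u b \<longleftrightarrow> holds R V v b" if "f u = f v" "b \<in> subfms a" for u v b
  proof -
    have "h u \<in> Pow (subfms a)" "h v \<in> Pow (subfms a)"
      by (auto simp: h_def)
    with that(1) g have "h u = h v"
      by (simp add: f_def inj_on_eq_iff)
    with that(2) show ?thesis
      by (auto simp: h_def)
  qed
  define R' where "R' = {(f u, f v) |u v. (u, v) \<in> R}"
  define V' where "V' p = f ` V p" for p
  have *: "holds R' V' (f v) b \<longleftrightarrow> holds R V v b" if "subfms b \<subseteq> subfms a" for b v
    using that
  proof (induction b arbitrary: v)
    case (Atom p)
    then have "Atom p \<in> subfms a" by simp
    from f[OF _ this] have "u \<in> V p \<longleftrightarrow> v \<in> V p" if "f u = f v" for u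
      using that by (metis holds.simps(1))
    then have "f v \<in> V' p \<longleftrightarrow> v \<in> V p"
      unfolding V'_def by (metis imageE imageI)
    then show ?case by simp
  next
    case (NAtom p)
    then have "NAtom p \<in> subfms a" by simp
    from f[OF _ this] have "u \<in> V p \<longleftrightarrow> v \<in> V p" if "f u = f v" for u
      using that by (metis holds.simps(2))
    then have "f v \<in> V' p \<longleftrightarrow> v \<in> V p"
      unfolding V'_def by (metis imageE imageI)
    then show ?case by simp
  next
    case (Box b)
    then have sub: "Box b \<in> subfms a" and IH: "\<And>v. holds R' V' (f v) b \<longleftrightarrow> holds R V v b"
      by auto
    show ?case
    proof
      assume "holds R' V' (f v) (Box b)"
      then show "holds R V v (Box b)"
        using IH by (auto simp: R'_def)
    next
      assume v: "holds R V v (Box b)"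
      have "holds R' V' x b" if "(f v, x) \<in> R'" for x
      proof -
        from that obtain u u' where u: "f v = f u" "x = f u'" "(u, u') \<in> R"
          by (auto simp: R'_def)
        have "holds R V u (Box b)"
          using f[OF u(1) sub] v by blast
        with u IH show ?thesis by auto
      qed
      then show "holds R' V' (f v) (Box b)" by simp
    qed
  next
    case (Dia b)
    then have sub: "Dia b \<in> subfms a" and IH: "\<And>v. holds R' V' (f v) b \<longleftrightarrow> holds R V v b"
      by auto
    show ?case
    proof
      assume "holds R' V' (f v) (Dia b)"
      then obtain u u' where u: "f v = f u" "holds R' V' (f u') b" "(u, u') \<in> R"
        by (auto simp: R'_def)
      then have "holds R V u (Dia b)"
        using IH by auto
      with f[OF u(1) sub] show "holds R V v (Dia b)" by blast
    next
      assume "holds R V v (Dia b)"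
      then show "holds R' V' (f v) (Dia b)"
        using IH by (auto simp: R'_def)
    qed
  qed auto
  have "kripke_model (f ` W) R' V'"
    using M by (fastforce simp: kripke_model_def R'_def V'_def)
  moreover have "f w \<in> f ` W" "holds R' V' (f w) a"
    using w a * by auto
  ultimately show ?thesis
    unfolding satisfiable_def by blast
qed


section \<open>Formulas as bit strings\<close>

text \<open>
  Formulas are written in Polish notation with a four-bit tag for each constructor; the index of a
  propositional variable is written in binary (least significant bit first), every digit being
  preceded by \<^const>\<open>True\<close> and the last one being followed by \<^const>\<open>False\<close>.
\<close>

fun binary :: "nat \<Rightarrow> bool list" where
  "binary n = (if n = 0 then [] else odd n # binary (n div 2))"

declare binary.simps [simp del]

fun delimit :: "bool list \<Rightarrow> bool list" where
  "delimit [] = [False]"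
| "delimit (b # bs) = True # b # delimit bs"

fun encode :: "fm \<Rightarrow> bool list" where
  "encode (Atom p) = [False, False, False, False] @ delimit (binary p)"
| "encode (NAtom p) = [False, False, False, True] @ delimit (binary p)"
| "encode Top = [False, False, True, False]"
| "encode Bot = [False, False, True, True]"
| "encode (Neg a) = [False, True, False, False] @ encode a"
| "encode (Box a) = [False, True, False, True] @ encode a"
| "encode (Dia a) = [False, True, True, False] @ encode a"
| "encode (Conj a b) = [True, False, False, False] @ encode a @ encode b"
| "encode (Disj a b) = [True, False, False, True] @ encode a @ encode b"

lemma binary_0: "binary 0 = []"
  by (subst binary.simps) simp

lemma binary_pos: "n \<noteq> 0 \<Longrightarrow> binary n = odd n # binary (n div 2)"
  by (subst binary.simps) simp

lemma binary_inject: "binary m = binary n \<Longrightarrow> m = n"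
proof (induction m arbitrary: n rule: less_induct)
  case (less m)
  show ?case
  proof (cases "m = 0 \<or> n = 0")
    case True
    with less.prems binary_pos[of m] binary_pos[of n] binary_0 show ?thesis
      by (metis list.distinct(1))
  next
    case False
    then have "odd m # binary (m div 2) = odd n # binary (n div 2)"
      using less.prems binary_pos[of m] binary_pos[of n] by metis
    then have par: "odd m = odd n" and half: "binary (m div 2) = binary (n div 2)"
      by blast+
    from half False have "m div 2 = n div 2"
      by (intro less.IH) auto
    with par show ?thesis
      by presburger
  qed
qed

lemma delimit_inject: "delimit xs @ r = delimit ys @ s \<Longrightarrow> xs = ys \<and> r = s"
proof (induction xs arbitrary: ys)
  case Nil
  then show ?case by (cases ys) auto
next
  case (Cons x xs)
  then show ?case by (cases ys) auto
qed

lemma encode_prefix_free: "encode a @ r = encode b @ s \<Longrightarrow> a = b \<and> r = s"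
proof (induction a arbitrary: b r s)
  case (Conj a1 a2)
  show ?case
    using Conj.prems
  proof (cases b)
    case (Conj b1 b2)
    with Conj.prems have "encode a1 @ (encode a2 @ r) = encode b1 @ (encode b2 @ s)"
      by simp
    from Conj.IH(1)[OF this] have "a1 = b1" "encode a2 @ r = encode b2 @ s" by auto
    with Conj.IH(2)[of r b2 s] Conj show ?thesis by auto
  qed auto
next
  case (Disj a1 a2)
  show ?case
    using Disj.prems
  proof (cases b)
    case (Disj b1 b2)
    with Disj.prems have "encode a1 @ (encode a2 @ r) = encode b1 @ (encode b2 @ s)"
      by simp
    from Disj.IH(1)[OF this] have "a1 = b1" "encode a2 @ r = encode b2 @ s" by auto
    with Disj.IH(2)[of r b2 s] Disj show ?thesis by auto
  qed auto
next
  case (Atom p)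
  then show ?case by (cases b) (auto dest!: delimit_inject binary_inject)
next
  case (NAtom p)
  then show ?case by (cases b) (auto dest!: delimit_inject binary_inject)
next
  case Top
  then show ?case by (cases b) auto
next
  case Bot
  then show ?case by (cases b) auto
next
  case (Neg a)
  show ?case
    using Neg.prems Neg.IH[of r _ s] by (cases b) simp_all
next
  case (Box a)
  show ?case
    using Box.prems Box.IH[of r _ s] by (cases b) simp_all
next
  case (Dia a)
  show ?case
    using Dia.prems Dia.IH[of r _ s] by (cases b) simp_all
qed

lemma inj_encode: "inj encode"
  using encode_prefix_free[of _ "[]" _ "[]"] by (auto intro!: injI)

definition sat_problem :: "oper set \<Rightarrow> bool list set" where
  "sat_problem S = encode ` {a \<in> lang S. satisfiable a}"


section \<open>Turing machines\<close>

text \<open>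
  Deterministic machines with finitely many two-way infinite tapes. States and tape symbols are
  initial segments of \<^typ>\<open>nat\<close>. State 0 is initial, state 1 accepts and state 2 rejects.
  Symbol 0 is the blank, 1 and 2 represent the bits \<^const>\<open>False\<close> and \<^const>\<open>True\<close>, and 3 is a
  separator used to present a pair of bit strings. The first tape carries the input and the last
  tape the output.
\<close>

datatype dir = MoveLeft | Stay | MoveRight

record machine =
  num_tapes :: nat
  num_states :: nat
  num_symbols :: nat
  delta :: "nat \<Rightarrow> nat list \<Rightarrow> nat \<times> (nat \<times> dir) list"

definition turing_machine :: "machine \<Rightarrow> bool" where
  "turing_machine M \<longleftrightarrow>
     num_tapes M \<ge> 1 \<and> num_states M \<ge> 3 \<and> num_symbols M \<ge> 4 \<and>
     (\<forall>q as. q < num_states M \<and> length as = num_tapes M \<and> set as \<subseteq> {..<num_symbols M} \<longrightarrow>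
        (case delta M q as of (q', acts) \<Rightarrow>
           q' < num_states M \<and> length acts = num_tapes M \<and>
           (\<forall>(a, d) \<in> set acts. a < num_symbols M)))"

type_synonym tape = "(int \<Rightarrow> nat) \<times> int"

type_synonym config = "nat \<times> tape list"

fun read_tape :: "tape \<Rightarrow> nat" where
  "read_tape (c, h) = c h"

fun act_tape :: "nat \<times> dir \<Rightarrow> tape \<Rightarrow> tape" where
  "act_tape (a, d) (c, h) =
     (c(h := a), case d of MoveLeft \<Rightarrow> h - 1 | Stay \<Rightarrow> h | MoveRight \<Rightarrow> h + 1)"

fun step :: "machine \<Rightarrow> config \<Rightarrow> config" where
  "step M (q, ts) =
     (if q = 1 \<or> q = 2 then (q, ts)
      else case delta M q (map read_tape ts) of (q', acts) \<Rightarrow> (q', map2 act_tape acts ts))"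

definition word_tape :: "nat list \<Rightarrow> tape" where
  "word_tape w = (\<lambda>i. if 0 \<le> i \<and> i < int (length w) then w ! nat i else 0, 0)"

definition initial :: "machine \<Rightarrow> nat list \<Rightarrow> config" where
  "initial M w = (0, word_tape w # replicate (num_tapes M - 1) (word_tape []))"

definition run :: "machine \<Rightarrow> nat \<Rightarrow> nat list \<Rightarrow> config" where
  "run M t w = (step M ^^ t) (initial M w)"

definition bits :: "bool list \<Rightarrow> nat list" where
  "bits x = map (\<lambda>b. if b then 2 else 1) x"

definition pair :: "bool list \<Rightarrow> bool list \<Rightarrow> nat list" where
  "pair x u = bits x @ [3] @ bits u"

text \<open>The output is the word between cell 0 and the first blank cell to the right of it.\<close>

definition has_output :: "config \<Rightarrow> nat list \<Rightarrow> bool" where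
  "has_output C w \<longleftrightarrow> 0 \<notin> set w \<and>
     (\<forall>i \<le> length w. fst (last (snd C)) (int i) = (if i < length w then w ! i else 0))"


section \<open>NP-completeness\<close>

definition polytime_fun :: "(bool list \<Rightarrow> bool list) \<Rightarrow> bool" where
  "polytime_fun f \<longleftrightarrow>
     (\<exists>M (p :: nat poly). turing_machine M \<and>
        (\<forall>x. \<exists>t \<le> poly p (length x).
           fst (run M t (bits x)) = 1 \<and> has_output (run M t (bits x)) (bits (f x))))"

definition polytime_rel :: "(bool list \<Rightarrow> bool list \<Rightarrow> bool) \<Rightarrow> bool" where
  "polytime_rel Q \<longleftrightarrow>
     (\<exists>M (p :: nat poly). turing_machine M \<and>
        (\<forall>x u. \<exists>t \<le> poly p (length (pair x u)).
           fst (run M t (pair x u)) = (if Q x u then 1 else 2)))"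

definition NP :: "bool list set set" where
  "NP = {L. \<exists>Q (p :: nat poly). polytime_rel Q \<and>
     (\<forall>x. x \<in> L \<longleftrightarrow> (\<exists>u. length u \<le> poly p (length x) \<and> Q x u))}"

definition polytime_reducible :: "bool list set \<Rightarrow> bool list set \<Rightarrow> bool" where
  "polytime_reducible A B \<longleftrightarrow> (\<exists>f. polytime_fun f \<and> (\<forall>x. x \<in> A \<longleftrightarrow> f x \<in> B))"

definition NP_complete :: "bool list set \<Rightarrow> bool" where
  "NP_complete L \<longleftrightarrow> L \<in> NP \<and> (\<forall>A \<in> NP. polytime_reducible A L)"

end

theory Submission
  imports Defs "HOL-Library.Countable"
begin

text \<open>
  Hardness is Cook's theorem: the runs of a verifier on an input are described by clauses over
  variables for the state and for the cells at a given distance from the heads. The clauses that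
  propagate a configuration to the next one are Horn clauses, so a satisfying valuation contains the
  actual run, whatever else it makes true.

  For membership, a verifier guesses a truth value for every occurrence of a variable. Without
  diamonds a world without successors suffices, where every box formula is true. Without boxes and
  negation, successors can be added freely, so that every occurrence of a diamond has its own world,
  and the guesses only have to be consistent within each world.
\<close>

section \<open>A stack language for Turing machines\<close>

text \<open>Both halves of NP-completeness ask for concrete multi-tape machines with polynomial
  clocks. The reduction and the verifier are therefore programs of one small language, and machines
  are built only once, by its compiler. Since programs count in unary, every clause must be
  printable from unary counters. This is the reason for cells addressed relative to the head, and
  for variables whose binary digits are themselves unary blocks: exponentially large indices of
  linear length. The propagating clauses leave room for additional true variables, so acceptance is
  enforced negatively, by excluding every other state at the final time. The languages differ in
  their connectives. With negation and one of \<open>Conj\<close> and \<open>Disj\<close>, the other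
  is a De Morgan form that uses each argument once, so that no formula is duplicated and fixed
  strings around the arguments suffice to print it; one reduction serves all cases. The verifier is
  uniform as well: \<open>S\<close> only decides which tokens it admits, and the reason why its
  value is correct depends on the language.\<close>

text \<open>
  Variable 0 is the output, stored in reverse and only ever pushed to; variable 1 is the input.
  The command \<open>Put\<close> is the second half of a push and does not occur in programs.
\<close>

datatype cmd =
    Skip
  | Fail
  | Push nat nat
  | Put nat nat
  | Pop nat
  | Seq cmd cmd (infixr \<open>;;\<close> 60)
  | IfTop nat "nat set" cmd cmd
  | WhileTop nat "nat set" cmd

type_synonym store = "nat \<Rightarrow> nat list"

fun hd0 :: "nat list \<Rightarrow> nat" where
  "hd0 [] = 0"
| "hd0 (a # xs) = a"

text \<open>Exhausted fuel with a succeeding test gives \<open>None\<close>, so a defined result is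
  a result of the unbounded loop and the fuel acts as a bound only.\<close>

primrec loop_den ::
  "nat \<Rightarrow> (store \<Rightarrow> store option) \<Rightarrow> nat \<Rightarrow> nat set \<Rightarrow> store \<Rightarrow> store option" where
  "loop_den 0 f v A s = (if hd0 (s v) \<in> A then None else Some s)"
| "loop_den (Suc k) f v A s =
     (if hd0 (s v) \<in> A then Option.bind (f s) (loop_den k f v A) else Some s)"

text \<open>
  The fuel \<open>N\<close> bounds the number of iterations of each single execution of a loop. Hence the running
  time is at most \<open>cost N c\<close>, which for a fixed program is polynomial in the fuel, and no running
  times have to be computed for individual programs.
\<close>

primrec den :: "nat \<Rightarrow> cmd \<Rightarrow> store \<Rightarrow> store option" where
  "den N Skip s = Some s"
| "den N Fail s = None"
| "den N (Push v a) s = Some (s(v := a # s v))"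
| "den N (Put v a) s = None"
| "den N (Pop v) s = Some (s(v := tl (s v)))"
| "den N (Seq c d) s = Option.bind (den N c s) (den N d)"
| "den N (IfTop v A c d) s = (if hd0 (s v) \<in> A then den N c s else den N d s)"
| "den N (WhileTop v A c) s = loop_den N (den N c) v A s"

primrec cost :: "nat \<Rightarrow> cmd \<Rightarrow> nat" where
  "cost N Skip = 0"
| "cost N Fail = 0"
| "cost N (Push v a) = 2"
| "cost N (Put v a) = 1"
| "cost N (Pop v) = 1"
| "cost N (Seq c d) = cost N c + cost N d + 1"
| "cost N (IfTop v A c d) = cost N c + cost N d + 1"
| "cost N (WhileTop v A c) = (N + 1) * (cost N c + 2)"

lemma cost_poly: "\<exists>p :: nat poly. \<forall>N. cost N c \<le> poly p N"
proof (induction c)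
  case (Push v a)
  show ?case by (rule exI[of _ "[:2:]"]) simp
next
  case (Put v a)
  show ?case by (rule exI[of _ "[:1:]"]) simp
next
  case (Pop v)
  show ?case by (rule exI[of _ "[:1:]"]) simp
next
  case (Seq c d)
  then obtain p q :: "nat poly" where "\<forall>N. cost N c \<le> poly p N" "\<forall>N. cost N d \<le> poly q N"
    by blast
  then have "cost N (c ;; d) \<le> poly (p + q + 1) N" for N
    by (simp add: add_mono)
  then show ?case by blast
next
  case (IfTop v A c d)
  then obtain p q :: "nat poly" where "\<forall>N. cost N c \<le> poly p N" "\<forall>N. cost N d \<le> poly q N"
    by blast
  then have "cost N (IfTop v A c d) \<le> poly (p + q + 1) N" for N
    by (simp add: add_mono)
  then show ?case by blast
next
  case (WhileTop v A c)
  then obtain p :: "nat poly" where p: "\<forall>N. cost N c \<le> poly p N"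
    by blast
  have "cost N (WhileTop v A c) \<le> poly ([:1, 1:] * (p + [:2:])) N" for N
    using mult_le_mono2[of "cost N c + 2" "poly p N + 2" "N + 1"] p by simp
  then show ?case by blast
qed auto

lemma poly_nat_mono: "m \<le> n \<Longrightarrow> poly p m \<le> poly p n" for p :: "nat poly"
  by (induction p) (auto intro: add_mono mult_mono)

text \<open>One step of a command, given the symbols under the heads: the remaining command and a tape
  together with the symbol to be written on it and the direction in which its head moves.\<close>

definition no_action :: "nat list \<Rightarrow> nat \<times> nat \<times> dir" where
  "no_action rs = (0, rs ! 0, Stay)"

primrec cstep :: "nat \<Rightarrow> nat list \<Rightarrow> cmd \<Rightarrow> cmd \<times> nat \<times> nat \<times> dir" where
  "cstep K rs Skip = (Skip, no_action rs)"
| "cstep K rs Fail = (Fail, no_action rs)"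
| "cstep K rs (Push v a) =
     (if v = 0 then (Skip, K, a, MoveRight) else (Put v a, v - 1, rs ! (v - 1), MoveLeft))"
| "cstep K rs (Put v a) = (Skip, v - 1, a, Stay)"
| "cstep K rs (Pop v) = (Skip, v - 1, 0, MoveRight)"
| "cstep K rs (Seq c d) =
     (if c = Skip then (d, no_action rs)
      else case cstep K rs c of (c', x) \<Rightarrow> (c' ;; d, x))"
| "cstep K rs (IfTop v A c d) = (if rs ! (v - 1) \<in> A then c else d, no_action rs)"
| "cstep K rs (WhileTop v A c) =
     (if rs ! (v - 1) \<in> A then c ;; WhileTop v A c else Skip, no_action rs)"

text \<open>A set closed under \<open>cstep\<close> that is finite by structural recursion:
  unfolding a loop merely puts a residual of its body in front of the same loop. These commands will
  be the states of the machine.\<close>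

primrec reach :: "cmd \<Rightarrow> cmd set" where
  "reach Skip = {Skip}"
| "reach Fail = {Fail}"
| "reach (Push v a) = {Push v a, Skip} \<union> (if v = 0 then {} else {Put v a})"
| "reach (Put v a) = {Put v a, Skip}"
| "reach (Pop v) = {Pop v, Skip}"
| "reach (Seq c d) = (\<lambda>c'. c' ;; d) ` reach c \<union> reach d"
| "reach (IfTop v A c d) = insert (IfTop v A c d) (reach c \<union> reach d)"
| "reach (WhileTop v A c) =
     {WhileTop v A c, Skip} \<union> (\<lambda>c'. c' ;; WhileTop v A c) ` reach c"

lemma finite_reach: "finite (reach c)"
  by (induction c) auto

lemma reach_self: "c \<in> reach c"
  by (induction c) auto

lemma cstep_Seq:
  "fst (cstep K rs (c ;; d)) = (if c = Skip then d else fst (cstep K rs c) ;; d)"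
  by (simp split: prod.split)

lemma reach_cstep: "c' \<in> reach c \<Longrightarrow> fst (cstep K rs c') \<in> reach c"
proof (induction c arbitrary: c')
  case (Push v a)
  then show ?case by (cases "v = 0") auto
next
  case (Seq c d)
  from Seq.prems consider e where "e \<in> reach c" "c' = (e ;; d)" | "c' \<in> reach d" by auto
  then show ?case
    using Seq.IH reach_self[of d] by cases (auto simp: cstep_Seq simp del: cstep.simps)
next
  case (IfTop v A c d)
  then show ?case
    using reach_self[of d] reach_self[of c] by auto
next
  case (WhileTop v A c)
  from WhileTop.prems consider e where "e \<in> reach c" "c' = (e ;; WhileTop v A c)"
    | "c' = WhileTop v A c" | "c' = Skip" by auto
  then show ?case
  proof cases
    case 1
    with WhileTop.IH show ?thesis by (auto simp: cstep_Seq simp del: cstep.simps)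
  qed (use reach_self[of c] in auto)
qed auto

primrec cmd_ok :: "nat \<Rightarrow> nat \<Rightarrow> cmd \<Rightarrow> bool" where
  "cmd_ok K G Skip \<longleftrightarrow> True"
| "cmd_ok K G Fail \<longleftrightarrow> True"
| "cmd_ok K G (Push v a) \<longleftrightarrow> v \<le> K \<and> a < G"
| "cmd_ok K G (Put v a) \<longleftrightarrow> 1 \<le> v \<and> v \<le> K \<and> a < G"
| "cmd_ok K G (Pop v) \<longleftrightarrow> 1 \<le> v \<and> v \<le> K"
| "cmd_ok K G (Seq c d) \<longleftrightarrow> cmd_ok K G c \<and> cmd_ok K G d"
| "cmd_ok K G (IfTop v A c d) \<longleftrightarrow> 1 \<le> v \<and> v \<le> K \<and> cmd_ok K G c \<and> cmd_ok K G d"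
| "cmd_ok K G (WhileTop v A c) \<longleftrightarrow> 1 \<le> v \<and> v \<le> K \<and> cmd_ok K G c"

text \<open>The output is neither popped nor inspected.\<close>

primrec wf_cmd :: "cmd \<Rightarrow> bool" where
  "wf_cmd Skip \<longleftrightarrow> True"
| "wf_cmd Fail \<longleftrightarrow> True"
| "wf_cmd (Push v a) \<longleftrightarrow> True"
| "wf_cmd (Put v a) \<longleftrightarrow> 1 \<le> v"
| "wf_cmd (Pop v) \<longleftrightarrow> 1 \<le> v"
| "wf_cmd (Seq c d) \<longleftrightarrow> wf_cmd c \<and> wf_cmd d"
| "wf_cmd (IfTop v A c d) \<longleftrightarrow> 1 \<le> v \<and> wf_cmd c \<and> wf_cmd d"
| "wf_cmd (WhileTop v A c) \<longleftrightarrow> 1 \<le> v \<and> wf_cmd c"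

lemma cmd_ok_mono: "cmd_ok K G c \<Longrightarrow> K \<le> K' \<Longrightarrow> G \<le> G' \<Longrightarrow> cmd_ok K' G' c"
  by (induction c) auto

lemma cmd_ok_exists: "wf_cmd c \<Longrightarrow> \<exists>K G. cmd_ok K G c"
proof (induction c)
  case (Push v a)
  show ?case by (rule exI[of _ v], rule exI[of _ "Suc a"]) simp
next
  case (Put v a)
  then show ?case by (intro exI[of _ v] exI[of _ "Suc a"]) simp
next
  case (Seq c d)
  then obtain K G K' G' where "cmd_ok K G c" "cmd_ok K' G' d" by auto
  then have "cmd_ok (max K K') (max G G') (c ;; d)"
    by (auto elim!: cmd_ok_mono)
  then show ?case by blast
next
  case (IfTop v A c d)
  then obtain K G K' G' where *: "cmd_ok K G c" "cmd_ok K' G' d" by auto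
  have "cmd_ok (max v (max K K')) (max G G') (IfTop v A c d)"
    using IfTop.prems * by (auto elim!: cmd_ok_mono)
  then show ?case by blast
next
  case (WhileTop v A c)
  then obtain K G where *: "cmd_ok K G c" by auto
  have "cmd_ok (max v K) G (WhileTop v A c)"
    using WhileTop.prems * by (auto elim!: cmd_ok_mono)
  then show ?case by blast
qed auto

lemma cmd_ok_reach: "cmd_ok K G c \<Longrightarrow> \<forall>c' \<in> reach c. cmd_ok K G c'"
proof (induction c)
  case (Seq c d)
  from Seq.prems have "cmd_ok K G c" "cmd_ok K G d" by simp_all
  with Seq.IH have "\<forall>c' \<in> reach c. cmd_ok K G c'" "\<forall>c' \<in> reach d. cmd_ok K G c'"
    by blast+
  with Seq.prems show ?case by auto
next
  case (IfTop v A c d)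
  from IfTop.prems have "cmd_ok K G c" "cmd_ok K G d" by simp_all
  with IfTop.IH have "\<forall>c' \<in> reach c. cmd_ok K G c'" "\<forall>c' \<in> reach d. cmd_ok K G c'"
    by blast+
  with IfTop.prems show ?case by auto
next
  case (WhileTop v A c)
  from WhileTop.prems have "cmd_ok K G c" by simp
  with WhileTop.IH have "\<forall>c' \<in> reach c. cmd_ok K G c'"
    by blast
  with WhileTop.prems show ?case by auto
qed auto

lemma cstep_symbol:
  assumes "cmd_ok K G c" "cstep K rs c = (c', i, a, d)" "set rs \<subseteq> {..<G}" "length rs = Suc K" "0 < G"
  shows "a < G"
  using assms
proof (induction c arbitrary: c')
  case (Seq c1 c2)
  then show ?case
    by (auto simp: no_action_def subset_iff split: if_splits prod.splits)
qed (auto simp: no_action_def subset_iff split: if_splits)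

section \<open>Execution of commands on tapes\<close>

definition conf :: "nat \<Rightarrow> cmd \<times> tape list \<Rightarrow> cmd \<times> tape list" where
  "conf K = (\<lambda>(c, ts). case cstep K (map read_tape ts) c of
     (c', i, a, d) \<Rightarrow> (c', ts[i := act_tape (a, d) (ts ! i)]))"

lemma act_tape_stay [simp]: "act_tape (read_tape t, Stay) t = t"
  by (cases t) simp

lemma no_action_update:
  assumes "ts \<noteq> []"
  shows "ts[0 := act_tape (map read_tape ts ! 0, Stay) (ts ! 0)] = ts"
  using assms by (cases ts) auto

lemma conf_no_action:
  assumes "ts \<noteq> []" "cstep K (map read_tape ts) c = (c', no_action (map read_tape ts))"
  shows "conf K (c, ts) = (c', ts)"
  using assms no_action_update[of ts] by (auto simp: conf_def no_action_def)

lemma conf_length: "length (snd (conf K (c, ts))) = length ts"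
  by (auto simp: conf_def split: prod.splits)

text \<open>\<open>Skip\<close> is a fixed point of \<open>conf\<close>, whereas
  \<open>Skip ;; b\<close> moves on to \<open>b\<close>. The run of the sequence has to be stopped
  as soon as its first part is finished, which may be earlier than \<open>t\<close>.\<close>

lemma conf_Seq:
  assumes "(conf K ^^ t) (a, ts) = (Skip, ts')" "ts \<noteq> []"
  shows "\<exists>t' \<le> t. (conf K ^^ t') (a ;; b, ts) = (Skip ;; b, ts')"
  using assms
proof (induction t arbitrary: a ts)
  case 0
  then show ?case by auto
next
  case (Suc t)
  obtain a1 ts1 where 1: "conf K (a, ts) = (a1, ts1)"
    by (cases "conf K (a, ts)")
  show ?case
  proof (cases "a = Skip")
    case True
    have skip: "conf K (Skip, ts) = (Skip, ts)"
      using Suc.prems by (intro conf_no_action) auto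
    then have "(conf K ^^ n) (Skip, ts) = (Skip, ts)" for n
      by (induction n) auto
    with Suc.prems True have "ts' = ts" by (metis prod.inject)
    with True show ?thesis by (intro exI[of _ 0]) auto
  next
    case False
    then have step: "conf K (a ;; b, ts) = (a1 ;; b, ts1)"
      using 1 by (auto simp: conf_def split: prod.splits)
    have "length ts1 = length ts"
      using conf_length[of K a ts] 1 by simp
    moreover have "(conf K ^^ t) (a1, ts1) = (Skip, ts')"
      using Suc.prems 1 by (simp add: funpow_Suc_right del: funpow.simps)
    moreover have "ts1 \<noteq> []"
      using \<open>length ts1 = length ts\<close> Suc.prems(2) by auto
    ultimately obtain t' where "t' \<le> t" "(conf K ^^ t') (a1 ;; b, ts1) = (Skip ;; b, ts')"
      using Suc.IH[of a1 ts1] by blast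
    with step show ?thesis
      by (intro exI[of _ "Suc t'"]) (simp add: funpow_Suc_right del: funpow.simps)
  qed
qed

text \<open>The stack is read off the tape from the head to the right; cells to the left of the head are
  irrelevant. The output tape is written from cell 0 to the right.\<close>

definition stack_tape :: "tape \<Rightarrow> nat list \<Rightarrow> bool" where
  "stack_tape t xs \<longleftrightarrow> (\<forall>i. fst t (snd t + int i) = (if i < length xs then xs ! i else 0))"

definition output_tape :: "tape \<Rightarrow> nat list \<Rightarrow> bool" where
  "output_tape t xs \<longleftrightarrow> snd t = int (length xs) \<and>
     (\<forall>i. fst t (int i) = (if i < length xs then rev xs ! i else 0))"

text \<open>The output variable 0 lives on the last tape and variable \<open>Suc v\<close> on tape
  \<open>v\<close>. Thus variable 1 is on the first tape, as the machine model prescribes for the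
  input.\<close>

definition represents :: "nat \<Rightarrow> tape list \<Rightarrow> store \<Rightarrow> bool" where
  "represents K ts s \<longleftrightarrow> length ts = Suc K \<and> output_tape (ts ! K) (s 0) \<and>
     (\<forall>v < K. stack_tape (ts ! v) (s (Suc v)))"

lemma read_stack: "stack_tape t xs \<Longrightarrow> read_tape t = hd0 xs"
  unfolding stack_tape_def by (cases t; cases xs) (auto dest: spec[of _ 0])

lemma stack_pop: "stack_tape t xs \<Longrightarrow> stack_tape (act_tape (a, MoveRight) t) (tl xs)"
  unfolding stack_tape_def
proof (cases t, intro allI)
  fix c h i
  assume *: "\<forall>i. fst t (snd t + int i) = (if i < length xs then xs ! i else 0)" "t = (c, h)"
  show "fst (act_tape (a, MoveRight) t) (snd (act_tape (a, MoveRight) t) + int i) =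
      (if i < length (tl xs) then tl xs ! i else 0)"
    using * spec[OF *(1), of "Suc i"] by (auto simp: nth_tl algebra_simps)
qed

text \<open>A machine writes before it moves, so a push takes two steps: a move to the left that
  rewrites the current symbol, and a write in place. The cell reached may have held anything, since
  \<open>stack_tape\<close> constrains only the cells from the head on.\<close>

lemma stack_push:
  assumes "stack_tape t xs"
  shows "stack_tape (act_tape (a, Stay) (act_tape (read_tape t, MoveLeft) t)) (a # xs)"
proof -
  obtain c h where t: "t = (c, h)" by (cases t)
  have *: "c (h + int i) = (if i < length xs then xs ! i else 0)" for i
    using assms t by (auto simp: stack_tape_def)
  have "(c(h - 1 := a)) (h - 1 + int i) = (if i < length (a # xs) then (a # xs) ! i else 0)" for i
  proof (cases i)
    case (Suc j)
    then show ?thesis using *[of j] by (simp add: algebra_simps)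
  qed simp
  then show ?thesis
    by (simp add: stack_tape_def t)
qed

lemma output_push:
  assumes "output_tape t xs"
  shows "output_tape (act_tape (a, MoveRight) t) (a # xs)"
  using assms by (cases t) (auto simp: output_tape_def nth_append less_Suc_eq)

lemma represents_stack:
  assumes "represents K ts s" "1 \<le> v" "v \<le> K"
  shows "stack_tape (ts ! (v - 1)) (s v)" "v - 1 < length ts"
proof -
  obtain w where "v = Suc w" using assms(2) by (cases v) auto
  with assms show "stack_tape (ts ! (v - 1)) (s v)" "v - 1 < length ts"
    by (auto simp: represents_def)
qed

lemma represents_read:
  "represents K ts s \<Longrightarrow> 1 \<le> v \<Longrightarrow> v \<le> K \<Longrightarrow> map read_tape ts ! (v - 1) = hd0 (s v)"
  using represents_stack[of K ts s v] read_stack by simp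

lemma represents_update:
  assumes "represents K ts s" "1 \<le> v" "v \<le> K" "stack_tape t xs"
  shows "represents K (ts[v - 1 := t]) (s(v := xs))"
  using assms by (auto simp: represents_def nth_list_update)

lemma funpow_conf_trans:
  assumes "(f ^^ t1) x = y" "f y = y'" "(f ^^ t2) y' = z"
  shows "(f ^^ (t1 + t2 + 1)) x = z"
proof -
  have "(f ^^ (t2 + (1 + t1))) x = z"
    using assms by (simp only: funpow_add) simp
  then show ?thesis by (simp add: add.commute add.left_commute)
qed

text \<open>Induction on the program, with an inner induction on the fuel for loops. A result of
  \<open>den\<close> rules out \<open>Fail\<close>, so the run ends in \<open>Skip\<close>.\<close>

lemma conf_represents:
  assumes "cmd_ok K G c" "den N c s = Some s'" "represents K ts s"
  shows "\<exists>t \<le> cost N c. \<exists>ts'. (conf K ^^ t) (c, ts) = (Skip, ts') \<and> represents K ts' s'"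
  using assms
proof (induction c arbitrary: s s' ts)
  case Skip
  then show ?case by (intro exI[of _ 0]) auto
next
  case (Push v a)
  show ?case
  proof (cases "v = 0")
    case True
    define ts' where "ts' = ts[K := act_tape (a, MoveRight) (ts ! K)]"
    have "conf K (Push v a, ts) = (Skip, ts')"
      using True by (simp add: conf_def ts'_def)
    moreover have "represents K ts' s'"
      using Push.prems True by (auto simp: represents_def ts'_def output_push)
    ultimately show ?thesis
      by (intro exI[of _ 1]) auto
  next
    case False
    define t1 where "t1 = act_tape (read_tape (ts ! (v - 1)), MoveLeft) (ts ! (v - 1))"
    define t2 where "t2 = act_tape (a, Stay) t1"
    have v: "1 \<le> v" "v \<le> K" "length ts = Suc K"
      using False Push.prems by (auto simp: represents_def)
    have "v - 1 < length ts" using v by auto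
    then have 1: "conf K (Push v a, ts) = (Put v a, ts[v - 1 := t1])"
      and 2: "conf K (Put v a, ts[v - 1 := t1]) = (Skip, ts[v - 1 := t2])"
      using False by (simp_all add: conf_def t1_def t2_def)
    have "stack_tape (ts ! (v - 1)) (s v)"
      using represents_stack[OF Push.prems(3) v(1,2)] by simp
    then have "stack_tape t2 (a # s v)"
      unfolding t1_def t2_def by (rule stack_push)
    then have "represents K (ts[v - 1 := t2]) s'"
      using represents_update[OF Push.prems(3) v(1,2), of t2 "a # s v"] Push.prems(2) by simp
    moreover have "(conf K ^^ 2) (Push v a, ts) = (Skip, ts[v - 1 := t2])"
      using 1 2 by (simp add: numeral_2_eq_2)
    ultimately show ?thesis
      by (intro exI[of _ 2]) auto
  qed
next
  case (Pop v)
  define t' where "t' = act_tape (0, MoveRight) (ts ! (v - 1))"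
  have v: "1 \<le> v" "v \<le> K"
    using Pop.prems by auto
  have "stack_tape (ts ! (v - 1)) (s v)"
    using represents_stack[OF Pop.prems(3) v] by simp
  then have "stack_tape t' (tl (s v))"
    unfolding t'_def by (rule stack_pop)
  then have "represents K (ts[v - 1 := t']) s'"
    using represents_update[OF Pop.prems(3) v, of t' "tl (s v)"] Pop.prems(2) by simp
  moreover have "conf K (Pop v, ts) = (Skip, ts[v - 1 := t'])"
    by (simp add: conf_def t'_def)
  ultimately show ?case
    by (intro exI[of _ 1]) auto
next
  case (Seq c d)
  then obtain s1 where s1: "den N c s = Some s1" "den N d s1 = Some s'"
    by (auto simp: bind_eq_Some_conv)
  obtain t1 ts1 where 1: "t1 \<le> cost N c" "(conf K ^^ t1) (c, ts) = (Skip, ts1)" "represents K ts1 s1"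
    using Seq.IH(1)[OF _ s1(1) Seq.prems(3)] Seq.prems by auto
  obtain t2 ts2 where 2: "t2 \<le> cost N d" "(conf K ^^ t2) (d, ts1) = (Skip, ts2)" "represents K ts2 s'"
    using Seq.IH(2)[OF _ s1(2) 1(3)] Seq.prems by auto
  have ne: "ts \<noteq> []" "ts1 \<noteq> []"
    using Seq.prems(3) 1(3) by (auto simp: represents_def)
  obtain t1' where 3: "t1' \<le> t1" "(conf K ^^ t1') (c ;; d, ts) = (Skip ;; d, ts1)"
    using conf_Seq[OF 1(2) ne(1)] by blast
  have "conf K (Skip ;; d, ts1) = (d, ts1)"
    using ne by (intro conf_no_action) auto
  from funpow_conf_trans[OF 3(2) this 2(2)]
  have "(conf K ^^ (t1' + t2 + 1)) (c ;; d, ts) = (Skip, ts2)" .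
  with 1 2 3 show ?case
    by (intro exI[of _ "t1' + t2 + 1"]) auto
next
  case (IfTop v A c d)
  define e where "e = (if hd0 (s v) \<in> A then c else d)"
  have e: "den N e s = Some s'" "cmd_ok K G e" "cost N e \<le> cost N c + cost N d"
    using IfTop.prems by (auto simp: e_def split: if_splits)
  obtain t ts' where t: "t \<le> cost N e" "(conf K ^^ t) (e, ts) = (Skip, ts')" "represents K ts' s'"
    using IfTop.IH(1)[of s s' ts] IfTop.IH(2)[of s s' ts] IfTop.prems(3) e
    by (auto simp: e_def split: if_splits)
  have "ts \<noteq> []"
    using IfTop.prems(3) by (auto simp: represents_def)
  then have "conf K (IfTop v A c d, ts) = (e, ts)"
    using represents_read[OF IfTop.prems(3), of v] IfTop.prems(1)
    by (intro conf_no_action) (auto simp: e_def)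
  from funpow_conf_trans[where ?t1.0 = 0, OF _ this t(2)]
  have "(conf K ^^ (t + 1)) (IfTop v A c d, ts) = (Skip, ts')"
    by simp
  moreover have "t + 1 \<le> cost N (IfTop v A c d)"
    using t(1) e(3) by simp
  ultimately show ?case using t(3) by blast
next
  case (WhileTop v A c)
  let ?w = "WhileTop v A c"
  \<comment> \<open>Each iteration costs two steps beyond its body: one unfolds the loop, one drops
    the \<open>Skip\<close> left by the body. The extra round in \<open>k + 1\<close> pays for the
    last test.\<close>
  have *: "\<exists>t \<le> (k + 1) * (cost N c + 2). \<exists>ts'. (conf K ^^ t) (?w, ts) = (Skip, ts') \<and> represents K ts' s'"
    if "loop_den k (den N c) v A s = Some s'" "represents K ts s" for k s s' ts
    using that
  proof (induction k arbitrary: s ts)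
    case (0 s ts)
    then have "ts \<noteq> []" by (auto simp: represents_def)
    then have "conf K (?w, ts) = (Skip, ts)"
      using 0 represents_read[OF 0(2), of v] WhileTop.prems(1)
      by (intro conf_no_action) (auto split: if_splits)
    with 0 show ?case
      by (intro exI[of _ 1]) (auto split: if_splits)
  next
    case (Suc k s ts)
    have ne: "ts \<noteq> []" using Suc.prems(2) by (auto simp: represents_def)
    show ?case
    proof (cases "hd0 (s v) \<in> A")
      case False
      then have "conf K (?w, ts) = (Skip, ts)"
        using Suc.prems ne represents_read[OF Suc.prems(2), of v] WhileTop.prems(1)
        by (intro conf_no_action) (auto split: if_splits)
      with Suc.prems False show ?thesis
        by (intro exI[of _ 1]) auto
    next
      case True
      then obtain s1 where s1: "den N c s = Some s1" "loop_den k (den N c) v A s1 = Some s'"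
        using Suc.prems by (auto simp: bind_eq_Some_conv)
      obtain t1 ts1 where 1: "t1 \<le> cost N c" "(conf K ^^ t1) (c, ts) = (Skip, ts1)" "represents K ts1 s1"
        using WhileTop.IH[OF _ s1(1) Suc.prems(2)] WhileTop.prems by auto
      obtain t2 ts2 where 2: "t2 \<le> (k + 1) * (cost N c + 2)" "(conf K ^^ t2) (?w, ts1) = (Skip, ts2)"
        "represents K ts2 s'"
        using Suc.IH[OF s1(2) 1(3)] by auto
      obtain t1' where 3: "t1' \<le> t1" "(conf K ^^ t1') (c ;; ?w, ts) = (Skip ;; ?w, ts1)"
        using conf_Seq[OF 1(2) ne] by blast
      have "ts1 \<noteq> []" using 1(3) by (auto simp: represents_def)
      then have "conf K (Skip ;; ?w, ts1) = (?w, ts1)"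
        by (intro conf_no_action) auto
      from funpow_conf_trans[OF 3(2) this 2(2)]
      have 4: "(conf K ^^ (t1' + t2 + 1)) (c ;; ?w, ts) = (Skip, ts2)" .
      have "conf K (?w, ts) = (c ;; ?w, ts)"
        using True ne represents_read[OF Suc.prems(2), of v] WhileTop.prems(1)
        by (intro conf_no_action) auto
      from funpow_conf_trans[where ?t1.0 = 0, OF _ this 4]
      have "(conf K ^^ (t1' + t2 + 1 + 1)) (?w, ts) = (Skip, ts2)"
        by simp
      moreover have "t1' + t2 + 1 + 1 \<le> (Suc k + 1) * (cost N c + 2)"
        using 1(1) 2(1) 3(1) by simp
      ultimately show ?thesis using 2(3) by blast
    qed
  qed
  from WhileTop.prems *[of N s s' ts] show ?case by simp
qed auto

text \<open>The states of the machine are the commands reachable from the program.\<close>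

definition compile :: "nat \<Rightarrow> nat \<Rightarrow> cmd set \<Rightarrow> (cmd \<Rightarrow> nat) \<Rightarrow> machine" where
  "compile K G D e =
     \<lparr>num_tapes = Suc K, num_states = Suc (Max (e ` D)), num_symbols = G,
      delta = \<lambda>q as. if q \<in> e ` D then
          (case cstep K as (inv_into D e q) of (c', i, a, d) \<Rightarrow>
            (e c', map (\<lambda>j. if j = i then (a, d) else (as ! j, Stay)) [0..<Suc K]))
        else (1, map (\<lambda>a. (a, Stay)) as)\<rparr>"

text \<open>The machine model fixes the meaning of states 0, 1 and 2; all commands without a
  prescribed number are moved beyond these by adding 3.\<close>

lemma state_numbering:
  assumes "finite D" "c0 \<noteq> Skip" "c0 \<noteq> Fail"
  obtains e :: "cmd \<Rightarrow> nat" where "inj_on e D" "e c0 = 0" "e Skip = 1" "e Fail = 2"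
    "\<And>c. c \<in> D \<Longrightarrow> e c \<in> {1, 2} \<Longrightarrow> c \<in> {Skip, Fail}"
proof -
  obtain g :: "cmd \<Rightarrow> nat" where g: "inj_on g D"
    using finite_imp_inj_to_nat_seg[OF assms(1)] by blast
  define e where "e c = (if c = c0 then 0 else if c = Skip then 1 else if c = Fail then 2 else g c + 3)" for c
  have "inj_on e D"
    using g by (auto simp: inj_on_def e_def)
  moreover have "e c0 = 0" "e Skip = 1" "e Fail = 2"
    using assms by (auto simp: e_def)
  moreover have "c \<in> {Skip, Fail}" if "e c \<in> {1, 2}" for c
    using that by (simp add: e_def split: if_splits)
  ultimately show thesis
    by (intro that[of e]) blast+
qed

text \<open>Machine and \<open>conf\<close> proceed in lockstep. The halting commands are fixed
  points of \<open>conf\<close>, just as states 1 and 2 are fixed points of \<open>step\<close>, so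
  the correspondence holds at all times, also after halting.\<close>

lemma compile_run:
  assumes ok: "cmd_ok K G c0" "4 \<le> G" "1 \<le> K" and c0: "c0 \<noteq> Skip" "c0 \<noteq> Fail"
  shows "\<exists>M. turing_machine M \<and> num_tapes M = Suc K \<and>
    (\<forall>t w. \<exists>q. run M t w = (q, snd ((conf K ^^ t) (c0, snd (initial M w)))) \<and>
       (fst ((conf K ^^ t) (c0, snd (initial M w))) = Skip \<longrightarrow> q = 1) \<and>
       (fst ((conf K ^^ t) (c0, snd (initial M w))) = Fail \<longrightarrow> q = 2))"
proof -
  define D where "D = reach c0 \<union> {Skip, Fail}"
  have fin: "finite D" by (simp add: D_def finite_reach)
  have D0: "c0 \<in> D" by (simp add: D_def reach_self)
  have Dstep: "fst (cstep K rs c) \<in> D" if "c \<in> D" for c rs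
    using that reach_cstep[of c c0 K rs] by (auto simp: D_def)
  have Dok: "cmd_ok K G c" if "c \<in> D" for c
    using that cmd_ok_reach[OF ok(1)] unfolding D_def by fastforce
  obtain e :: "cmd \<Rightarrow> nat" where e: "inj_on e D" "e c0 = 0" "e Skip = 1" "e Fail = 2"
    "\<And>c. c \<in> D \<Longrightarrow> e c \<in> {1, 2} \<Longrightarrow> c \<in> {Skip, Fail}"
    using state_numbering[OF fin c0] by blast
  define M where "M = compile K G D e"
  have M: "num_tapes M = Suc K" "num_states M = Suc (Max (e ` D))" "num_symbols M = G"
    by (simp_all add: M_def compile_def)
  have delta: "delta M (e c) as = (case cstep K as c of (c', i, a, d) \<Rightarrow>
      (e c', map (\<lambda>j. if j = i then (a, d) else (as ! j, Stay)) [0..<Suc K]))" if "c \<in> D" for c as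
    using that e(1) by (auto simp: M_def compile_def simp del: upt_Suc split: prod.splits)
  have bound: "e c < num_states M" if "c \<in> D" for c
    using that fin by (simp add: M le_imp_less_Suc)
  have three: "3 \<le> num_states M"
    using bound[of Fail] e by (simp add: D_def)
  have tm: "turing_machine M"
  proof -
    have "case delta M q as of (q', acts) \<Rightarrow> q' < num_states M \<and> length acts = num_tapes M \<and>
        (\<forall>(a, d) \<in> set acts. a < num_symbols M)"
      if as: "length as = num_tapes M" "set as \<subseteq> {..<num_symbols M}" for q as
    proof (cases "q \<in> e ` D")
      case True
      then obtain c where c: "c \<in> D" "q = e c" by blast
      obtain c' i a d where cs: "cstep K as c = (c', i, a, d)"
        by (cases "cstep K as c") auto
      have "c' \<in> D" using Dstep[OF c(1), of as] cs by simp
      moreover have "a < G"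
        using cstep_symbol[OF Dok[OF c(1)] cs] as ok M by auto
      ultimately show ?thesis
        using as bound c cs by (auto simp: delta M subset_iff simp del: upt_Suc)
    next
      case False
      then have "delta M q as = (1, map (\<lambda>a. (a, Stay)) as)"
        by (simp add: M_def compile_def)
      with as three show ?thesis by auto
    qed
    then show ?thesis
      using three ok by (auto simp: turing_machine_def M(1,3))
  qed
  have step: "step M (e c, ts) = (e (fst (conf K (c, ts))), snd (conf K (c, ts)))"
    if c: "c \<in> D" and ts: "length ts = Suc K" for c ts
  proof (cases "c \<in> {Skip, Fail}")
    case True
    with ts have "conf K (c, ts) = (c, ts)"
      by (intro conf_no_action) auto
    with True e show ?thesis by auto
  next
    case False
    with e(5) c have q: "e c \<noteq> 1" "e c \<noteq> 2" by auto
    obtain c' i a d where cs: "cstep K (map read_tape ts) c = (c', i, a, d)"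
      by (cases "cstep K (map read_tape ts) c") auto
    have "map2 act_tape (map (\<lambda>j. if j = i then (a, d) else (map read_tape ts ! j, Stay)) [0..<Suc K]) ts
        = ts[i := act_tape (a, d) (ts ! i)]"
      using ts by (intro nth_equalityI) (auto simp del: upt_Suc simp: nth_list_update)
    then show ?thesis
      using q c cs by (simp add: delta conf_def del: upt_Suc)
  qed
  have len: "length (snd (initial M w)) = Suc K" for w
    by (simp add: initial_def M)
  have main: "run M t w = (e (fst ((conf K ^^ t) (c0, snd (initial M w)))),
      snd ((conf K ^^ t) (c0, snd (initial M w)))) \<and>
      fst ((conf K ^^ t) (c0, snd (initial M w))) \<in> D \<and>
      length (snd ((conf K ^^ t) (c0, snd (initial M w)))) = Suc K" for t w
  proof (induction t)
    case 0
    show ?case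
      using D0 len e by (simp add: run_def) (simp add: initial_def)
  next
    case (Suc t)
    obtain c ts where cts: "(conf K ^^ t) (c0, snd (initial M w)) = (c, ts)" by fastforce
    with Suc have *: "run M t w = (e c, ts)" "c \<in> D" "length ts = Suc K" by auto
    moreover have "fst (conf K (c, ts)) \<in> D"
      using Dstep[OF *(2), of "map read_tape ts"] by (auto simp: conf_def split: prod.splits)
    ultimately show ?case
      using cts step[OF *(2,3)] conf_length[of K c ts] by (simp add: run_def)
  qed
  show ?thesis
    using tm main e M by (intro exI[of _ M]) auto
qed

section \<open>Polynomial-time functions and relations from programs\<close>

definition input_store :: "nat list \<Rightarrow> store" where
  "input_store w = (\<lambda>v. if v = 1 then w else [])"

lemma represents_initial:
  assumes "num_tapes M = Suc K" "1 \<le> K"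
  shows "represents K (snd (initial M w)) (input_store w)"
proof -
  have ts: "snd (initial M w) ! v = word_tape (if v = 0 then w else [])" if "v \<le> K" for v
    using that assms by (cases v) (auto simp: initial_def)
  have word: "stack_tape (word_tape w) w" for w
    by (simp add: stack_tape_def word_tape_def)
  have "output_tape (word_tape []) []"
    by (simp add: output_tape_def word_tape_def)
  moreover have "length (snd (initial M w)) = Suc K"
    using assms by (simp add: initial_def)
  ultimately show ?thesis
    using assms(2) word by (auto simp: represents_def ts input_store_def)
qed

lemma output_has_output:
  assumes "represents K ts s" "s 0 = rev w" "0 \<notin> set w"
  shows "has_output (q, ts) w"
proof -
  have "ts \<noteq> []" "last ts = ts ! K"
    using assms(1) by (auto simp: represents_def last_conv_nth simp flip: length_greater_0_conv)
  with assms show ?thesis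
    by (auto simp: has_output_def represents_def output_tape_def)
qed

lemma polytime_funI:
  fixes p :: "nat poly"
  assumes wf: "wf_cmd c" and den: "\<And>x. \<exists>s. den (poly p (length x)) c (input_store (bits x)) = Some s \<and>
    s 0 = rev (bits (f x))"
  shows "polytime_fun f"
proof -
  \<comment> \<open>The prefix makes the initial command different from the two halting commands,
    which already own states 1 and 2.\<close>
  define c0 where "c0 = (Skip ;; c)"
  obtain K0 G0 where "cmd_ok K0 G0 c"
    using cmd_ok_exists[OF wf] by blast
  then obtain K G where ok: "cmd_ok K G c0" "4 \<le> G" "1 \<le> K"
    using cmd_ok_mono[of K0 G0 c "max K0 1" "max G0 4"] by (auto simp: c0_def)
  obtain M where M: "turing_machine M" "num_tapes M = Suc K" and
    run: "\<And>t w. \<exists>q. run M t w = (q, snd ((conf K ^^ t) (c0, snd (initial M w)))) \<and>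
       (fst ((conf K ^^ t) (c0, snd (initial M w))) = Skip \<longrightarrow> q = 1) \<and>
       (fst ((conf K ^^ t) (c0, snd (initial M w))) = Fail \<longrightarrow> q = 2)"
  proof -
    have "c0 \<noteq> Skip" "c0 \<noteq> Fail" by (simp_all add: c0_def)
    from compile_run[OF ok this] that show thesis by blast
  qed
  obtain r :: "nat poly" where r: "\<And>N. cost N c0 \<le> poly r N"
    using cost_poly by blast
  have "\<exists>t \<le> poly (pcompose r p) (length x).
      fst (run M t (bits x)) = 1 \<and> has_output (run M t (bits x)) (bits (f x))" for x
  proof -
    let ?N = "poly p (length x)"
    obtain s where s: "den ?N c0 (input_store (bits x)) = Some s" "s 0 = rev (bits (f x))"
      using den[of x] by (auto simp: c0_def)
    obtain t ts where t: "t \<le> cost ?N c0"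
      "(conf K ^^ t) (c0, snd (initial M (bits x))) = (Skip, ts)" "represents K ts s"
      using conf_represents[OF ok(1) s(1) represents_initial[OF M(2) ok(3)]] by blast
    have "0 \<notin> set (bits (f x))"
      by (auto simp: bits_def)
    then have "has_output (1, ts) (bits (f x))"
      using output_has_output[OF t(3) s(2)] by simp
    moreover have "run M t (bits x) = (1, ts)"
      using run[of t "bits x"] t(2) by auto
    moreover have "t \<le> poly (pcompose r p) (length x)"
      using t(1) r[of ?N] by (simp add: poly_pcompose)
    ultimately show ?thesis by auto
  qed
  then show ?thesis
    unfolding polytime_fun_def by (intro exI[of _ M] exI[of _ "pcompose r p"]) (simp add: M)
qed

lemma polytime_relI:
  fixes p :: "nat poly"
  assumes wf: "wf_cmd c" "1 \<le> v"
    and den: "\<And>x u. \<exists>s. den (poly p (length (pair x u))) c (input_store (pair x u)) = Some s \<and>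
      (Q x u \<longleftrightarrow> hd0 (s v) \<in> A)"
  shows "polytime_rel Q"
proof -
  \<comment> \<open>\<open>den\<close> yields no result for \<open>Fail\<close>. The program
    therefore leaves its verdict in variable \<open>v\<close>, and only the appended test turns it
    into a halting state; the steps of this test are followed in \<open>conf\<close>
    directly.\<close>
  define c0 where "c0 = (c ;; IfTop v A Skip Fail)"
  obtain K0 G0 where "cmd_ok K0 G0 c0"
    using cmd_ok_exists[of c0] wf by (auto simp: c0_def)
  then obtain K G where ok: "cmd_ok K G c0" "4 \<le> G" "1 \<le> K"
    using cmd_ok_mono[of K0 G0 c0 "max K0 1" "max G0 4"] by auto
  then have okc: "cmd_ok K G c" and v: "1 \<le> v" "v \<le> K"
    by (auto simp: c0_def)
  obtain M where M: "turing_machine M" "num_tapes M = Suc K" and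
    run: "\<And>t w. \<exists>q. run M t w = (q, snd ((conf K ^^ t) (c0, snd (initial M w)))) \<and>
       (fst ((conf K ^^ t) (c0, snd (initial M w))) = Skip \<longrightarrow> q = 1) \<and>
       (fst ((conf K ^^ t) (c0, snd (initial M w))) = Fail \<longrightarrow> q = 2)"
  proof -
    have "c0 \<noteq> Skip" "c0 \<noteq> Fail" by (simp_all add: c0_def)
    from compile_run[OF ok this] that show thesis by blast
  qed
  obtain r :: "nat poly" where r: "\<And>N. cost N c0 \<le> poly r N"
    using cost_poly by blast
  have "\<exists>t \<le> poly (pcompose r p) (length (pair x u)).
      fst (run M t (pair x u)) = (if Q x u then 1 else 2)" for x u
  proof -
    let ?N = "poly p (length (pair x u))"
    let ?e = "IfTop v A Skip Fail"
    obtain s where s: "den ?N c (input_store (pair x u)) = Some s" "Q x u \<longleftrightarrow> hd0 (s v) \<in> A"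
      using den[of x u] by auto
    have init: "represents K (snd (initial M (pair x u))) (input_store (pair x u))"
      by (rule represents_initial[OF M(2) ok(3)])
    obtain t ts where t: "t \<le> cost ?N c"
      "(conf K ^^ t) (c, snd (initial M (pair x u))) = (Skip, ts)" "represents K ts s"
      using conf_represents[OF okc s(1) init] by blast
    have ne: "snd (initial M (pair x u)) \<noteq> []" "ts \<noteq> []"
      using init t(3) by (auto simp: represents_def)
    obtain t' where t': "t' \<le> t" "(conf K ^^ t') (c0, snd (initial M (pair x u))) = (Skip ;; ?e, ts)"
      using conf_Seq[OF t(2) ne(1)] unfolding c0_def by blast
    have "conf K (Skip ;; ?e, ts) = (?e, ts)"
      using ne by (intro conf_no_action) auto
    moreover have "conf K (?e, ts) = (if Q x u then Skip else Fail, ts)"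
      using ne represents_read[OF t(3) v] s(2) by (intro conf_no_action) auto
    ultimately have *: "(conf K ^^ (t' + 1 + 1)) (c0, snd (initial M (pair x u))) = (if Q x u then Skip else Fail, ts)"
      using funpow_conf_trans[OF t'(2), of "(?e, ts)" 1] by simp
    have "fst (run M (t' + 1 + 1) (pair x u)) = (if Q x u then 1 else 2)"
      using run[of "t' + 1 + 1" "pair x u"] unfolding * by (auto split: if_splits)
    moreover have "t' + 1 + 1 \<le> cost ?N c0"
      using t(1) t'(1) by (simp add: c0_def)
    ultimately show ?thesis
      using r[of ?N] by (intro exI[of _ "t' + 1 + 1"]) (auto simp: poly_pcompose intro: order_trans)
  qed
  then show ?thesis
    unfolding polytime_rel_def by (intro exI[of _ M] exI[of _ "pcompose r p"]) (simp add: M)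
qed

section \<open>Clauses describing a run of a Turing machine\<close>

text \<open>
  The tapes are described relative to the position of the head: \<open>SR j a\<close> at time \<open>t\<close> and index \<open>i\<close>
  says that the cell \<open>i\<close> places to the right of the head of tape \<open>j\<close> contains \<open>a\<close>, and \<open>SL j a\<close> that
  the cell \<open>i + 1\<close> places to the left of it does. A move of the head is a shift of all indices, so
  that no variables for head positions are needed.
\<close>

datatype symb = SQ nat | SAct nat nat dir | SL nat nat | SR nat nat

instance dir :: countable
  by countable_datatype

instance symb :: countable
  by countable_datatype

type_synonym literal = "bool \<times> symb \<times> nat \<times> nat"

text \<open>
  Clauses are instances of templates at a time \<open>t\<close> and an index \<open>i\<close>. In a template the time is
  relative to \<open>t\<close>; the indices 0 and 1 are absolute and the index \<open>d + 2\<close> stands for \<open>i + d\<close>.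
\<close>

definition instantiate :: "nat \<Rightarrow> nat \<Rightarrow> literal list \<Rightarrow> literal list" where
  "instantiate t i = map (\<lambda>(s, \<sigma>, dt, di). (s, \<sigma>, t + dt, if di < 2 then di else i + (di - 2)))"

abbreviation neg :: "symb \<Rightarrow> nat \<Rightarrow> nat \<Rightarrow> literal" where
  "neg \<sigma> dt di \<equiv> (False, \<sigma>, dt, di)"

abbreviation pos :: "symb \<Rightarrow> nat \<Rightarrow> nat \<Rightarrow> literal" where
  "pos \<sigma> dt di \<equiv> (True, \<sigma>, dt, di)"

definition sat_clause :: "(symb \<Rightarrow> nat \<Rightarrow> nat \<Rightarrow> bool) \<Rightarrow> literal list \<Rightarrow> bool" where
  "sat_clause v c \<longleftrightarrow> (\<exists>(s, \<sigma>, t, i) \<in> set c. v \<sigma> t i = s)"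

lemma sat_clause_simps [simp]:
  "sat_clause v [] \<longleftrightarrow> False"
  "sat_clause v ((s, \<sigma>, t, i) # c) \<longleftrightarrow> v \<sigma> t i = s \<or> sat_clause v c"
  "sat_clause v (c @ c') \<longleftrightarrow> sat_clause v c \<or> sat_clause v c'"
  by (auto simp: sat_clause_def)

lemma instantiate_simps [simp]:
  "instantiate t i [] = []"
  "instantiate t i ((s, \<sigma>, dt, di) # c) =
     (s, \<sigma>, t + dt, if di < 2 then di else i + (di - 2)) # instantiate t i c"
  "instantiate t i (c @ c') = instantiate t i c @ instantiate t i c'"
  by (simp_all add: instantiate_def)

text \<open>Halting states become explicit loops, so that a run which halts early is described by
  the same clauses up to time \<open>T\<close>.\<close>

definition transition :: "machine \<Rightarrow> nat \<Rightarrow> nat list \<Rightarrow> nat \<times> (nat \<times> dir) list" where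
  "transition M q as = (if q = 1 \<or> q = 2 then (q, map (\<lambda>a. (a, Stay)) as) else delta M q as)"

text \<open>Only here do the symbols under all heads occur together. The resulting action is
  recorded per tape in \<open>SAct\<close>, which allows the clauses about cells to treat each tape
  separately.\<close>

definition scan_clauses :: "machine \<Rightarrow> nat \<Rightarrow> nat list \<Rightarrow> literal list list" where
  "scan_clauses M q as =
     (let prem = neg (SQ q) 0 0 # map (\<lambda>j. neg (SR j (as ! j)) 0 0) [0..<num_tapes M];
          q' = fst (transition M q as); acts = snd (transition M q as)
      in (prem @ [pos (SQ q') 1 0]) #
         map (\<lambda>j. prem @ [pos (SAct j (fst (acts ! j)) (snd (acts ! j))) 0 0]) [0..<num_tapes M])"

definition write_clauses :: "nat \<Rightarrow> nat \<Rightarrow> literal list list" where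
  "write_clauses j b =
     [[neg (SAct j b MoveRight) 0 0, pos (SL j b) 1 0],
      [neg (SAct j b Stay) 0 0, pos (SR j b) 1 0],
      [neg (SAct j b MoveLeft) 0 0, pos (SR j b) 1 1]]"

text \<open>The indices 2, 3, 4 stand for \<open>i\<close>, \<open>i + 1\<close>,
  \<open>i + 2\<close>. Cells to the right are taken from \<open>i + 1\<close> on because the cell
  under the head is overwritten and belongs to \<open>write_clauses\<close>. The last clause is the
  boundary case of a left move: the nearest left cell comes under the head.\<close>

definition move_clauses :: "nat \<Rightarrow> nat \<Rightarrow> nat \<Rightarrow> literal list list" where
  "move_clauses j b a =
     [[neg (SAct j b MoveRight) 0 0, neg (SR j a) 0 3, pos (SR j a) 1 2],
      [neg (SAct j b MoveRight) 0 0, neg (SL j a) 0 2, pos (SL j a) 1 3],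
      [neg (SAct j b Stay) 0 0, neg (SR j a) 0 3, pos (SR j a) 1 3],
      [neg (SAct j b Stay) 0 0, neg (SL j a) 0 2, pos (SL j a) 1 2],
      [neg (SAct j b MoveLeft) 0 0, neg (SR j a) 0 3, pos (SR j a) 1 4],
      [neg (SAct j b MoveLeft) 0 0, neg (SL j a) 0 3, pos (SL j a) 1 2],
      [neg (SAct j b MoveLeft) 0 0, neg (SL j a) 0 0, pos (SR j a) 1 0]]"

definition step_clauses :: "machine \<Rightarrow> literal list list" where
  "step_clauses M =
     concat (map (\<lambda>q. concat (map (scan_clauses M q) (List.n_lists (num_tapes M) [0..<num_symbols M])))
       [0..<num_states M]) @
     concat (map (\<lambda>j. concat (map (\<lambda>b. write_clauses j b @
         concat (map (move_clauses j b) [0..<num_symbols M])) [0..<num_symbols M])) [0..<num_tapes M])"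

definition guess_clauses :: "literal list list" where
  "guess_clauses =
     [[pos (SR 0 0) 0 2, pos (SR 0 1) 0 2, pos (SR 0 2) 0 2], [neg (SR 0 0) 0 2, pos (SR 0 0) 0 3]]"

definition blank_clauses :: "machine \<Rightarrow> literal list list" where
  "blank_clauses M =
     map (\<lambda>j. [pos (SR j 0) 0 2]) [1..<num_tapes M] @ map (\<lambda>j. [pos (SL j 0) 0 2]) [0..<num_tapes M]"

text \<open>Excluding all other states, rather than asking for state 1, is what forces acceptance:
  the state of the actual run is true in any case, but a satisfying valuation could make state 1
  true besides it.\<close>

definition final_clauses :: "machine \<Rightarrow> literal list list" where
  "final_clauses M = map (\<lambda>q. [neg (SQ q) 0 0]) (filter (\<lambda>q. q \<noteq> 1) [0..<num_states M])"

definition inst_all :: "nat \<Rightarrow> nat \<Rightarrow> literal list list \<Rightarrow> literal list list" where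
  "inst_all t i = map (instantiate t i)"

text \<open>\<open>w\<close> is the fixed part of the input and \<open>m\<close> cells are left for
  the certificate. The padding by \<open>T\<close> blanks covers every cell that can matter within
  \<open>T\<close> steps.\<close>

definition input_clauses :: "nat list \<Rightarrow> nat \<Rightarrow> nat \<Rightarrow> literal list list" where
  "input_clauses w m T =
     [pos (SQ 0) 0 0] #
     concat (map (\<lambda>i. inst_all 0 i [[pos (SR 0 (w ! i)) 0 2]]) [0..<length w]) @
     concat (map (\<lambda>i. inst_all 0 i guess_clauses) [length w..<length w + m]) @
     concat (map (\<lambda>i. inst_all 0 i [[pos (SR 0 0) 0 2]]) [length w + m..<length w + m + T])"

definition run_clauses :: "machine \<Rightarrow> nat list \<Rightarrow> nat \<Rightarrow> nat \<Rightarrow> literal list list" where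
  "run_clauses M w m T =
     input_clauses w m T @
     concat (map (\<lambda>i. inst_all 0 i (blank_clauses M)) [0..<T]) @
     concat (map (\<lambda>t. concat (map (\<lambda>i. inst_all t i (step_clauses M)) [0..<T])) [0..<T]) @
     inst_all T 0 (final_clauses M)"

lemma ball_input_clauses:
  "(\<forall>c \<in> set (input_clauses w m T). P c) \<longleftrightarrow> P [pos (SQ 0) 0 0] \<and>
     (\<forall>i < length w. P [pos (SR 0 (w ! i)) 0 i]) \<and>
     (\<forall>i. length w \<le> i \<and> i < length w + m \<longrightarrow> (\<forall>c \<in> set guess_clauses. P (instantiate 0 i c))) \<and>
     (\<forall>i. length w + m \<le> i \<and> i < length w + m + T \<longrightarrow> P [pos (SR 0 0) 0 i])"
  by (auto simp: input_clauses_def inst_all_def ball_Un)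

lemma ball_run_clauses:
  "(\<forall>c \<in> set (run_clauses M w m T). P c) \<longleftrightarrow> (\<forall>c \<in> set (input_clauses w m T). P c) \<and>
     (\<forall>i < T. \<forall>c \<in> set (blank_clauses M). P (instantiate 0 i c)) \<and>
     (\<forall>t < T. \<forall>i < T. \<forall>c \<in> set (step_clauses M). P (instantiate t i c)) \<and>
     (\<forall>c \<in> set (final_clauses M). P (instantiate T 0 c))"
  by (auto simp: run_clauses_def inst_all_def ball_Un)

definition accept_clause :: "nat \<Rightarrow> literal list" where
  "accept_clause T = instantiate T 0 [pos (SQ 1) 0 0]"

section \<open>Cells seen from the head, and configurations within bounds\<close>

fun right_cell :: "tape \<Rightarrow> nat \<Rightarrow> nat" where
  "right_cell (c, h) i = c (h + int i)"

fun left_cell :: "tape \<Rightarrow> nat \<Rightarrow> nat" where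
  "left_cell (c, h) i = c (h - 1 - int i)"

lemma right_cell_0: "right_cell tp 0 = read_tape tp"
  by (cases tp) simp

text \<open>The shifts of indices that \<open>write_clauses\<close> and \<open>move_clauses\<close>
  express, one equation for each.\<close>

lemma cell_act_tape:
  "right_cell (act_tape (b, MoveRight) tp) i = right_cell tp (Suc i)"
  "left_cell (act_tape (b, MoveRight) tp) 0 = b"
  "left_cell (act_tape (b, MoveRight) tp) (Suc i) = left_cell tp i"
  "right_cell (act_tape (b, Stay) tp) 0 = b"
  "right_cell (act_tape (b, Stay) tp) (Suc i) = right_cell tp (Suc i)"
  "left_cell (act_tape (b, Stay) tp) i = left_cell tp i"
  "right_cell (act_tape (b, MoveLeft) tp) 0 = left_cell tp 0"
  "right_cell (act_tape (b, MoveLeft) tp) (Suc 0) = b"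
  "right_cell (act_tape (b, MoveLeft) tp) (Suc (Suc i)) = right_cell tp (Suc i)"
  "left_cell (act_tape (b, MoveLeft) tp) i = left_cell tp (Suc i)"
  by (cases tp; simp add: algebra_simps)+

lemma step_trans:
  assumes "length ts = num_tapes M"
  shows "step M (q, ts) = (fst (transition M q (map read_tape ts)),
    map2 act_tape (snd (transition M q (map read_tape ts))) ts)"
proof (cases "q = 1 \<or> q = 2")
  case True
  have "map2 act_tape (map (\<lambda>a. (a, Stay)) (map read_tape ts)) ts = ts"
    by (rule nth_equalityI) auto
  with True show ?thesis by (simp add: transition_def)
qed (simp add: transition_def split: prod.split)

text \<open>Clauses exist only for states and symbols below the bounds of \<open>M\<close>; this
  invariant guarantees that they cover every configuration of the run.\<close>

definition config_ok :: "machine \<Rightarrow> config \<Rightarrow> bool" where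
  "config_ok M C \<longleftrightarrow> fst C < num_states M \<and> length (snd C) = num_tapes M \<and>
     (\<forall>tp \<in> set (snd C). \<forall>i. fst tp i < num_symbols M)"

lemma trans_ok:
  assumes "turing_machine M" "q < num_states M" "length as = num_tapes M" "set as \<subseteq> {..<num_symbols M}"
  shows "fst (transition M q as) < num_states M" "length (snd (transition M q as)) = num_tapes M"
    "\<forall>x \<in> set (snd (transition M q as)). fst x < num_symbols M"
proof -
  have "case delta M q as of (q', acts) \<Rightarrow> q' < num_states M \<and> length acts = num_tapes M \<and>
      (\<forall>(a, d) \<in> set acts. a < num_symbols M)"
    using assms by (simp add: turing_machine_def)
  then show "fst (transition M q as) < num_states M" "length (snd (transition M q as)) = num_tapes M"
    "\<forall>x \<in> set (snd (transition M q as)). fst x < num_symbols M"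
    using assms by (auto simp: transition_def split: prod.splits)
qed

lemma reads_ok:
  assumes "config_ok M (q, ts)"
  shows "length (map read_tape ts) = num_tapes M" "set (map read_tape ts) \<subseteq> {..<num_symbols M}"
  using assms by (auto simp: config_ok_def)

lemma config_ok_step:
  assumes "turing_machine M" "config_ok M C"
  shows "config_ok M (step M C)"
proof -
  obtain q ts where C: "C = (q, ts)" by (cases C)
  let ?as = "map read_tape ts"
  note r = reads_ok[OF assms(2)[unfolded C]]
  have q: "q < num_states M" and len: "length ts = num_tapes M"
    and cells: "\<And>j i. j < num_tapes M \<Longrightarrow> fst (ts ! j) i < num_symbols M"
    using assms(2) by (auto simp: C config_ok_def)
  note t = trans_ok[OF assms(1) q r]
  have "fst (act_tape (snd (transition M q ?as) ! j) (ts ! j)) i < num_symbols M" if "j < num_tapes M" for i j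
  proof -
    obtain a d where ad: "snd (transition M q ?as) ! j = (a, d)" by fastforce
    have "snd (transition M q ?as) ! j \<in> set (snd (transition M q ?as))"
      using t(2) that by simp
    with ad t(3) have "a < num_symbols M" by fastforce
    with cells[OF that] ad show ?thesis by (cases "ts ! j") auto
  qed
  then have "\<forall>tp \<in> set (map2 act_tape (snd (transition M q ?as)) ts). \<forall>i. fst tp i < num_symbols M"
    using t(2) len unfolding all_set_conv_all_nth by simp
  then show ?thesis
    using t len by (simp add: C step_trans config_ok_def del: step.simps)
qed

lemma config_ok_run:
  assumes "turing_machine M" "set w \<subseteq> {..<4}"
  shows "config_ok M (run M t w)"
proof (induction t)
  case 0
  have "\<forall>a \<in> set w. a < num_symbols M" "0 < num_symbols M"
    using assms by (auto simp: turing_machine_def)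
  then show ?case
    using assms(1)
    by (auto simp: run_def initial_def config_ok_def word_tape_def turing_machine_def)
next
  case (Suc t)
  then show ?case
    using config_ok_step[OF assms(1)] by (simp add: run_def)
qed

lemma run_Suc:
  assumes "config_ok M (run M t w)" "run M t w = (q, ts)"
  shows "run M (Suc t) w = (fst (transition M q (map read_tape ts)),
    map2 act_tape (snd (transition M q (map read_tape ts))) ts)"
proof -
  have "run M (Suc t) w = step M (run M t w)"
    by (simp add: run_def)
  also have "\<dots> = step M (q, ts)"
    using assms by simp
  finally show ?thesis
    using step_trans[of ts M q] assms by (simp add: config_ok_def del: step.simps)
qed

text \<open>A verifier halts at some time below a bound; since nothing changes afterwards, its
  verdict can be read at the bound itself, which does not depend on the certificate.\<close>

lemma run_halted:
  assumes "fst (run M t w) \<in> {1, 2}" "t \<le> t'"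
  shows "run M t' w = run M t w"
proof -
  have "(step M ^^ n) (run M t w) = run M t w" for n
  proof (induction n)
    case (Suc n)
    then show ?case using assms(1) by (cases "run M t w") auto
  qed simp
  from this[of "t' - t"] have "(step M ^^ (t' - t + t)) (initial M w) = run M t w"
    by (simp add: run_def funpow_add)
  with assms(2) show ?thesis by (simp add: run_def)
qed

lemma initial_cells:
  assumes "1 \<le> num_tapes M" "j < num_tapes M"
  shows "right_cell (snd (run M 0 w) ! j) i = (if j = 0 \<and> i < length w then w ! i else 0)"
    "left_cell (snd (run M 0 w) ! j) i = 0"
  using assms by (cases j; auto simp: run_def initial_def word_tape_def)+

subsection \<open>A run satisfies its clauses\<close>

definition run_valuation :: "machine \<Rightarrow> nat list \<Rightarrow> symb \<Rightarrow> nat \<Rightarrow> nat \<Rightarrow> bool" where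
  "run_valuation M w \<sigma> t i =
     (case run M t w of (q, ts) \<Rightarrow>
       (case \<sigma> of
          SQ q' \<Rightarrow> q' = q
        | SR j a \<Rightarrow> right_cell (ts ! j) i = a
        | SL j a \<Rightarrow> left_cell (ts ! j) i = a
        | SAct j b d \<Rightarrow> snd (transition M q (map read_tape ts)) ! j = (b, d)))"

lemma run_sat_step:
  assumes M: "turing_machine M" and w: "set w \<subseteq> {..<4}" and c: "c \<in> set (step_clauses M)"
  shows "sat_clause (run_valuation M w) (instantiate t i c)"
proof -
  let ?v = "run_valuation M w"
  obtain q ts where C: "run M t w = (q, ts)" by fastforce
  note ok = config_ok_run[OF M w, of t]
  have len: "length ts = num_tapes M" and q: "q < num_states M"
    using ok by (auto simp: C config_ok_def)
  let ?as = "map read_tape ts"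
  define acts where "acts = snd (transition M q ?as)"
  have lacts: "length acts = num_tapes M"
    using trans_ok[OF M q] reads_ok[of M q ts] ok C by (simp add: acts_def)
  have C': "run M (Suc t) w = (fst (transition M q ?as), map2 act_tape acts ts)"
    using run_Suc[OF ok C] by (simp add: acts_def)
  have nth: "map2 act_tape acts ts ! j = act_tape (acts ! j) (ts ! j)" if "j < num_tapes M" for j
    using that len lacts by simp
  consider (scan) q' as where "as \<in> set (List.n_lists (num_tapes M) [0..<num_symbols M])"
      "c \<in> set (scan_clauses M q' as)"
    | (writing) j b where "j < num_tapes M" "c \<in> set (write_clauses j b)"
    | (move) j b a where "j < num_tapes M" "c \<in> set (move_clauses j b a)"
    using c by (auto simp: step_clauses_def)
  then show ?thesis
  proof cases
    case scan
    then have las: "length as = num_tapes M"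
      by (auto simp: set_n_lists)
    define prem where "prem = neg (SQ q') 0 0 # map (\<lambda>j. neg (SR j (as ! j)) 0 0) [0..<num_tapes M]"
    \<comment> \<open>If no premise literal is satisfied, the clause was made for exactly the
      present state and symbols, and its conclusion is the actual transition.\<close>
    have *: "q' = q \<and> as = ?as" if "\<not> sat_clause ?v (instantiate t i prem)"
    proof -
      from that have "?v (SQ q') t 0" "\<And>j. j < num_tapes M \<Longrightarrow> ?v (SR j (as ! j)) t 0"
        by (auto simp: prem_def instantiate_def sat_clause_def)
      then have "q' = q" "\<And>j. j < num_tapes M \<Longrightarrow> as ! j = read_tape (ts ! j)"
        by (auto simp: run_valuation_def C right_cell_0)
      with las len show ?thesis by (auto intro: nth_equalityI)
    qed
    from scan(2) consider "c = prem @ [pos (SQ (fst (transition M q' as))) 1 0]"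
      | j where "j < num_tapes M" "c = prem @ [pos (SAct j (fst (snd (transition M q' as) ! j))
          (snd (snd (transition M q' as) ! j))) 0 0]"
      by (auto simp: scan_clauses_def Let_def prem_def)
    then show ?thesis
    proof cases
      case 1
      show ?thesis
      proof (cases "sat_clause ?v (instantiate t i prem)")
        case False
        from *[OF False] show ?thesis
          by (simp add: 1 run_valuation_def C')
      qed (simp add: 1)
    next
      case 2
      show ?thesis
      proof (cases "sat_clause ?v (instantiate t i prem)")
        case False
        from *[OF False] show ?thesis
          by (simp add: 2 run_valuation_def C)
      qed (simp add: 2)
    qed
  next
    case writing
    then show ?thesis
      by (auto simp: write_clauses_def run_valuation_def C C' nth cell_act_tape simp flip: acts_def)
  next
    case move
    then show ?thesis
      by (auto simp: move_clauses_def run_valuation_def C C' nth cell_act_tape eval_nat_numeral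
          simp flip: acts_def)
  qed
qed

lemma run_sat_input:
  assumes M: "turing_machine M" and w: "set w \<subseteq> {..<4}" and u: "length u \<le> m"
  shows "\<forall>c \<in> set (input_clauses w m T). sat_clause (run_valuation M (w @ bits u)) c"
proof -
  let ?v = "run_valuation M (w @ bits u)"
  have "1 \<le> num_tapes M" using M by (simp add: turing_machine_def)
  then have v: "?v (SR 0 a) 0 i \<longleftrightarrow> (if i < length w then w ! i else if i < length w + length u
      then bits u ! (i - length w) else 0) = a" for a i
    using initial_cells[of M 0 "w @ bits u" i]
    by (cases "run M 0 (w @ bits u)") (auto simp: run_valuation_def nth_append bits_def)
  have q: "?v (SQ 0) 0 i" for i
    by (simp add: run_valuation_def run_def initial_def)
  have "0 < bits u ! k" "bits u ! k \<noteq> 2 \<Longrightarrow> bits u ! k = Suc 0" if "k < length u" for k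
    using that by (auto simp: bits_def split: if_splits)
  then show ?thesis
    using u by (auto simp: ball_input_clauses guess_clauses_def v q)
qed

lemma run_sat:
  assumes M: "turing_machine M" and w: "set w \<subseteq> {..<4}" and u: "length u \<le> m"
    and acc: "fst (run M T (w @ bits u)) = 1"
    and c: "c \<in> insert (accept_clause T) (set (run_clauses M w m T))"
  shows "sat_clause (run_valuation M (w @ bits u)) c"
proof -
  let ?v = "run_valuation M (w @ bits u)"
  have wu: "set (w @ bits u) \<subseteq> {..<4}"
    using w by (auto simp: bits_def)
  have k: "1 \<le> num_tapes M" using M by (simp add: turing_machine_def)
  have blank: "sat_clause ?v (instantiate 0 i c)" if c: "c \<in> set (blank_clauses M)" for c i
  proof -
    have "?v (SR j 0) 0 i" if "1 \<le> j" "j < num_tapes M" for j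
      using that initial_cells[OF k that(2), of "w @ bits u" i]
      by (cases "run M 0 (w @ bits u)") (auto simp: run_valuation_def)
    moreover have "?v (SL j 0) 0 i" if "j < num_tapes M" for j
      using that initial_cells[OF k that, of "w @ bits u" i]
      by (cases "run M 0 (w @ bits u)") (auto simp: run_valuation_def)
    ultimately show ?thesis using c by (auto simp: blank_clauses_def)
  qed
  have fin: "?v (SQ q) T i \<longleftrightarrow> q = 1" for q i
    using acc by (auto simp: run_valuation_def split: prod.split)
  consider "c = accept_clause T" | "c \<in> set (input_clauses w m T)"
    | c' i where "c' \<in> set (blank_clauses M)" "c = instantiate 0 i c'"
    | c' t i where "c' \<in> set (step_clauses M)" "c = instantiate t i c'"
    | "c \<in> set (inst_all T 0 (final_clauses M))"
    using c unfolding run_clauses_def inst_all_def by auto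
  then show ?thesis
  proof cases
    case 1
    then show ?thesis using fin by (simp add: accept_clause_def)
  next
    case 2
    then show ?thesis using run_sat_input[OF M w u] by blast
  next
    case 3
    then show ?thesis using blank by blast
  next
    case 4
    then show ?thesis using run_sat_step[OF M wu] by blast
  next
    case 5
    then show ?thesis using fin by (auto simp: inst_all_def final_clauses_def)
  qed
qed

subsection \<open>Satisfied clauses determine an accepting run\<close>

text \<open>A valuation may put several symbols into one cell. The certificate is taken to end at
  the first cell that may be blank, from which on blanks propagate; before it the cell carries 1 or
  2, and 2 is preferred if both are true.\<close>

lemma sat_word:
  assumes sat: "\<forall>c \<in> set (input_clauses w m T). sat_clause v c"
  obtains u where "length u \<le> m"
    "\<And>i. i < T \<Longrightarrow> v (SR 0 (if i < length (w @ bits u) then (w @ bits u) ! i else 0)) 0 i"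
proof -
  have inp: "v (SR 0 (w ! i)) 0 i" if "i < length w" for i
    using sat that by (auto simp: ball_input_clauses)
  have guess: "v (SR 0 0) 0 i \<or> v (SR 0 1) 0 i \<or> v (SR 0 2) 0 i"
    and blank_Suc: "v (SR 0 0) 0 i \<longrightarrow> v (SR 0 0) 0 (Suc i)"
    if "length w \<le> i" "i < length w + m" for i
    using sat that by (auto simp: ball_input_clauses guess_clauses_def)
  have blank: "v (SR 0 0) 0 i" if "length w + m \<le> i" "i < length w + m + T" for i
    using sat that by (auto simp: ball_input_clauses)
  define b where "b i \<longleftrightarrow> v (SR 0 2) 0 (length w + i)" for i
  define n where "n = (LEAST n. n = m \<or> v (SR 0 0) 0 (length w + n))"
  have n: "n = m \<or> v (SR 0 0) 0 (length w + n)"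
    unfolding n_def by (rule LeastI[of _ m]) simp
  have nm: "n \<le> m"
    unfolding n_def by (rule Least_le) simp
  have less: "\<not> v (SR 0 0) 0 (length w + i)" if "i < n" for i
    using not_less_Least[of i "\<lambda>n. n = m \<or> v (SR 0 0) 0 (length w + n)"] that by (simp add: n_def)
  define u where "u = map b [0..<n]"
  \<comment> \<open>At index \<open>m\<close> the blank is supplied by the padding, which is
    nonempty only if \<open>T > 0\<close>.\<close>
  have after: "n \<le> i \<Longrightarrow> i \<le> m \<Longrightarrow> i < m \<or> T > 0 \<Longrightarrow> v (SR 0 0) 0 (length w + i)" for i
  proof (induction i rule: dec_induct)
    case base
    with n blank[of "length w + n"] nm show ?case by auto
  next
    case (step i)
    then show ?case using blank_Suc[of "length w + i"] by simp
  qed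
  have "v (SR 0 (if i < length (w @ bits u) then (w @ bits u) ! i else 0)) 0 i" if "i < T" for i
  proof -
    consider "i < length w" | "length w \<le> i" "i < length w + n" | "length w + n \<le> i" "i < length w + m"
      | "length w + m \<le> i" by linarith
    then show ?thesis
    proof cases
      case 1
      with inp show ?thesis by (simp add: nth_append)
    next
      case 2
      define k where "k = i - length w"
      have k: "i = length w + k" "k < n" using 2 by (auto simp: k_def)
      have "v (SR 0 (if b k then 2 else 1)) 0 i"
        using guess[of i] less[OF k(2)] k nm by (auto simp: b_def)
      with k show ?thesis by (simp add: nth_append u_def bits_def)
    next
      case 3
      define k where "k = i - length w"
      have k: "i = length w + k" "n \<le> k" "k < m" using 3 by (auto simp: k_def)
      with after[of k] show ?thesis by (simp add: nth_append u_def bits_def)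
    next
      case 4
      with blank[of i] that nm show ?thesis by (simp add: nth_append u_def bits_def)
    qed
  qed
  moreover have "length u \<le> m" using nm by (simp add: u_def)
  ultimately show thesis using that by blast
qed

lemma sat_accepts:
  assumes M: "turing_machine M" and w: "set w \<subseteq> {..<4}"
    and sat: "\<forall>c \<in> set (run_clauses M w m T). sat_clause v c"
  shows "\<exists>u. length u \<le> m \<and> fst (run M T (w @ bits u)) = 1"
proof -
  have "\<forall>c \<in> set (input_clauses w m T). sat_clause v c"
    using sat by (simp add: run_clauses_def)
  then obtain u where u: "length u \<le> m"
    and right0: "\<And>i. i < T \<Longrightarrow> v (SR 0 (if i < length (w @ bits u) then (w @ bits u) ! i else 0)) 0 i"
    using sat_word by blast
  let ?w = "w @ bits u"
  have wu: "set ?w \<subseteq> {..<4}"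
    using w by (auto simp: bits_def)
  have k: "1 \<le> num_tapes M" using M by (simp add: turing_machine_def)
  have init: "v (SQ 0) 0 0"
    using sat by (simp add: run_clauses_def input_clauses_def)
  have stepc: "sat_clause v (instantiate t i c)" if "t < T" "i < T" "c \<in> set (step_clauses M)" for t i c
    using sat that by (simp add: ball_run_clauses)
  have blankc: "sat_clause v (instantiate 0 i c)" if "i < T" "c \<in> set (blank_clauses M)" for i c
    using sat that by (simp add: ball_run_clauses)
  \<comment> \<open>The known part of the tapes shrinks by one cell per step, because a move brings
    in a cell from one place further out and clauses are available for indices below
    \<open>T\<close> only. The cell under the head is still known whenever
    \<open>t < T\<close>.\<close>
  have "v (SQ (fst (run M t ?w))) t 0 \<and>
      (\<forall>j < num_tapes M. \<forall>i. i + t < T \<longrightarrow>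
        v (SR j (right_cell (snd (run M t ?w) ! j) i)) t i \<and>
        v (SL j (left_cell (snd (run M t ?w) ! j) i)) t i)" if "t \<le> T" for t
    using that
  proof (induction t)
    case 0
    have "v (SL j 0) 0 i" if "j < num_tapes M" "i < T" for i j
      using blankc[of i "[pos (SL j 0) 0 2]"] that by (auto simp: blank_clauses_def)
    moreover have "v (SR j 0) 0 i" if "j < num_tapes M" "j \<noteq> 0" "i < T" for i j
      using blankc[of i "[pos (SR j 0) 0 2]"] that by (auto simp: blank_clauses_def)
    moreover have "fst (run M 0 ?w) = 0"
      by (simp add: run_def initial_def)
    moreover have "v (SR j (right_cell (snd (run M 0 ?w) ! j) i)) 0 i"
      if "j < num_tapes M" "i < T" for i j
      using right0[OF that(2)] calculation(2)[of j i] that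
      by (cases "j = 0") (simp_all add: initial_cells[OF k])
    ultimately show ?case
      using init by (simp add: initial_cells[OF k])
  next
    case (Suc t)
    obtain q ts where C: "run M t ?w = (q, ts)" by fastforce
    note ok = config_ok_run[OF M wu, of t]
    have len: "length ts = num_tapes M" and q: "q < num_states M"
      using ok by (auto simp: C config_ok_def)
    let ?as = "map read_tape ts"
    note as = reads_ok[OF ok[unfolded C]]
    define acts where "acts = snd (transition M q ?as)"
    have lacts: "length acts = num_tapes M"
      using trans_ok[OF M q as] by (simp add: acts_def)
    have C': "run M (Suc t) ?w = (fst (transition M q ?as), map2 act_tape acts ts)"
      using run_Suc[OF ok C] by (simp add: acts_def)
    have nth: "map2 act_tape acts ts ! j = act_tape (acts ! j) (ts ! j)" if "j < num_tapes M" for j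
      using that len lacts by simp
    have IHq: "v (SQ q) t 0"
      and IHr: "\<And>i j. j < num_tapes M \<Longrightarrow> i + t < T \<Longrightarrow> v (SR j (right_cell (ts ! j) i)) t i"
      and IHl: "\<And>i j. j < num_tapes M \<Longrightarrow> i + t < T \<Longrightarrow> v (SL j (left_cell (ts ! j) i)) t i"
      using Suc.IH Suc.prems by (auto simp: C)
    have "?as \<in> set (List.n_lists (num_tapes M) [0..<num_symbols M])"
      using as by (auto simp: set_n_lists)
    then have scan: "sat_clause v (instantiate t 0 c)" if "c \<in> set (scan_clauses M q ?as)" for c
      using stepc[of t 0 c] that q Suc.prems by (fastforce simp: step_clauses_def)
    have prem: "\<not> sat_clause v (instantiate t 0
        (neg (SQ q) 0 0 # map (\<lambda>j. neg (SR j (?as ! j)) 0 0) [0..<num_tapes M]))"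
      using IHq IHr[of _ 0] Suc.prems len
      by (auto simp: sat_clause_def instantiate_def right_cell_0)
    have q': "v (SQ (fst (transition M q ?as))) (Suc t) 0"
      using scan[of "(neg (SQ q) 0 0 # map (\<lambda>j. neg (SR j (?as ! j)) 0 0) [0..<num_tapes M]) @
        [pos (SQ (fst (transition M q ?as))) 1 0]"] prem
      by (simp add: scan_clauses_def Let_def)
    have act: "v (SAct j (fst (acts ! j)) (snd (acts ! j))) t 0" if "j < num_tapes M" for j
      using scan[of "(neg (SQ q) 0 0 # map (\<lambda>j. neg (SR j (?as ! j)) 0 0) [0..<num_tapes M]) @
        [pos (SAct j (fst (acts ! j)) (snd (acts ! j))) 0 0]"] prem that
      by (auto simp: scan_clauses_def Let_def acts_def)
    have "v (SR j (right_cell (act_tape (acts ! j) (ts ! j)) i)) (Suc t) i \<and>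
        v (SL j (left_cell (act_tape (acts ! j) (ts ! j)) i)) (Suc t) i"
      if j: "j < num_tapes M" and i: "i + Suc t < T" for i j
    proof -
      obtain b d where bd: "acts ! j = (b, d)" by fastforce
      have b: "b < num_symbols M"
        using trans_ok(3)[OF M q as] lacts j nth_mem[of j acts] bd by (fastforce simp: acts_def)
      have sym: "right_cell (ts ! j) n < num_symbols M" "left_cell (ts ! j) n < num_symbols M" for n
      proof -
        have "\<forall>i. fst (ts ! j) i < num_symbols M"
          using ok j len by (simp add: C config_ok_def)
        then show "right_cell (ts ! j) n < num_symbols M" "left_cell (ts ! j) n < num_symbols M"
          by (cases "ts ! j"; simp)+
      qed
      have wr: "sat_clause v (instantiate t n c)" if "c \<in> set (write_clauses j b)" "n < T" for c n
        using stepc[of t n c] that j b Suc.prems by (fastforce simp: step_clauses_def)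
      have mv: "sat_clause v (instantiate t n c)" if "c \<in> set (move_clauses j b a)" "n < T" "a < num_symbols M" for c n a
        using stepc[of t n c] that j b Suc.prems by (fastforce simp: step_clauses_def)
      note act' = act[OF j, unfolded bd fst_conv snd_conv]
      have r: "v (SR j (right_cell (ts ! j) n)) t n" and l: "v (SL j (left_cell (ts ! j) n)) t n"
        if "n \<le> Suc i" for n
        using IHr[OF j, of n] IHl[OF j, of n] that i by auto
      show ?thesis
      proof (cases d)
        case MoveRight
        have "v (SR j (right_cell (ts ! j) (Suc i))) (Suc t) i"
          using mv[of "move_clauses j b (right_cell (ts ! j) (Suc i)) ! 0" "right_cell (ts ! j) (Suc i)" i]
            r[of "Suc i"] act' MoveRight sym i by (simp add: move_clauses_def)
        moreover have "v (SL j b) (Suc t) 0"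
          using wr[of "write_clauses j b ! 0" 0] act' MoveRight i by (simp add: write_clauses_def)
        moreover have "v (SL j (left_cell (ts ! j) n)) (Suc t) (Suc n)" if "i = Suc n" for n
          using mv[of "move_clauses j b (left_cell (ts ! j) n) ! 1" "left_cell (ts ! j) n" n]
            l[of n] act' MoveRight sym i that by (simp add: move_clauses_def)
        ultimately show ?thesis
          unfolding bd MoveRight by (cases i) (auto simp: cell_act_tape)
      next
        case Stay
        have "v (SR j b) (Suc t) 0"
          using wr[of "write_clauses j b ! 1" 0] act' Stay i by (simp add: write_clauses_def)
        moreover have "v (SR j (right_cell (ts ! j) (Suc n))) (Suc t) (Suc n)" if "i = Suc n" for n
          using mv[of "move_clauses j b (right_cell (ts ! j) (Suc n)) ! 2" "right_cell (ts ! j) (Suc n)" n]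
            r[of "Suc n"] act' Stay sym i that by (simp add: move_clauses_def)
        moreover have "v (SL j (left_cell (ts ! j) i)) (Suc t) i"
          using mv[of "move_clauses j b (left_cell (ts ! j) i) ! 3" "left_cell (ts ! j) i" i]
            l[of i] act' Stay sym i by (simp add: move_clauses_def)
        ultimately show ?thesis
          unfolding bd Stay by (cases i) (auto simp: cell_act_tape)
      next
        case MoveLeft
        have "v (SR j b) (Suc t) 1"
          using wr[of "write_clauses j b ! 2" 0] act' MoveLeft i by (simp add: write_clauses_def)
        moreover have "v (SR j (left_cell (ts ! j) 0)) (Suc t) 0"
          using mv[of "move_clauses j b (left_cell (ts ! j) 0) ! 6" "left_cell (ts ! j) 0" 0]
            l[of 0] act' MoveLeft sym i by (simp add: move_clauses_def)
        moreover have "v (SR j (right_cell (ts ! j) (Suc n))) (Suc t) (Suc (Suc n))" if "i = Suc (Suc n)" for n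
          using mv[of "move_clauses j b (right_cell (ts ! j) (Suc n)) ! 4" "right_cell (ts ! j) (Suc n)" n]
            r[of "Suc n"] act' MoveLeft sym i that by (simp add: move_clauses_def)
        moreover have "v (SL j (left_cell (ts ! j) (Suc i))) (Suc t) i"
          using mv[of "move_clauses j b (left_cell (ts ! j) (Suc i)) ! 5" "left_cell (ts ! j) (Suc i)" i]
            l[of "Suc i"] act' MoveLeft sym i by (simp add: move_clauses_def)
        ultimately show ?thesis
          unfolding bd MoveLeft by (cases i; cases "i - 1") (auto simp: cell_act_tape)
      qed
    qed
    with q' nth show ?case by (simp add: C')
  qed
  \<comment> \<open>At time \<open>T\<close> the window of known cells is empty, but the state is
    still known.\<close>
  then have *: "v (SQ (fst (run M T ?w))) T 0" by simp
  have "fst (run M T ?w) = 1"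
  proof (rule ccontr)
    assume "fst (run M T ?w) \<noteq> 1"
    moreover have "fst (run M T ?w) < num_states M"
      using config_ok_run[OF M wu, of T] by (simp add: config_ok_def)
    ultimately have "sat_clause v (instantiate T 0 [neg (SQ (fst (run M T ?w))) 0 0])"
      using sat by (simp add: ball_run_clauses final_clauses_def)
    with * show False by simp
  qed
  with u show ?thesis by blast
qed

section \<open>Writing down the clauses as a formula\<close>

lemma bits_append [simp]: "bits (xs @ ys) = bits xs @ bits ys"
  by (simp add: bits_def)

lemma bits_Nil_Cons [simp]: "bits [] = []" "bits (b # x) = (if b then 2 else 1) # bits x"
  by (simp_all add: bits_def)

lemma length_bits [simp]: "length (bits x) = length x"
  by (simp add: bits_def)

fun unbinary :: "bool list \<Rightarrow> nat" where
  "unbinary [] = 0"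
| "unbinary (b # bs) = (if b then 1 else 0) + 2 * unbinary bs"

lemma unbinary_pos: "bs \<noteq> [] \<Longrightarrow> last bs \<Longrightarrow> 0 < unbinary bs"
  by (induction bs) (auto split: if_splits)

lemma binary_unbinary: "bs = [] \<or> last bs \<Longrightarrow> binary (unbinary bs) = bs"
proof (induction bs)
  case Nil
  then show ?case by (simp add: binary_0)
next
  case (Cons b bs)
  have "unbinary (b # bs) \<noteq> 0"
    using unbinary_pos[of "b # bs"] Cons.prems by simp
  then have "binary (unbinary (b # bs)) =
      odd (unbinary (b # bs)) # binary (unbinary (b # bs) div 2)"
    by (rule binary_pos)
  moreover have "odd (unbinary (b # bs)) = b" "unbinary (b # bs) div 2 = unbinary bs"
    by auto
  moreover have "binary (unbinary bs) = bs"
    using Cons by (auto split: if_splits)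
  ultimately show ?case by simp
qed

text \<open>
  The index of a variable is chosen through its binary digits, so that it can be written from unary
  counters without any arithmetic.
\<close>

definition digits :: "symb \<Rightarrow> nat \<Rightarrow> nat \<Rightarrow> bool list" where
  "digits \<sigma> t i = replicate (to_nat \<sigma>) True @ [False] @ replicate t True @ [False] @
     replicate i True @ [False, True]"

definition var :: "symb \<Rightarrow> nat \<Rightarrow> nat \<Rightarrow> nat" where
  "var \<sigma> t i = unbinary (digits \<sigma> t i)"

text \<open>\<open>binary\<close> never ends in the digit 0, and \<open>digits\<close> ends in
  \<open>True\<close>, so every such list is a genuine numeral. The number is exponential in
  \<open>t\<close> and \<open>i\<close>, but only its length, which is linear in them, is ever
  written.\<close>

lemma binary_var: "binary (var \<sigma> t i) = digits \<sigma> t i"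
  unfolding var_def by (rule binary_unbinary) (simp add: digits_def)

lemma replicate_True_append:
  "replicate m True @ False # xs = replicate n True @ False # ys \<longleftrightarrow> m = n \<and> xs = ys"
proof (induction m arbitrary: n)
  case 0
  then show ?case by (cases n) auto
next
  case (Suc m)
  then show ?case by (cases n) auto
qed

lemma var_inject: "var \<sigma> t i = var \<sigma>' t' i' \<longleftrightarrow> \<sigma> = \<sigma>' \<and> t = t' \<and> i = i'"
proof
  assume "var \<sigma> t i = var \<sigma>' t' i'"
  then have "digits \<sigma> t i = digits \<sigma>' t' i'"
    by (metis binary_var)
  then show "\<sigma> = \<sigma>' \<and> t = t' \<and> i = i'"
    by (simp add: digits_def replicate_True_append)
qed simp

text \<open>
  The connectives available in a language, given by prefixes and infixes in Polish notation.
\<close>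

locale connectives =
  fixes S :: "oper set"
    and conj disj :: "fm \<Rightarrow> fm \<Rightarrow> fm" and neg_atom :: "nat \<Rightarrow> fm"
    and conj_pre conj_in disj_pre disj_in neg_pre :: "bool list"
  assumes encode_conj: "encode (conj a b) = conj_pre @ encode a @ conj_in @ encode b"
    and encode_disj: "encode (disj a b) = disj_pre @ encode a @ disj_in @ encode b"
    and encode_neg: "encode (neg_atom p) = neg_pre @ delimit (binary p)"
    and lang_conj: "a \<in> lang S \<Longrightarrow> b \<in> lang S \<Longrightarrow> conj a b \<in> lang S"
    and lang_disj: "a \<in> lang S \<Longrightarrow> b \<in> lang S \<Longrightarrow> disj a b \<in> lang S"
    and lang_neg: "neg_atom p \<in> lang S"
    and holds_conj: "\<And>R V (w :: nat). holds R V w (conj a b) \<longleftrightarrow> holds R V w a \<and> holds R V w b"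
    and holds_disj: "\<And>R V (w :: nat). holds R V w (disj a b) \<longleftrightarrow> holds R V w a \<or> holds R V w b"
    and holds_neg: "\<And>R V (w :: nat). holds R V w (neg_atom p) \<longleftrightarrow> w \<notin> V p"
begin

fun literal_fm :: "literal \<Rightarrow> fm" where
  "literal_fm (s, \<sigma>, t, i) = (if s then Atom (var \<sigma> t i) else neg_atom (var \<sigma> t i))"

fun clause_fm :: "literal list \<Rightarrow> fm" where
  "clause_fm [] = neg_atom 0"
| "clause_fm [l] = literal_fm l"
| "clause_fm (l # ls) = disj (literal_fm l) (clause_fm ls)"

text \<open>The last clause is a separate argument because a language without constants has no empty
  conjunction to end with. For the same reason clauses are required to be nonempty below.\<close>

definition cnf_fm :: "literal list list \<Rightarrow> literal list \<Rightarrow> fm" where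
  "cnf_fm cs c = foldr (\<lambda>c f. conj (clause_fm c) f) cs (clause_fm c)"

lemma literal_lang: "literal_fm l \<in> lang S"
  using lang_neg by (cases l) (auto simp: lang_def)

lemma clause_lang: "clause_fm c \<in> lang S"
  by (induction c rule: clause_fm.induct) (auto intro: lang_neg lang_disj literal_lang simp del: literal_fm.simps)

lemma cnf_lang: "cnf_fm cs c \<in> lang S"
  by (induction cs) (auto simp: cnf_fm_def intro: lang_conj clause_lang)

lemma holds_literal:
  fixes w :: nat
  shows "holds R V w (literal_fm (s, \<sigma>, t, i)) \<longleftrightarrow> (w \<in> V (var \<sigma> t i)) = s"
  by (simp add: holds_neg)

lemma holds_clause:
  fixes w :: nat
  assumes "c \<noteq> []"
  shows "holds R V w (clause_fm c) \<longleftrightarrow> sat_clause (\<lambda>\<sigma> t i. w \<in> V (var \<sigma> t i)) c"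
  using assms
proof (induction c rule: clause_fm.induct)
  case (2 l)
  then show ?case by (cases l) (simp add: holds_literal del: literal_fm.simps)
next
  case (3 l l' ls)
  then show ?case by (cases l) (simp add: holds_literal holds_disj del: literal_fm.simps)
qed simp

lemma holds_cnf:
  fixes w :: nat
  assumes "\<forall>c \<in> insert c (set cs). c \<noteq> []"
  shows "holds R V w (cnf_fm cs c) \<longleftrightarrow> (\<forall>c \<in> insert c (set cs). sat_clause (\<lambda>\<sigma> t i. w \<in> V (var \<sigma> t i)) c)"
  using assms by (induction cs) (auto simp: cnf_fm_def holds_clause holds_conj)

text \<open>The formula is propositional: a world of any model is a valuation, and a valuation is a
  model with one world. The latter direction needs \<open>var_inject\<close>, so that distinct
  variables keep distinct indices.\<close>

lemma satisfiable_cnf: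
  assumes "\<forall>c \<in> insert c (set cs). c \<noteq> []"
  shows "satisfiable (cnf_fm cs c) \<longleftrightarrow> (\<exists>v. \<forall>c \<in> insert c (set cs). sat_clause v c)"
proof
  assume "satisfiable (cnf_fm cs c)"
  then show "\<exists>v. \<forall>c \<in> insert c (set cs). sat_clause v c"
    unfolding satisfiable_def holds_cnf[OF assms] by blast
next
  assume "\<exists>v. \<forall>c \<in> insert c (set cs). sat_clause v c"
  then obtain v where v: "\<forall>c \<in> insert c (set cs). sat_clause v c" by blast
  define V where "V p = (if \<exists>\<sigma> t i. p = var \<sigma> t i \<and> v \<sigma> t i then {0 :: nat} else {})" for p
  have "(\<lambda>\<sigma> t i. (0 :: nat) \<in> V (var \<sigma> t i)) = v"
    by (intro ext) (auto simp: V_def var_inject)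
  then have "holds {} V 0 (cnf_fm cs c)"
    unfolding holds_cnf[OF assms] using v by simp
  moreover have "kripke_model {0} {} V"
    by (auto simp: kripke_model_def V_def)
  ultimately show "satisfiable (cnf_fm cs c)"
    by (intro satisfiableI[of "{0}" "{}" V 0]) auto
qed

fun literal_bits :: "literal \<Rightarrow> bool list" where
  "literal_bits (s, \<sigma>, t, i) =
     (if s then [False, False, False, False] else neg_pre) @ delimit (digits \<sigma> t i)"

fun clause_bits :: "literal list \<Rightarrow> bool list" where
  "clause_bits [] = encode (neg_atom 0)"
| "clause_bits [l] = literal_bits l"
| "clause_bits (l # ls) = disj_pre @ literal_bits l @ disj_in @ clause_bits ls"

definition clauses_bits :: "literal list list \<Rightarrow> bool list" where
  "clauses_bits cs = concat (map (\<lambda>c. conj_pre @ clause_bits c @ conj_in) cs)"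

lemma clauses_bits_simps [simp]:
  "clauses_bits [] = []"
  "clauses_bits (c # cs) = conj_pre @ clause_bits c @ conj_in @ clauses_bits cs"
  "clauses_bits (cs @ cs') = clauses_bits cs @ clauses_bits cs'"
  by (simp_all add: clauses_bits_def)

lemma clauses_bits_concat:
  "clauses_bits (concat (map f xs)) = concat (map (\<lambda>x. clauses_bits (f x)) xs)"
  by (induction xs) auto

lemma encode_literal: "encode (literal_fm l) = literal_bits l"
  by (cases l) (simp add: encode_neg binary_var)

lemma encode_clause: "encode (clause_fm c) = clause_bits c"
  by (induction c rule: clause_fm.induct)
    (auto simp: encode_literal encode_disj simp del: literal_fm.simps literal_bits.simps)

lemma encode_cnf: "encode (cnf_fm cs c) = clauses_bits cs @ clause_bits c"
  by (induction cs) (auto simp: cnf_fm_def encode_conj encode_clause)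

end

section \<open>Programs with unary counters\<close>

lemma den_Seq: "den N c s = Some s1 \<Longrightarrow> den N d s1 = Some s2 \<Longrightarrow> den N (c ;; d) s = Some s2"
  by simp

abbreviation unary :: "nat \<Rightarrow> nat list" where
  "unary n \<equiv> replicate n 1"

lemma hd0_unary [simp]: "hd0 (unary n) \<in> {1} \<longleftrightarrow> 0 < n" "hd0 (unary n) = Suc 0 \<longleftrightarrow> 0 < n"
  by (cases n; simp)+

lemma replicate_app [simp]: "replicate m x @ replicate n x = replicate (m + n) x"
  by (simp add: replicate_add)

definition emit :: "bool list \<Rightarrow> cmd" where
  "emit bs = foldr (\<lambda>b c. Push 0 (if b then 2 else 1) ;; c) bs Skip"

lemma den_emit [simp]: "den N (emit bs) s = Some (s(0 := rev (bits bs) @ s 0))"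
  by (induction bs arbitrary: s) (auto simp: emit_def bits_def)

lemma wf_emit [simp]: "wf_cmd (emit bs)"
  by (induction bs) (auto simp: emit_def)

definition shift :: "nat \<Rightarrow> nat \<Rightarrow> cmd" where
  "shift v w = WhileTop v {1} (Pop v ;; Push w 1)"

lemma loop_shift:
  "v \<noteq> w \<Longrightarrow> s v = unary m \<Longrightarrow> m \<le> k \<Longrightarrow>
     loop_den k (den N (Pop v ;; Push w 1)) v {1} s = Some (s(v := [], w := unary m @ s w))"
proof (induction m arbitrary: k s)
  case 0
  then show ?case by (cases k) (auto simp: fun_upd_idem)
next
  case (Suc m)
  then obtain k' where k: "k = Suc k'" by (cases k) auto
  define s1 where "s1 = s(v := unary m, w := 1 # s w)"
  have "den N (Pop v ;; Push w 1) s = Some s1"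
    using Suc.prems by (simp add: s1_def)
  moreover have "loop_den k' (den N (Pop v ;; Push w 1)) v {1} s1 = Some (s1(v := [], w := unary m @ s1 w))"
    using Suc.prems k by (intro Suc.IH) (auto simp: s1_def)
  moreover have "s1(v := [], w := unary m @ s1 w) = s(v := [], w := unary (Suc m) @ s w)"
    using Suc.prems(1) by (auto simp: s1_def fun_eq_iff replicate_app_Cons_same)
  ultimately show ?case
    using Suc.prems by (simp add: k fun_eq_iff del: den.simps)
qed

lemma den_shift:
  "v \<noteq> w \<Longrightarrow> s v = unary m \<Longrightarrow> m \<le> N \<Longrightarrow>
     den N (shift v w) s = Some (s(v := [], w := unary m @ s w))"
  unfolding shift_def den.simps(8) by (rule loop_shift)

definition clear :: "nat \<Rightarrow> cmd" where
  "clear v = WhileTop v {1} (Pop v)"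

lemma loop_clear:
  "s v = unary m \<Longrightarrow> m \<le> k \<Longrightarrow> loop_den k (den N (Pop v)) v {1} s = Some (s(v := []))"
proof (induction m arbitrary: k s)
  case 0
  then show ?case by (cases k) (auto simp: fun_upd_idem)
next
  case (Suc m)
  then obtain k' where k: "k = Suc k'" by (cases k) auto
  have "loop_den k' (den N (Pop v)) v {1} (s(v := unary m)) = Some ((s(v := unary m))(v := []))"
    using Suc.prems k by (intro Suc.IH) auto
  moreover have "den N (Pop v) s = Some (s(v := unary m))"
    using Suc.prems by simp
  ultimately show ?case
    using Suc.prems by (simp add: k fun_eq_iff del: den.simps)
qed

lemma den_clear: "s v = unary m \<Longrightarrow> m \<le> N \<Longrightarrow> den N (clear v) s = Some (s(v := []))"
  unfolding clear_def den.simps(8) by (rule loop_clear)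

text \<open>A counter can only be inspected by popping it. It is therefore moved to \<open>w\<close>
  during the loop and restored afterwards, so that it remains available for further loops.\<close>

definition foreach :: "nat \<Rightarrow> nat \<Rightarrow> cmd \<Rightarrow> cmd" where
  "foreach v w c = WhileTop v {1} (Pop v ;; Push w 1 ;; c) ;; shift w v"

lemma wf_foreach [simp]: "wf_cmd (foreach v w c) \<longleftrightarrow> 1 \<le> v \<and> 1 \<le> w \<and> wf_cmd c"
  by (auto simp: foreach_def shift_def)

lemma wf_clear [simp]: "wf_cmd (clear v) \<longleftrightarrow> 1 \<le> v"
  by (auto simp: clear_def)

lemma wf_shift [simp]: "wf_cmd (shift v w) \<longleftrightarrow> 1 \<le> v"
  by (auto simp: shift_def)

text \<open>The body sees the store \<open>\<sigma> j\<close> except for the two variables of the loop.\<close>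

lemma den_foreach:
  assumes vw: "v \<noteq> w" and m: "m \<le> N"
    and body: "\<And>j. j < m \<Longrightarrow>
      den N c ((\<sigma> j)(v := unary (m - Suc j), w := unary (Suc j))) =
        Some ((\<sigma> (Suc j))(v := unary (m - Suc j), w := unary (Suc j)))"
    and s: "s = (\<sigma> 0)(v := unary m, w := [])"
  shows "den N (foreach v w c) s = Some ((\<sigma> m)(v := unary m, w := []))"
proof -
  let ?b = "Pop v ;; Push w 1 ;; c"
  have "loop_den k (den N ?b) v {1} ((\<sigma> j)(v := unary (m - j), w := unary j)) =
      Some ((\<sigma> m)(v := [], w := unary m))" if "m - j \<le> k" "j \<le> m" for j k
    using that
  proof (induction "m - j" arbitrary: j k)
    case 0
    then show ?case using vw by (cases k) auto
  next
    case (Suc d)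
    then obtain k' where k: "k = Suc k'" by (cases k) auto
    have j: "j < m" "m - j = Suc (m - Suc j)" using Suc by auto
    have "den N ?b ((\<sigma> j)(v := unary (m - j), w := unary j)) =
        den N c (((\<sigma> j)(v := unary (m - j), w := unary j))(v := unary (m - Suc j), w := unary (Suc j)))"
      using vw j by simp
    also have "((\<sigma> j)(v := unary (m - j), w := unary j))(v := unary (m - Suc j), w := unary (Suc j)) =
        (\<sigma> j)(v := unary (m - Suc j), w := unary (Suc j))"
      using vw by (auto simp: fun_eq_iff)
    also note body[OF j(1)]
    finally have 1: "den N ?b ((\<sigma> j)(v := unary (m - j), w := unary j)) =
        Some ((\<sigma> (Suc j))(v := unary (m - Suc j), w := unary (Suc j)))" .
    have 2: "loop_den k' (den N ?b) v {1} ((\<sigma> (Suc j))(v := unary (m - Suc j), w := unary (Suc j))) =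
        Some ((\<sigma> m)(v := [], w := unary m))"
      using Suc k by (intro Suc(1)) auto
    have "hd0 (((\<sigma> j)(v := unary (m - j), w := unary j)) v) \<in> {1}"
      using vw j by simp
    then show ?case
      using 1 2 unfolding k loop_den.simps by simp
  qed
  from this[of 0 N] have 1: "den N (WhileTop v {1} ?b) s = Some ((\<sigma> m)(v := [], w := unary m))"
    using m vw by (simp add: s fun_upd_twist del: den.simps(1-7))
  have 2: "den N (shift w v) ((\<sigma> m)(v := [], w := unary m)) =
      Some (((\<sigma> m)(v := [], w := unary m))(w := [], v := unary m @ ((\<sigma> m)(v := [], w := unary m)) v))"
    using vw m by (intro den_shift) auto
  have "((\<sigma> m)(v := [], w := unary m))(w := [], v := unary m @ ((\<sigma> m)(v := [], w := unary m)) v) =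
      (\<sigma> m)(v := unary m, w := [])"
    using vw by (auto simp: fun_eq_iff)
  with 1 2 show ?thesis by (simp add: foreach_def del: den.simps(8))
qed

lemma concat_replicate_app: "xs @ concat (replicate j xs) = concat (replicate j xs) @ xs"
  by (induction j) auto

lemma den_foreach_const:
  assumes vw: "v \<noteq> w" "c \<noteq> v" "c \<noteq> w" "m \<le> N" "s v = unary m" "s w = []"
    and body: "\<And>s. den N b s = Some (s(c := y @ s c))"
  shows "den N (foreach v w b) s = Some (s(c := concat (replicate m y) @ s c))"
proof -
  define \<sigma> where "\<sigma> j = s(c := concat (replicate j y) @ s c)" for j
  have "den N (foreach v w b) s = Some ((\<sigma> m)(v := unary m, w := []))"
    by (rule den_foreach) (use assms in \<open>auto simp: \<sigma>_def fun_eq_iff\<close>)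
  also have "(\<sigma> m)(v := unary m, w := []) = s(c := concat (replicate m y) @ s c)"
    using assms by (auto simp: \<sigma>_def fun_eq_iff)
  finally show ?thesis .
qed

text \<open>For bodies whose output depends on the current index, which is kept in unary in
  \<open>c\<close>. The predicate \<open>P\<close> states what the body needs of the remaining
  variables and has to survive the updates made by the loop.\<close>

lemma den_foreach_emit:
  assumes v: "distinct [0, v, w, c]" and m: "m \<le> N" "s v = unary m" "s w = []" "s c = unary i0" "P s"
    and P: "\<And>s x y. P s \<Longrightarrow> x \<in> {0, v, w, c} \<Longrightarrow> P (s(x := y))"
    and body: "\<And>s j. P s \<Longrightarrow> j < m \<Longrightarrow> s c = unary (i0 + j) \<Longrightarrow>
      den N b s = Some (s(0 := rev (bits (F (i0 + j))) @ s 0))"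
  shows "den N (foreach v w (b ;; Push c 1)) s =
    Some (s(0 := rev (bits (concat (map F [i0..<i0 + m]))) @ s 0, c := unary (i0 + m)))"
proof -
  define \<sigma> where "\<sigma> j = s(0 := rev (bits (concat (map F [i0..<i0 + j]))) @ s 0, c := unary (i0 + j))" for j
  have "den N (foreach v w (b ;; Push c 1)) s = Some ((\<sigma> m)(v := unary m, w := []))"
  proof (rule den_foreach)
    fix j assume j: "j < m"
    let ?s = "(\<sigma> j)(v := unary (m - Suc j), w := unary (Suc j))"
    have "P ?s" unfolding \<sigma>_def using m(5) by (intro P) auto
    moreover have "?s c = unary (i0 + j)" "?s 0 = rev (bits (concat (map F [i0..<i0 + j]))) @ s 0"
      using v by (auto simp: \<sigma>_def)
    ultimately have "den N b ?s = Some (?s(0 := rev (bits (F (i0 + j))) @ rev (bits (concat (map F [i0..<i0 + j]))) @ s 0))"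
      using body[of ?s j] j by simp
    then have "den N (b ;; Push c 1) ?s = Some (?s(0 := rev (bits (F (i0 + j))) @
        rev (bits (concat (map F [i0..<i0 + j]))) @ s 0, c := 1 # unary (i0 + j)))"
      using v \<open>?s c = unary (i0 + j)\<close> by (simp del: fun_upd_apply) (simp add: \<sigma>_def)
    also have "?s(0 := rev (bits (F (i0 + j))) @ rev (bits (concat (map F [i0..<i0 + j]))) @ s 0,
        c := 1 # unary (i0 + j)) = (\<sigma> (Suc j))(v := unary (m - Suc j), w := unary (Suc j))"
      using v by (auto simp: \<sigma>_def fun_eq_iff bits_def)
    finally show "den N (b ;; Push c 1) ?s = Some ((\<sigma> (Suc j))(v := unary (m - Suc j), w := unary (Suc j)))" .
  qed (use v m in \<open>auto simp: \<sigma>_def fun_eq_iff bits_def\<close>)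
  also have "(\<sigma> m)(v := unary m, w := []) =
      s(0 := rev (bits (concat (map F [i0..<i0 + m]))) @ s 0, c := unary (i0 + m))"
    using v m by (auto simp: \<sigma>_def fun_eq_iff)
  finally show ?thesis .
qed

section \<open>Evaluation of polynomials in unary\<close>

primrec push_unary :: "nat \<Rightarrow> nat \<Rightarrow> cmd" where
  "push_unary v 0 = Skip"
| "push_unary v (Suc n) = Push v 1 ;; push_unary v n"

lemma den_push_unary [simp]: "den N (push_unary v n) s = Some (s(v := unary n @ s v))"
  by (induction n arbitrary: s) (auto simp: replicate_app_Cons_same)

lemma wf_push_unary [simp]: "wf_cmd (push_unary v n)"
  by (induction n) auto

text \<open>Horner's scheme: the variable \<open>a\<close> receives the value at \<open>v\<close>; \<open>b\<close> and \<open>w\<close> are auxiliary.\<close>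

primrec horner :: "nat \<Rightarrow> nat \<Rightarrow> nat \<Rightarrow> nat \<Rightarrow> nat list \<Rightarrow> cmd" where
  "horner v a b w [] = Skip"
| "horner v a b w (c # cs) =
     horner v a b w cs ;; WhileTop a {1} (Pop a ;; foreach v w (Push b 1)) ;; shift b a ;; push_unary a c"

lemma wf_horner: "1 \<le> v \<Longrightarrow> 1 \<le> a \<Longrightarrow> 1 \<le> b \<Longrightarrow> 1 \<le> w \<Longrightarrow> wf_cmd (horner v a b w cs)"
  by (induction cs) auto

primrec horner_val :: "nat list \<Rightarrow> nat \<Rightarrow> nat" where
  "horner_val [] n = 0"
| "horner_val (c # cs) n = c + n * horner_val cs n"

lemma horner_val_mono: "horner_val cs n \<le> horner_val cs (Suc n)"
  by (induction cs) (auto intro!: add_mono mult_le_mono simp del: mult_Suc)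

lemma horner_val_coeffs: "horner_val (coeffs p) n = poly p n"
  by (induction p) (auto simp: cCons_def)

lemma loop_multiply:
  assumes d: "distinct [v, a, b, w]" and n: "n \<le> N"
  shows "s v = unary n \<Longrightarrow> s w = [] \<Longrightarrow> s a = unary m \<Longrightarrow> s b = unary l \<Longrightarrow> m \<le> k \<Longrightarrow>
    loop_den k (den N (Pop a ;; foreach v w (Push b 1))) a {1} s = Some (s(a := [], b := unary (n * m + l)))"
proof (induction m arbitrary: k s l)
  case 0
  then show ?case by (cases k) (auto simp: fun_upd_idem)
next
  case (Suc m)
  then obtain k' where k: "k = Suc k'" by (cases k) auto
  define s1 where "s1 = s(a := unary m, b := unary (n + l))"
  have "den N (foreach v w (Push b 1)) (s(a := unary m)) =
      Some ((s(a := unary m))(b := concat (replicate n [1]) @ (s(a := unary m)) b))"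
    using Suc.prems d n by (intro den_foreach_const) auto
  also have "(s(a := unary m))(b := concat (replicate n [1]) @ (s(a := unary m)) b) = s1"
  proof -
    have "concat (replicate n [1]) = unary n" by (induction n) auto
    with Suc.prems d show ?thesis by (auto simp: s1_def fun_eq_iff)
  qed
  finally have body: "den N (foreach v w (Push b 1)) (s(a := unary m)) = Some s1" .
  have "den N (Pop a) s = Some (s(a := unary m))"
    using Suc.prems by simp
  then have "den N (Pop a ;; foreach v w (Push b 1)) s = Some s1"
    using body by (rule den_Seq)
  moreover have "loop_den k' (den N (Pop a ;; foreach v w (Push b 1))) a {1} s1 =
      Some (s1(a := [], b := unary (n * m + (n + l))))"
    using Suc.prems d k by (intro Suc.IH) (auto simp: s1_def)
  moreover have "s1(a := [], b := unary (n * m + (n + l))) = s(a := [], b := unary (n * Suc m + l))"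
    by (auto simp: s1_def fun_eq_iff algebra_simps)
  ultimately show ?case
    using Suc.prems by (simp add: k fun_eq_iff del: den.simps)
qed

text \<open>The fuel is measured at \<open>Suc n\<close> because for \<open>n = 0\<close> an
  intermediate value may exceed the final one, being multiplied by 0. At a positive argument the
  final value dominates all intermediate ones.\<close>

lemma den_horner:
  assumes d: "distinct [v, a, b, w]"
    and s: "s v = unary n" "s w = []" "s a = []" "s b = []"
    and N: "n \<le> N" "horner_val cs (Suc n) \<le> N"
  shows "den N (horner v a b w cs) s = Some (s(a := unary (horner_val cs n)))"
  using N(2)
proof (induction cs)
  case Nil
  then show ?case using s by (auto simp: fun_upd_idem)
next
  case (Cons c cs)
  define h where "h = horner_val cs n"
  have "h \<le> horner_val cs (Suc n)"
    unfolding h_def by (rule horner_val_mono)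
  then have h: "h \<le> N" "n * h \<le> N"
    using Cons.prems mult_le_mono[of n "Suc n" h "horner_val cs (Suc n)"] by auto
  define s1 where "s1 = s(a := unary h)"
  have "horner_val cs (Suc n) \<le> N"
    using Cons.prems by simp
  from Cons.IH[OF this] have 1: "den N (horner v a b w cs) s = Some s1"
    unfolding s1_def h_def .
  have 2: "den N (WhileTop a {1} (Pop a ;; foreach v w (Push b 1))) s1 = Some (s1(a := [], b := unary (n * h + 0)))"
    unfolding den.simps(8) using d s N h by (intro loop_multiply) (auto simp: s1_def)
  define s2 where "s2 = s(a := [], b := unary (n * h))"
  have s2: "s1(a := [], b := unary (n * h + 0)) = s2"
    by (auto simp: s1_def s2_def fun_eq_iff)
  have "den N (shift b a) s2 = Some (s2(b := [], a := unary (n * h) @ s2 a))"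
    using d h by (intro den_shift) (auto simp: s2_def)
  also have "s2(b := [], a := unary (n * h) @ s2 a) = s(a := unary (n * h))"
    using d s by (auto simp: s2_def fun_eq_iff)
  finally have 3: "den N (shift b a) s2 = Some (s(a := unary (n * h)))" .
  have 4: "den N (push_unary a c) (s(a := unary (n * h))) = Some (s(a := unary (horner_val (c # cs) n)))"
    by (simp add: h_def fun_eq_iff)
  show ?case
    unfolding horner.simps by (rule den_Seq 1 2[unfolded s2] 3 4)+
qed

section \<open>The reduction as a program\<close>

context connectives
begin

text \<open>Variables 6 and 7 hold the time and the index in unary, variable 8 is auxiliary.\<close>

fun emit_literal :: "literal \<Rightarrow> cmd" where
  "emit_literal (s, \<sigma>, dt, di) =
     emit ((if s then [False, False, False, False] else neg_pre) @
       concat (map (\<lambda>b. [True, b]) (replicate (to_nat \<sigma>) True @ [False] @ replicate dt True))) ;;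
     foreach 6 8 (emit [True, True]) ;;
     emit ([True, False] @ concat (map (\<lambda>b. [True, b]) (replicate (if di < 2 then di else di - 2) True))) ;;
     (if di < 2 then Skip else foreach 7 8 (emit [True, True])) ;;
     emit (delimit [False, True])"

fun emit_clause :: "literal list \<Rightarrow> cmd" where
  "emit_clause [] = emit (encode (neg_atom 0))"
| "emit_clause [l] = emit_literal l"
| "emit_clause (l # ls) = emit disj_pre ;; emit_literal l ;; emit disj_in ;; emit_clause ls"

primrec emit_clauses :: "literal list list \<Rightarrow> cmd" where
  "emit_clauses [] = Skip"
| "emit_clauses (c # cs) = emit conj_pre ;; emit_clause c ;; emit conj_in ;; emit_clauses cs"

lemma wf_emit_literal [simp]: "wf_cmd (emit_literal l)"
  by (cases l) simp

lemma wf_emit_clause [simp]: "wf_cmd (emit_clause c)"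
  by (induction c rule: emit_clause.induct) (simp_all del: emit_literal.simps)

lemma wf_emit_clauses [simp]: "wf_cmd (emit_clauses cs)"
  by (induction cs) simp_all

definition writing :: "nat \<Rightarrow> nat \<Rightarrow> nat \<Rightarrow> store \<Rightarrow> bool" where
  "writing N t i s \<longleftrightarrow> s 6 = unary t \<and> s 7 = unary i \<and> s 8 = [] \<and> t \<le> N \<and> i \<le> N"

lemma writing_update [simp]:
  "x \<notin> {6, 7, 8} \<Longrightarrow> writing N t i (s(x := xs)) \<longleftrightarrow> writing N t i s"
  by (auto simp: writing_def)

lemma concat_replicate_rev_bits:
  "concat (replicate m (rev (bits bs))) = rev (bits (concat (replicate m bs)))"
proof (induction m)
  case 0
  then show ?case by (simp add: bits_def)
next
  case (Suc m)
  then show ?case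
    using concat_replicate_app[of "rev (bits bs)" m] by simp
qed

lemma den_emit_counter:
  assumes "c \<notin> {0, 8}" "s c = unary m" "s 8 = []" "m \<le> N"
  shows "den N (foreach c 8 (emit [True, True])) s =
    Some (s(0 := rev (bits (concat (map (\<lambda>b. [True, b]) (replicate m True)))) @ s 0))"
proof -
  have "den N (foreach c 8 (emit [True, True])) s =
      Some (s(0 := concat (replicate m (rev (bits [True, True]))) @ s 0))"
    using assms by (intro den_foreach_const) auto
  also have "concat (replicate m (rev (bits [True, True]))) =
      rev (bits (concat (map (\<lambda>b. [True, b]) (replicate m True))))"
    unfolding concat_replicate_rev_bits by simp
  finally show ?thesis .
qed

lemma delimit_append: "delimit (xs @ ys) = concat (map (\<lambda>b. [True, b]) xs) @ delimit ys"
  by (induction xs) auto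

lemma den_emit_literal:
  assumes "writing N t i s"
  shows "den N (emit_literal l) s =
    Some (s(0 := rev (bits (literal_bits (hd (instantiate t i [l])))) @ s 0))"
proof -
  obtain b \<sigma> dt di where l: "l = (b, \<sigma>, dt, di)" by (cases l)
  let ?d = "\<lambda>n. concat (map (\<lambda>b. [True, b]) (replicate n True))"
  define pre where "pre = (if b then [False, False, False, False] else neg_pre) @
    concat (map (\<lambda>b. [True, b]) (replicate (to_nat \<sigma>) True @ [False] @ replicate dt True))"
  define mid where "mid = [True, False] @ ?d (if di < 2 then di else di - 2)"
  define fin where "fin = (if di < 2 then [] else ?d i)"
  define s1 where "s1 = s(0 := rev (bits pre) @ s 0)"
  define s2 where "s2 = s1(0 := rev (bits (?d t)) @ s1 0)"
  define s3 where "s3 = s2(0 := rev (bits mid) @ s2 0)"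
  define s4 where "s4 = s3(0 := rev (bits fin) @ s3 0)"
  define s5 where "s5 = s4(0 := rev (bits (delimit [False, True])) @ s4 0)"
  have w: "writing N t i s1" "writing N t i s3"
    using assms by (simp_all add: s1_def s2_def s3_def)
  have 2: "den N (foreach 6 8 (emit [True, True])) s1 = Some s2"
    unfolding s2_def using w(1) by (intro den_emit_counter) (auto simp: writing_def)
  have 4: "den N (if di < 2 then Skip else foreach 7 8 (emit [True, True])) s3 = Some s4"
  proof (cases "di < 2")
    case True
    then show ?thesis by (simp add: s4_def fin_def bits_def)
  next
    case False
    have "den N (foreach 7 8 (emit [True, True])) s3 = Some (s3(0 := rev (bits (?d i)) @ s3 0))"
      using w(2) by (intro den_emit_counter) (auto simp: writing_def)
    with False show ?thesis by (simp add: s4_def fin_def)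
  qed
  have "den N (emit_literal l) s = Some s5"
    unfolding l emit_literal.simps pre_def[symmetric] mid_def[symmetric]
    by (rule den_Seq 2 4 den_emit[of N pre s, folded s1_def] den_emit[of N mid s2, folded s3_def]
        den_emit[of N "delimit [False, True]" s4, folded s5_def])+
  also have "s5 = s(0 := rev (bits (pre @ ?d t @ mid @ fin @ delimit [False, True])) @ s 0)"
    by (simp add: s1_def s2_def s3_def s4_def s5_def fun_eq_iff)
  also have "pre @ ?d t @ mid @ fin @ delimit [False, True] =
      literal_bits (hd (instantiate t i [l]))"
  proof -
    \<comment> \<open>The program prints the constant offset before the counter. The order is
      immaterial, since both are blocks of the same digit.\<close>
    have "?d dt @ ?d t = ?d (t + dt)"
      by (simp add: add.commute flip: map_append concat_append)
    moreover have "?d (di - 2) @ ?d i = ?d (i + (di - 2))"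
      by (simp add: add.commute flip: map_append concat_append)
    ultimately show ?thesis
      by (simp add: l pre_def mid_def fin_def digits_def delimit_append)
  qed
  finally show ?thesis .
qed

lemma den_emit_clause:
  "writing N t i s \<Longrightarrow> den N (emit_clause c) s =
     Some (s(0 := rev (bits (clause_bits (instantiate t i c))) @ s 0))"
proof (induction c arbitrary: s rule: emit_clause.induct)
  case (2 l)
  show ?case
  proof -
    have "instantiate t i [l] = [hd (instantiate t i [l])]"
      by (cases l) simp
    then have "clause_bits (instantiate t i [l]) = literal_bits (hd (instantiate t i [l]))"
      by (metis clause_bits.simps(2))
    then show ?thesis
      unfolding emit_clause.simps using den_emit_literal[OF 2, of l] by (simp add: fun_eq_iff)
  qed
next
  case (3 l l' ls)
  define m where "m = hd (instantiate t i [l])"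
  define r where "r = instantiate t i (l' # ls)"
  have c: "clause_bits (instantiate t i (l # l' # ls)) =
      disj_pre @ literal_bits m @ disj_in @ clause_bits r"
    by (cases l; cases l') (simp add: m_def r_def)
  define s1 where "s1 = s(0 := rev (bits disj_pre) @ s 0)"
  define s2 where "s2 = s1(0 := rev (bits (literal_bits m)) @ s1 0)"
  define s3 where "s3 = s2(0 := rev (bits disj_in) @ s2 0)"
  have w: "writing N t i s1" "writing N t i s3"
    using 3 by (simp_all add: s1_def s2_def s3_def)
  have 1: "den N (emit_literal l) s1 = Some s2"
    using den_emit_literal[OF w(1)] by (simp add: s2_def m_def)
  have 2: "den N (emit_clause (l' # ls)) s3 = Some (s3(0 := rev (bits (clause_bits r)) @ s3 0))"
    unfolding r_def by (rule 3(1)[OF w(2)])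
  have "den N (emit_clause (l # l' # ls)) s = Some (s3(0 := rev (bits (clause_bits r)) @ s3 0))"
    unfolding emit_clause.simps
    by (rule den_Seq 1 2 den_emit[of N disj_pre s, folded s1_def] den_emit[of N disj_in s2, folded s3_def])+
  then show ?case
    unfolding c by (simp add: s1_def s2_def s3_def fun_eq_iff)
qed simp

lemma den_emit_clauses:
  "writing N t i s \<Longrightarrow> den N (emit_clauses cs) s =
     Some (s(0 := rev (bits (clauses_bits (inst_all t i cs))) @ s 0))"
proof (induction cs arbitrary: s)
  case Nil
  then show ?case by (simp add: inst_all_def bits_def)
next
  case (Cons c cs)
  define s1 where "s1 = s(0 := rev (bits conj_pre) @ s 0)"
  define s2 where "s2 = s1(0 := rev (bits (clause_bits (instantiate t i c))) @ s1 0)"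
  define s3 where "s3 = s2(0 := rev (bits conj_in) @ s2 0)"
  have w: "writing N t i s1" "writing N t i s3"
    using Cons by (simp_all add: s1_def s2_def s3_def)
  have 1: "den N (emit_clause c) s1 = Some s2"
    using den_emit_clause[OF w(1)] by (simp add: s2_def)
  have "den N (emit_clauses (c # cs)) s = Some (s3(0 := rev (bits (clauses_bits (inst_all t i cs))) @ s3 0))"
    unfolding emit_clauses.simps
    by (rule den_Seq 1 Cons.IH[OF w(2)] den_emit[of N conj_pre s, folded s1_def]
        den_emit[of N conj_in s2, folded s3_def])+
  then show ?case
    by (simp add: s1_def s2_def s3_def fun_eq_iff inst_all_def)
qed

definition emit_input :: cmd where
  "emit_input =
     IfTop 1 {1} (emit_clauses [[pos (SR 0 1) 0 2]]) (emit_clauses [[pos (SR 0 2) 0 2]]) ;;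
     Pop 1 ;; Push 7 1 ;; Push 3 1"

definition emit_index_loop :: "nat \<Rightarrow> nat \<Rightarrow> literal list list \<Rightarrow> cmd" where
  "emit_index_loop v w cs = foreach v w (emit_clauses cs ;; Push 7 1)"

text \<open>\<open>T\<close> is held in two counters, 13 and 5: the outer loop takes its counter
  apart while the inner loop runs through the whole of \<open>T\<close>. The auxiliary variables 9
  and 10 differ for the same reason. Clearing 7 restarts the index at 0.\<close>

definition emit_time_loop :: "literal list list \<Rightarrow> cmd" where
  "emit_time_loop cs = foreach 13 9 ((emit_index_loop 5 10 cs ;; clear 7) ;; Push 6 1)"

text \<open>Variable 3 receives the input length, 4 the bound on the certificate, and 12 the length
  of the longest pair, whose final \<open>Push\<close> accounts for the separator. From 12 the time
  \<open>T\<close> is computed into 5 and copied to 13. Symbol 3 in the clause after the input loop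
  is the separator itself.\<close>

definition reduction_prog :: "machine \<Rightarrow> nat poly \<Rightarrow> nat poly \<Rightarrow> cmd" where
  "reduction_prog M p r =
     emit_clauses [[pos (SQ 0) 0 0]] ;;
     WhileTop 1 {1, 2} emit_input ;;
     emit_clauses [[pos (SR 0 3) 0 2]] ;; Push 7 1 ;;
     horner 3 4 11 9 (coeffs p) ;;
     foreach 3 9 (Push 12 1) ;; foreach 4 9 (Push 12 1) ;; Push 12 1 ;;
     horner 12 5 11 9 (coeffs r) ;;
     foreach 5 9 (Push 13 1) ;;
     emit_index_loop 4 9 guess_clauses ;;
     emit_index_loop 5 9 [[pos (SR 0 0) 0 2]] ;; clear 7 ;;
     emit_index_loop 5 9 (blank_clauses M) ;; clear 7 ;;
     emit_time_loop (step_clauses M) ;;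
     emit_clauses (final_clauses M) ;; emit_clause [pos (SQ 1) 0 0]"

lemma wf_reduction_prog: "wf_cmd (reduction_prog M p r)"
  by (simp add: reduction_prog_def emit_input_def emit_index_loop_def emit_time_loop_def wf_horner del: emit_clauses.simps emit_clause.simps)

text \<open>The stores between the parts of the program: the output, the rest of the input and the unary
  counters.\<close>

definition counters :: "bool list \<Rightarrow> nat list \<Rightarrow> nat \<Rightarrow> nat \<Rightarrow> nat \<Rightarrow> nat \<Rightarrow> nat \<Rightarrow> nat \<Rightarrow> nat \<Rightarrow> store" where
  "counters out x n m T t i l T' = (\<lambda>v.
     if v = 0 then rev (bits out) else if v = 1 then x else if v = 3 then unary n
     else if v = 4 then unary m else if v = 5 then unary T else if v = 6 then unary t
     else if v = 7 then unary i else if v = 12 then unary l else if v = 13 then unary T' else [])"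

lemma counters_emit:
  "(counters out x n m T t i l T')(0 := rev (bits b) @ counters out x n m T t i l T' 0) =
     counters (out @ b) x n m T t i l T'"
  by (simp add: counters_def fun_eq_iff)

lemma emit_counters:
  assumes "t \<le> N" "i \<le> N"
  shows "den N (emit_clauses cs) (counters out x n m T t i l T') =
    Some (counters (out @ clauses_bits (inst_all t i cs)) x n m T t i l T')"
  using den_emit_clauses[of N t i "counters out x n m T t i l T'" cs] assms
  by (simp add: counters_emit writing_def) (simp add: counters_def)

lemma input_loop:
  assumes "length x \<le> k" "i + length x \<le> N"
  shows "loop_den k (den N emit_input) 1 {1, 2} (counters out (bits x) n 0 0 0 i 0 0) =
    Some (counters (out @ clauses_bits (concat (map (\<lambda>j. inst_all 0 (i + j) [[pos (SR 0 (bits x ! j)) 0 2]]) [0..<length x])))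
      [] (n + length x) 0 0 0 (i + length x) 0 0)"
  using assms
proof (induction x arbitrary: k i n out)
  case Nil
  then show ?case by (cases k) (auto simp: counters_def)
next
  case (Cons b x)
  from Cons obtain k' where k: "k = Suc k'" by (cases k) auto
  define a :: nat where "a = (if b then 2 else 1)"
  define out' where "out' = out @ clauses_bits (inst_all 0 i [[pos (SR 0 a) 0 2]])"
  define s1 where "s1 = counters out' (bits (b # x)) n 0 0 0 i 0 0"
  define s2 where "s2 = counters out' (bits x) (Suc n) 0 0 0 (Suc i) 0 0"
  have top: "hd0 (counters out (bits (b # x)) n 0 0 0 i 0 0 1) = a"
    by (simp add: counters_def a_def)
  have "den N (emit_clauses [[pos (SR 0 a) 0 2]]) (counters out (bits (b # x)) n 0 0 0 i 0 0) = Some s1"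
    unfolding s1_def out'_def using Cons.prems by (intro emit_counters) auto
  then have 1: "den N (IfTop 1 {1} (emit_clauses [[pos (SR 0 1) 0 2]]) (emit_clauses [[pos (SR 0 2) 0 2]]))
      (counters out (bits (b # x)) n 0 0 0 i 0 0) = Some s1"
    unfolding den.simps(7) top by (simp add: a_def split: if_splits)
  have "den N (Pop 1 ;; Push 7 1 ;; Push 3 1) s1 = Some s2"
    by (simp add: s1_def s2_def counters_def fun_eq_iff)
  with 1 have 2: "den N emit_input (counters out (bits (b # x)) n 0 0 0 i 0 0) = Some s2"
    unfolding emit_input_def by (rule den_Seq)
  have 3: "loop_den k' (den N emit_input) 1 {1, 2} s2 =
      Some (counters (out' @ clauses_bits (concat (map (\<lambda>j. inst_all 0 (Suc i + j)
        [[pos (SR 0 (bits x ! j)) 0 2]]) [0..<length x]))) [] (Suc n + length x) 0 0 0 (Suc i + length x) 0 0)"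
    unfolding s2_def using Cons.prems k by (intro Cons.IH) auto
  have "a \<in> {1, 2}" by (simp add: a_def)
  then have "loop_den k (den N emit_input) 1 {1, 2} (counters out (bits (b # x)) n 0 0 0 i 0 0) =
      Option.bind (den N emit_input (counters out (bits (b # x)) n 0 0 0 i 0 0)) (loop_den k' (den N emit_input) 1 {1, 2})"
    unfolding k loop_den.simps top by simp
  also have "\<dots> = loop_den k' (den N emit_input) 1 {1, 2} s2"
    unfolding 2 by simp
  also note 3
  also have "out' @ clauses_bits (concat (map (\<lambda>j. inst_all 0 (Suc i + j)
        [[pos (SR 0 (bits x ! j)) 0 2]]) [0..<length x])) =
      out @ clauses_bits (concat (map (\<lambda>j. inst_all 0 (i + j)
        [[pos (SR 0 (bits (b # x) ! j)) 0 2]]) [0..<length (b # x)]))"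
  proof -
    have upt: "[0..<length (b # x)] = 0 # map Suc [0..<length x]"
      by (simp add: upt_conv_Cons map_Suc_upt del: upt_Suc)
    show ?thesis
      unfolding upt by (simp add: out'_def a_def clauses_bits_concat o_def)
  qed
  finally show ?case by (simp del: upt_Suc)
qed

end

context connectives
begin

lemma den_emit_loop:
  assumes d: "distinct [0, 6, 7, 8, v, w]"
    and s: "s v = unary k" "s w = []" "s 6 = unary t" "s 7 = unary i" "s 8 = []"
    and N: "k \<le> N" "t \<le> N" "i + k \<le> N"
  shows "den N (emit_index_loop v w cs) s =
    Some (s(0 := rev (bits (clauses_bits (concat (map (\<lambda>j. inst_all t j cs) [i..<i + k])))) @ s 0,
      7 := unary (i + k)))"
  unfolding clauses_bits_concat emit_index_loop_def
proof (rule den_foreach_emit[where P = "\<lambda>s. s 6 = unary t \<and> s 8 = []"])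
  fix s :: store and j
  assume "s 6 = unary t \<and> s 8 = []" "j < k" "s 7 = unary (i + j)"
  then have "writing N t (i + j) s"
    using N by (simp add: writing_def)
  then show "den N (emit_clauses cs) s =
      Some (s(0 := rev (bits (clauses_bits (inst_all t (i + j) cs))) @ s 0))"
    by (rule den_emit_clauses)
qed (use d s N in auto)

lemma counters_emit_loop:
  assumes "v = 4 \<and> k = m \<or> v = 5 \<and> k = T" "k \<le> N" "t \<le> N" "i + k \<le> N"
  shows "den N (emit_index_loop v 9 cs) (counters out x n m T t i l T') =
    Some (counters (out @ clauses_bits (concat (map (\<lambda>j. inst_all t j cs) [i..<i + k]))) x n m T t (i + k) l T')"
proof -
  let ?s = "counters out x n m T t i l T'"
  have "den N (emit_index_loop v 9 cs) ?s =
    Some (?s(0 := rev (bits (clauses_bits (concat (map (\<lambda>j. inst_all t j cs) [i..<i + k])))) @ ?s 0,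
      7 := unary (i + k)))"
    using assms by (intro den_emit_loop) (auto simp: counters_def)
  also have "?s(0 := rev (bits (clauses_bits (concat (map (\<lambda>j. inst_all t j cs) [i..<i + k])))) @ ?s 0,
      7 := unary (i + k)) =
    counters (out @ clauses_bits (concat (map (\<lambda>j. inst_all t j cs) [i..<i + k]))) x n m T t (i + k) l T'"
    by (simp add: counters_emit) (simp add: counters_def fun_eq_iff)
  finally show ?thesis .
qed

lemma counters_clear:
  assumes "i \<le> N"
  shows "den N (clear 7) (counters out x n m T t i l T') = Some (counters out x n m T t 0 l T')"
proof -
  let ?s = "counters out x n m T t i l T'"
  have "den N (clear 7) ?s = Some (?s(7 := []))"
    using assms by (intro den_clear) (auto simp: counters_def)
  also have "?s(7 := []) = counters out x n m T t 0 l T'"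
    by (simp add: counters_def fun_eq_iff)
  finally show ?thesis .
qed

lemma counters_copy:
  assumes "k \<le> N" "v \<in> {3, 4, 5}" "c \<in> {12, 13}" "counters out x n m T t i l T' v = unary k"
  shows "den N (foreach v 9 (Push c 1)) (counters out x n m T t i l T') =
    Some (counters out x n m T t i (if c = 12 then k + l else l) (if c = 13 then k + T' else T'))"
proof -
  let ?s = "counters out x n m T t i l T'"
  have "concat (replicate k [1]) = unary k" by (induction k) auto
  moreover have "den N (foreach v 9 (Push c 1)) ?s = Some (?s(c := concat (replicate k [1]) @ ?s c))"
    using assms by (intro den_foreach_const) (auto simp: counters_def)
  ultimately have "den N (foreach v 9 (Push c 1)) ?s = Some (?s(c := unary k @ ?s c))"
    by simp
  also have "?s(c := unary k @ ?s c) =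
      counters out x n m T t i (if c = 12 then k + l else l) (if c = 13 then k + T' else T')"
    using assms(3) by (auto simp: counters_def fun_eq_iff)
  finally show ?thesis .
qed

lemma counters_step_loop:
  assumes "T \<le> N"
  shows "den N (emit_time_loop cs)
      (counters out x n m T 0 0 l T) =
    Some (counters (out @ clauses_bits (concat (map (\<lambda>t. concat (map (\<lambda>j. inst_all t j cs) [0..<T])) [0..<T])))
      x n m T T 0 l T)"
proof -
  let ?s = "counters out x n m T 0 0 l T"
  let ?F = "\<lambda>t. clauses_bits (concat (map (\<lambda>j. inst_all t j cs) [0..<T]))"
  have "den N (emit_time_loop cs) ?s =
      Some (?s(0 := rev (bits (concat (map ?F [0..<0 + T]))) @ ?s 0, 6 := unary (0 + T)))"
    unfolding emit_time_loop_def
  proof (rule den_foreach_emit[where P = "\<lambda>s. s 5 = unary T \<and> s 7 = [] \<and> s 8 = [] \<and> s 10 = []"])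
    fix s :: store and t
    assume s: "s 5 = unary T \<and> s 7 = [] \<and> s 8 = [] \<and> s 10 = []" and t: "t < T" "s 6 = unary (0 + t)"
    let ?s1 = "s(0 := rev (bits (?F t)) @ s 0, 7 := unary T)"
    have "den N (emit_index_loop 5 10 cs) s = Some (s(0 := rev (bits
        (clauses_bits (concat (map (\<lambda>j. inst_all t j cs) [0..<0 + T])))) @ s 0, 7 := unary (0 + T)))"
      using s t assms by (intro den_emit_loop) auto
    then have 1: "den N (emit_index_loop 5 10 cs) s = Some ?s1"
      by simp
    have "den N (clear 7) ?s1 = Some (?s1(7 := []))"
      using assms by (intro den_clear) auto
    also have "?s1(7 := []) = s(0 := rev (bits (?F t)) @ s 0)"
      using s by (auto simp: fun_eq_iff)
    finally have 2: "den N (clear 7) ?s1 = Some (s(0 := rev (bits (?F t)) @ s 0))" .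
    from 1 2 have "den N (emit_index_loop 5 10 cs ;; clear 7) s =
        Some (s(0 := rev (bits (?F t)) @ s 0))"
      by (rule den_Seq)
    then show "den N (emit_index_loop 5 10 cs ;; clear 7) s =
        Some (s(0 := rev (bits (?F (0 + t))) @ s 0))"
      by simp
  qed (use assms in \<open>auto simp: counters_def\<close>)
  also have "?s(0 := rev (bits (concat (map ?F [0..<0 + T]))) @ ?s 0, 6 := unary (0 + T)) =
      counters (out @ clauses_bits (concat (map (\<lambda>t. concat (map (\<lambda>j. inst_all t j cs) [0..<T])) [0..<T])))
        x n m T T 0 l T"
    unfolding clauses_bits_concat[of "\<lambda>t. concat (map (\<lambda>j. inst_all t j cs) [0..<T])"]
    by (simp add: counters_emit) (simp add: counters_def fun_eq_iff)
  finally show ?thesis .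
qed

text \<open>The fuel has to cover the largest index, \<open>n + 1 + m + T\<close>, and, as required
  by \<open>den_horner\<close>, the two polynomials at the successors of their arguments,
  \<open>n + 1\<close> and \<open>n + m + 2\<close>.\<close>

lemma den_reduction_prog:
  fixes p r :: "nat poly"
  assumes n_def: "n = length x" and m_def: "m = poly p n" and T_def: "T = poly r (n + m + 1)"
    and N: "n + 1 + m + T \<le> N" "poly p (n + 1) \<le> N" "poly r (n + m + 2) \<le> N"
  shows "\<exists>s. den N (reduction_prog M p r) (input_store (bits x)) = Some s \<and>
    s 0 = rev (bits (encode (cnf_fm (run_clauses M (bits x @ [3]) m T) (accept_clause T))))"
proof -
  let ?i = "\<lambda>t cs js. clauses_bits (concat (map (\<lambda>j. inst_all t j cs) js))"
  define out1 where "out1 = [] @ clauses_bits (inst_all 0 0 [[pos (SQ 0) 0 0]])"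
  define out2 where "out2 = out1 @ clauses_bits (concat (map (\<lambda>j. inst_all 0 (0 + j)
    [[pos (SR 0 (bits x ! j)) 0 2]]) [0..<length x]))"
  define out3 where "out3 = out2 @ clauses_bits (inst_all 0 n [[pos (SR 0 3) 0 2]])"
  define out4 where "out4 = out3 @ ?i 0 guess_clauses [n + 1..<n + 1 + m]"
  define out5 where "out5 = out4 @ ?i 0 [[pos (SR 0 0) 0 2]] [n + 1 + m..<n + 1 + m + T]"
  define out6 where "out6 = out5 @ ?i 0 (blank_clauses M) [0..<0 + T]"
  define out7 where "out7 = out6 @ clauses_bits (concat (map (\<lambda>t. concat (map (\<lambda>j. inst_all t j (step_clauses M)) [0..<T])) [0..<T]))"
  define out8 where "out8 = out7 @ clauses_bits (inst_all T 0 (final_clauses M))"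
  define out9 where "out9 = out8 @ clause_bits (accept_clause T)"
  have s0: "input_store (bits x) = counters [] (bits x) 0 0 0 0 0 0 0"
    by (simp add: input_store_def counters_def fun_eq_iff)
  have 1: "den N (emit_clauses [[pos (SQ 0) 0 0]]) (counters [] (bits x) 0 0 0 0 0 0 0) =
      Some (counters out1 (bits x) 0 0 0 0 0 0 0)"
    unfolding out1_def by (rule emit_counters) auto
  have 2: "den N (WhileTop 1 {1, 2} emit_input) (counters out1 (bits x) 0 0 0 0 0 0 0) =
      Some (counters out2 [] n 0 0 0 n 0 0)"
    using input_loop[of x N 0 N out1 0] N(1) unfolding den.simps(8) out2_def by (simp add: n_def)
  have 3: "den N (emit_clauses [[pos (SR 0 3) 0 2]]) (counters out2 [] n 0 0 0 n 0 0) =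
      Some (counters out3 [] n 0 0 0 n 0 0)"
    unfolding out3_def using N by (intro emit_counters) auto
  have 4: "den N (Push 7 1) (counters out3 [] n 0 0 0 n 0 0) = Some (counters out3 [] n 0 0 0 (n + 1) 0 0)"
    by (simp add: counters_def fun_eq_iff)
  have "den N (horner 3 4 11 9 (coeffs p)) (counters out3 [] n 0 0 0 (n + 1) 0 0) =
      Some ((counters out3 [] n 0 0 0 (n + 1) 0 0)(4 := unary (horner_val (coeffs p) n)))"
    using N horner_val_coeffs[of p "Suc n"] by (intro den_horner) (auto simp: counters_def)
  also have "(counters out3 [] n 0 0 0 (n + 1) 0 0)(4 := unary (horner_val (coeffs p) n)) =
      counters out3 [] n m 0 0 (n + 1) 0 0"
    by (simp add: counters_def fun_eq_iff horner_val_coeffs m_def)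
  finally have 5: "den N (horner 3 4 11 9 (coeffs p)) (counters out3 [] n 0 0 0 (n + 1) 0 0) =
      Some (counters out3 [] n m 0 0 (n + 1) 0 0)" .
  have 6: "den N (foreach 3 9 (Push 12 1)) (counters out3 [] n m 0 0 (n + 1) 0 0) =
      Some (counters out3 [] n m 0 0 (n + 1) n 0)"
    using counters_copy[of n N 3 12 out3 "[]" n m 0 0 "n + 1" 0 0] N by (simp add: counters_def)
  have 7: "den N (foreach 4 9 (Push 12 1)) (counters out3 [] n m 0 0 (n + 1) n 0) =
      Some (counters out3 [] n m 0 0 (n + 1) (m + n) 0)"
    using counters_copy[of m N 4 12 out3 "[]" n m 0 0 "n + 1" n 0] N by (simp add: counters_def)
  have 8: "den N (Push 12 1) (counters out3 [] n m 0 0 (n + 1) (m + n) 0) =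
      Some (counters out3 [] n m 0 0 (n + 1) (n + m + 1) 0)"
    by (simp add: counters_def fun_eq_iff add.commute)
  have "den N (horner 12 5 11 9 (coeffs r)) (counters out3 [] n m 0 0 (n + 1) (n + m + 1) 0) =
      Some ((counters out3 [] n m 0 0 (n + 1) (n + m + 1) 0)(5 := unary (horner_val (coeffs r) (n + m + 1))))"
    using N horner_val_coeffs[of r "Suc (n + m + 1)"] by (intro den_horner) (auto simp: counters_def)
  also have "(counters out3 [] n m 0 0 (n + 1) (n + m + 1) 0)(5 := unary (horner_val (coeffs r) (n + m + 1))) =
      counters out3 [] n m T 0 (n + 1) (n + m + 1) 0"
    by (simp add: counters_def fun_eq_iff horner_val_coeffs T_def)
  finally have 9: "den N (horner 12 5 11 9 (coeffs r)) (counters out3 [] n m 0 0 (n + 1) (n + m + 1) 0) =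
      Some (counters out3 [] n m T 0 (n + 1) (n + m + 1) 0)" .
  have 10: "den N (foreach 5 9 (Push 13 1)) (counters out3 [] n m T 0 (n + 1) (n + m + 1) 0) =
      Some (counters out3 [] n m T 0 (n + 1) (n + m + 1) T)"
    using counters_copy[of T N 5 13 out3 "[]" n m T 0 "n + 1" "n + m + 1" 0] N by (simp add: counters_def)
  have 11: "den N (emit_index_loop 4 9 guess_clauses)
      (counters out3 [] n m T 0 (n + 1) (n + m + 1) T) = Some (counters out4 [] n m T 0 (n + 1 + m) (n + m + 1) T)"
    unfolding out4_def using N by (intro counters_emit_loop) auto
  have 12: "den N (emit_index_loop 5 9 [[pos (SR 0 0) 0 2]])
      (counters out4 [] n m T 0 (n + 1 + m) (n + m + 1) T) =
      Some (counters out5 [] n m T 0 (n + 1 + m + T) (n + m + 1) T)"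
    unfolding out5_def using N by (intro counters_emit_loop) auto
  have 13: "den N (clear 7) (counters out5 [] n m T 0 (n + 1 + m + T) (n + m + 1) T) =
      Some (counters out5 [] n m T 0 0 (n + m + 1) T)"
    using N by (intro counters_clear) auto
  have 14: "den N (emit_index_loop 5 9 (blank_clauses M))
      (counters out5 [] n m T 0 0 (n + m + 1) T) =
      Some (counters out6 [] n m T 0 (0 + T) (n + m + 1) T)"
    unfolding out6_def using N by (intro counters_emit_loop) auto
  have 15: "den N (clear 7) (counters out6 [] n m T 0 (0 + T) (n + m + 1) T) =
      Some (counters out6 [] n m T 0 0 (n + m + 1) T)"
    using N by (intro counters_clear) auto
  have 16: "den N (emit_time_loop (step_clauses M))
      (counters out6 [] n m T 0 0 (n + m + 1) T) = Some (counters out7 [] n m T T 0 (n + m + 1) T)"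
    unfolding out7_def using N by (intro counters_step_loop) auto
  have 17: "den N (emit_clauses (final_clauses M)) (counters out7 [] n m T T 0 (n + m + 1) T) =
      Some (counters out8 [] n m T T 0 (n + m + 1) T)"
    unfolding out8_def using N by (intro emit_counters) auto
  have "writing N T 0 (counters out8 [] n m T T 0 (n + m + 1) T)"
    using N by (simp add: writing_def counters_def)
  from den_emit_clause[OF this, of "[pos (SQ 1) 0 0]"]
  have 18: "den N (emit_clause [pos (SQ 1) 0 0]) (counters out8 [] n m T T 0 (n + m + 1) T) =
      Some (counters out9 [] n m T T 0 (n + m + 1) T)"
    unfolding out9_def accept_clause_def by (simp only: counters_emit)
  have "den N (reduction_prog M p r) (input_store (bits x)) =
      Some (counters out9 [] n m T T 0 (n + m + 1) T)"
    unfolding reduction_prog_def s0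
    by (rule den_Seq 1 2 3 4 5 6 7 8 9 10 11 12 13 14 15 16 17 18)+
  moreover have "out9 = encode (cnf_fm (run_clauses M (bits x @ [3]) m T) (accept_clause T))"
  proof -
    have nth: "map (\<lambda>i. inst_all 0 i [[pos (SR 0 ((bits x @ [3]) ! i)) 0 2]]) [0..<n] =
        map (\<lambda>i. inst_all 0 i [[pos (SR 0 (bits x ! i)) 0 2]]) [0..<n]"
      by (rule map_cong) (simp_all add: nth_append n_def)
    have upt: "[0..<length (bits x @ [3])] = [0..<n] @ [n]"
      by (simp add: n_def)
    have last: "(bits x @ [3]) ! n = 3"
      by (simp add: n_def nth_append)
    have input: "clauses_bits (input_clauses (bits x @ [3]) m T) = out5"
      unfolding input_clauses_def upt map_append nth out5_def out4_def out3_def out2_def out1_def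
      by (simp add: last[unfolded n_def] n_def clauses_bits_concat inst_all_def)
    show ?thesis
      unfolding encode_cnf run_clauses_def clauses_bits_simps(3) input
      by (simp add: out9_def out8_def out7_def out6_def)
  qed
  ultimately show ?thesis
    by (simp add: counters_def)
qed

lemma accept_template: "accept_clause T = [(True, SQ 1, T, 0)]"
  by (simp add: accept_clause_def)

lemma instantiate_eq_Nil: "instantiate t i c = [] \<longleftrightarrow> c = []"
  by (simp add: instantiate_def)

lemma run_clauses_nonempty: "\<forall>c \<in> set (run_clauses M w m T). c \<noteq> []"
  by (auto simp: ball_run_clauses ball_input_clauses instantiate_eq_Nil guess_clauses_def
      blank_clauses_def step_clauses_def scan_clauses_def write_clauses_def move_clauses_def
      final_clauses_def Let_def)

lemma NP_reducible:
  assumes "A \<in> NP"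
  shows "polytime_reducible A (sat_problem S)"
proof -
  obtain Q and p :: "nat poly" where Q: "polytime_rel Q"
    and A: "\<And>x. x \<in> A \<longleftrightarrow> (\<exists>u. length u \<le> poly p (length x) \<and> Q x u)"
    using assms unfolding NP_def by blast
  obtain M and r :: "nat poly" where M: "turing_machine M"
    and run: "\<And>x u. \<exists>t \<le> poly r (length (pair x u)). fst (run M t (pair x u)) = (if Q x u then 1 else 2)"
    using Q unfolding polytime_rel_def by blast
  define m where "m x = poly p (length x)" for x :: "bool list"
  \<comment> \<open>The length of the longest admissible pair: input, separator and a certificate of
    length \<open>m x\<close>. By monotonicity of \<open>r\<close> this one time bound serves all
    certificates.\<close>
  define T where "T x = poly r (length x + m x + 1)" for x :: "bool list"
  define F where "F x = cnf_fm (run_clauses M (bits x @ [3]) (m x) (T x)) (accept_clause (T x))" for x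
  have acc: "fst (run M (T x) (pair x u)) = 1 \<longleftrightarrow> Q x u" if u: "length u \<le> m x" for x u
  proof -
    obtain t where t: "t \<le> poly r (length (pair x u))" "fst (run M t (pair x u)) = (if Q x u then 1 else 2)"
      using run by blast
    have "poly r (length (pair x u)) \<le> T x"
      unfolding T_def using u by (intro poly_nat_mono) (simp add: pair_def)
    with t have "run M (T x) (pair x u) = run M t (pair x u)"
      by (intro run_halted) auto
    with t show ?thesis by simp
  qed
  have w: "set (bits x @ [3]) \<subseteq> {..<4}" for x
    by (auto simp: bits_def)
  have sat: "satisfiable (F x) \<longleftrightarrow> (\<exists>u. length u \<le> m x \<and> fst (run M (T x) (pair x u)) = 1)" for x
  proof -
    have "\<forall>c \<in> insert (accept_clause (T x)) (set (run_clauses M (bits x @ [3]) (m x) (T x))). c \<noteq> []"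
      using run_clauses_nonempty by (simp add: accept_template)
    then have "satisfiable (F x) \<longleftrightarrow> (\<exists>v. \<forall>c \<in> insert (accept_clause (T x))
        (set (run_clauses M (bits x @ [3]) (m x) (T x))). sat_clause v c)"
      unfolding F_def by (rule satisfiable_cnf)
    also have "\<dots> \<longleftrightarrow> (\<exists>u. length u \<le> m x \<and> fst (run M (T x) (pair x u)) = 1)"
      using sat_accepts[OF M w] run_sat[OF M w] unfolding pair_def append_assoc[symmetric] by blast
    finally show ?thesis .
  qed
  have "x \<in> A \<longleftrightarrow> satisfiable (F x)" for x
    unfolding A sat using acc by (auto simp: m_def)
  moreover have "F x \<in> lang S" for x
    unfolding F_def by (rule cnf_lang)
  ultimately have red: "x \<in> A \<longleftrightarrow> encode (F x) \<in> sat_problem S" for x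
    unfolding sat_problem_def using inj_encode by (auto simp: inj_image_mem_iff)
  have "polytime_fun (\<lambda>x. encode (F x))"
  proof (rule polytime_funI[OF wf_reduction_prog])
    fix x :: "bool list"
    \<comment> \<open>A sum of polynomials dominating each of the fuel requirements of
      \<open>den_reduction_prog\<close>; the summands with \<open>p\<close> at \<open>n + 1\<close>
      and \<open>r\<close> at \<open>n + m + 2\<close> come from Horner's scheme.\<close>
    let ?q = "[:1, 1:] + p + pcompose r ([:1, 1:] + p) + pcompose p [:1, 1:] + pcompose r ([:2, 1:] + p)"
    show "\<exists>s. den (poly ?q (length x)) (reduction_prog M p r) (input_store (bits x)) = Some s \<and>
        s 0 = rev (bits (encode (F x)))"
      unfolding F_def T_def m_def
      by (rule den_reduction_prog[OF refl refl]) (simp_all add: poly_pcompose add.commute add.left_commute)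
  qed
  with red show ?thesis
    unfolding polytime_reducible_def by blast
qed

end

section \<open>Consistency of literals as a program\<close>

text \<open>A push writes a symbol fixed in the program, so copying an unknown top symbol means
  branching over the alphabet \<open>as\<close>. The symbol is popped only after the branch.\<close>

definition move :: "nat list \<Rightarrow> nat \<Rightarrow> nat \<Rightarrow> cmd" where
  "move as v w = foldr (\<lambda>a c. IfTop v {a} (Push w a) c) as Skip ;; Pop v"

lemma wf_move [simp]: "wf_cmd (move as v w) \<longleftrightarrow> 1 \<le> v"
proof -
  have "1 \<le> v \<Longrightarrow> wf_cmd (foldr (\<lambda>a c. IfTop v {a} (Push w a) c) as Skip)"
    by (induction as) auto
  then show ?thesis by (auto simp: move_def)
qed

lemma den_move:
  assumes "v \<noteq> w" "s v = a # xs" "a \<in> set as"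
  shows "den N (move as v w) s = Some (s(w := a # s w, v := xs))"
proof -
  have "den N (foldr (\<lambda>a c. IfTop v {a} (Push w a) c) as Skip) s = Some (s(w := a # s w))"
    using assms(2,3) by (induction as) auto
  then show ?thesis
    using assms by (simp add: move_def)
qed

definition transfer :: "nat list \<Rightarrow> nat \<Rightarrow> nat \<Rightarrow> cmd" where
  "transfer as v w = WhileTop v (set as) (move as v w)"

lemma loop_transfer:
  assumes "v \<noteq> w" "hd0 ys \<notin> set as"
  shows "s v = xs @ ys \<Longrightarrow> set xs \<subseteq> set as \<Longrightarrow> length xs \<le> k \<Longrightarrow>
    loop_den k (den N (move as v w)) v (set as) s = Some (s(v := ys, w := rev xs @ s w))"
proof (induction xs arbitrary: k s)
  case Nil
  then show ?case using assms by (cases k) (auto simp: fun_eq_iff)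
next
  case (Cons x xs)
  then obtain k' where k: "k = Suc k'" by (cases k) auto
  define s1 where "s1 = s(w := x # s w, v := xs @ ys)"
  have 1: "den N (move as v w) s = Some s1"
    unfolding s1_def using Cons.prems assms by (intro den_move) auto
  have 2: "loop_den k' (den N (move as v w)) v (set as) s1 = Some (s1(v := ys, w := rev xs @ s1 w))"
    using Cons.prems k assms by (intro Cons.IH) (auto simp: s1_def)
  have 3: "s1(v := ys, w := rev xs @ s1 w) = s(v := ys, w := rev (x # xs) @ s w)"
    using assms by (auto simp: s1_def fun_eq_iff)
  show ?case
    using Cons.prems 1 2 unfolding 3 k loop_den.simps by (simp add: fun_eq_iff)
qed

lemma den_transfer:
  assumes "v \<noteq> w" "hd0 ys \<notin> set as" "s v = xs @ ys" "set xs \<subseteq> set as" "length xs \<le> N"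
  shows "den N (transfer as v w) s = Some (s(v := ys, w := rev xs @ s w))"
  unfolding transfer_def den.simps(8) using assms by (intro loop_transfer)

lemma wf_transfer [simp]: "wf_cmd (transfer as v w) \<longleftrightarrow> 1 \<le> v"
  by (auto simp: transfer_def)

definition discard :: "nat list \<Rightarrow> nat \<Rightarrow> cmd" where
  "discard as v = WhileTop v (set as) (Pop v)"

lemma loop_discard:
  assumes "hd0 ys \<notin> set as"
  shows "s v = xs @ ys \<Longrightarrow> set xs \<subseteq> set as \<Longrightarrow> length xs \<le> k \<Longrightarrow>
    loop_den k (den N (Pop v)) v (set as) s = Some (s(v := ys))"
proof (induction xs arbitrary: k s)
  case Nil
  then show ?case using assms by (cases k) (auto simp: fun_eq_iff)
next
  case (Cons x xs)
  then obtain k' where k: "k = Suc k'" by (cases k) auto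
  define s1 where "s1 = s(v := xs @ ys)"
  have 1: "den N (Pop v) s = Some s1"
    using Cons.prems by (simp add: s1_def)
  have 2: "loop_den k' (den N (Pop v)) v (set as) s1 = Some (s1(v := ys))"
    using Cons.prems k assms by (intro Cons.IH) (auto simp: s1_def)
  have 3: "s1(v := ys) = s(v := ys)"
    by (auto simp: s1_def fun_eq_iff)
  show ?case
    using Cons.prems 1 2 unfolding 3 k loop_den.simps by (simp add: fun_eq_iff del: den.simps)
qed

lemma den_discard:
  assumes "hd0 ys \<notin> set as" "s v = xs @ ys" "set xs \<subseteq> set as" "length xs \<le> N"
  shows "den N (discard as v) s = Some (s(v := ys))"
  unfolding discard_def den.simps(8) using assms by (intro loop_discard)

lemma wf_discard [simp]: "wf_cmd (discard as v) \<longleftrightarrow> 1 \<le> v"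
  by (auto simp: discard_def)

abbreviation flag :: "bool \<Rightarrow> nat list" where
  "flag b \<equiv> (if b then [1] else [])"

text \<open>The test keeps the flag at one symbol at most, so that raising it repeatedly is
  harmless.\<close>

definition raise :: "nat \<Rightarrow> cmd" where
  "raise v = IfTop v {1} Skip (Push v 1)"

lemma den_raise: "s v = flag b \<Longrightarrow> den N (raise v) s = Some (s(v := flag True))"
  by (auto simp: raise_def fun_eq_iff)

lemma wf_raise [simp]: "wf_cmd (raise v) \<longleftrightarrow> 1 \<le> v"
  by (auto simp: raise_def)

text \<open>A literal is stored as the digits of its variable followed by 4 or 5 for its truth value.\<close>

type_synonym entry = "bool \<times> bool list"

definition end_sym :: "bool \<Rightarrow> nat" where
  "end_sym b = (if b then 5 else 4)"

fun entry_syms :: "entry \<Rightarrow> nat list" where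
  "entry_syms (b, ds) = bits ds @ [end_sym b]"

definition entries_syms :: "entry list \<Rightarrow> nat list" where
  "entries_syms E = concat (map entry_syms E)"

lemma entries_syms_simps [simp]:
  "entries_syms [] = []"
  "entries_syms ((b, ds) # E) = bits ds @ end_sym b # entries_syms E"
  by (simp_all add: entries_syms_def)

lemma set_bits: "set (bits ds) \<subseteq> {1, 2}"
  by (auto simp: bits_def)

lemma end_sym_simps [simp]: "end_sym b \<in> {4, 5}" "end_sym b \<noteq> 1" "end_sym b \<noteq> Suc 0" "end_sym b \<noteq> 2"
  "end_sym b = 4 \<longleftrightarrow> \<not> b" "end_sym b = 5 \<longleftrightarrow> b"
  by (auto simp: end_sym_def)

lemma set_entries_syms: "set (entries_syms E) \<subseteq> {1, 2, 4, 5}"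
proof (induction E)
  case (Cons e E)
  then show ?case
    using set_bits by (cases e) (auto simp: end_sym_def)
qed simp

primrec consistent :: "entry list \<Rightarrow> bool" where
  "consistent [] \<longleftrightarrow> True"
| "consistent (e # E) \<longleftrightarrow> (\<forall>e' \<in> set E. snd e' = snd e \<longrightarrow> fst e' = fst e) \<and> consistent E"

lemma consistent_iff:
  "consistent E \<longleftrightarrow> (\<forall>e \<in> set E. \<forall>e' \<in> set E. snd e = snd e' \<longrightarrow> fst e = fst e')"
proof (induction E)
  case (Cons e E)
  show ?case unfolding consistent.simps Cons by auto
qed simp

text \<open>
  Variable 4 holds the literals, the topmost of which is compared with all others: its digits are in
  variable 8 and its truth value in variable 11, while the other literals move to variable 9.
  Variable 7 holds the digits already compared and variable 10 is raised when digits differ.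
\<close>

definition compare_digit :: cmd where
  "compare_digit =
     IfTop 4 {1} (IfTop 8 {1} Skip (raise 10)) (IfTop 8 {2} Skip (raise 10)) ;;
     IfTop 8 {1, 2} (move [1, 2] 8 7) Skip ;; move [1, 2] 4 9"

text \<open>The condition \<open>take 1 es \<noteq> [d]\<close> also covers the case that the stored
  digits have run out: the test of an empty stack against 1 or 2 fails and raises the flag.\<close>

lemma den_compare_digit:
  assumes "s 4 = bits (d # ds) @ rest" "s 8 = bits es" "s 10 = flag b"
  shows "den N compare_digit s = Some (s(4 := bits ds @ rest, 9 := bits [d] @ s 9,
    7 := bits (take 1 es) @ s 7, 8 := bits (drop 1 es), 10 := flag (b \<or> take 1 es \<noteq> [d])))"
proof -
  define s1 where "s1 = s(10 := flag (b \<or> take 1 es \<noteq> [d]))"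
  define s2 where "s2 = s1(7 := bits (take 1 es) @ s 7, 8 := bits (drop 1 es))"
  have r: "den N (raise 10) s = Some (s(10 := [1]))"
    using den_raise[of s 10 b N] assms by simp
  have 1: "den N (IfTop 4 {1} (IfTop 8 {1} Skip (raise 10)) (IfTop 8 {2} Skip (raise 10))) s = Some s1"
    using assms r by (cases es; cases d) (auto simp: s1_def fun_eq_iff)
  have 2: "den N (IfTop 8 {1, 2} (move [1, 2] 8 7) Skip) s1 = Some s2"
  proof (cases es)
    case Nil
    then show ?thesis
      using assms by (auto simp: s1_def s2_def fun_eq_iff)
  next
    case (Cons e es')
    have "den N (move [1, 2] 8 7) s1 = Some (s1(7 := bits [e] @ s1 7, 8 := bits es'))"
      using den_move[of 8 7 s1 "if e then 2 else 1" "bits es'" "[1, 2]" N] assms Cons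
      by (simp add: s1_def)
    moreover have "s1(7 := bits [e] @ s1 7, 8 := bits es') = s2"
      using Cons by (simp add: s1_def s2_def)
    moreover have "hd0 (s1 8) \<in> {1, 2}"
      using assms Cons by (simp add: s1_def)
    ultimately show ?thesis by simp
  qed
  have 3: "den N (move [1, 2] 4 9) s2 = Some (s2(9 := bits [d] @ s2 9, 4 := bits ds @ rest))"
    using den_move[of 4 9 s2 "if d then 2 else 1" "bits ds @ rest" "[1, 2]" N] assms
    by (simp add: s1_def s2_def)
  have "den N compare_digit s = Some (s2(9 := bits [d] @ s2 9, 4 := bits ds @ rest))"
    unfolding compare_digit_def by (rule den_Seq 1 2 3)+
  also have "s2(9 := bits [d] @ s2 9, 4 := bits ds @ rest) = s(4 := bits ds @ rest, 9 := bits [d] @ s 9,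
    7 := bits (take 1 es) @ s 7, 8 := bits (drop 1 es), 10 := flag (b \<or> take 1 es \<noteq> [d]))"
    by (auto simp: s1_def s2_def fun_eq_iff)
  finally show ?thesis .
qed

lemma loop_compare:
  assumes "hd0 rest \<notin> {1, 2}"
  shows "s 4 = bits ds @ rest \<Longrightarrow> s 8 = bits es \<Longrightarrow> s 10 = flag b \<Longrightarrow> length ds \<le> k \<Longrightarrow>
    loop_den k (den N compare_digit) 4 {1, 2} s = Some (s(4 := rest, 9 := rev (bits ds) @ s 9,
      7 := rev (bits (take (length ds) es)) @ s 7, 8 := bits (drop (length ds) es),
      10 := flag (b \<or> take (length ds) es \<noteq> ds)))"
proof (induction ds arbitrary: k s es b)
  case Nil
  then show ?case using assms by (cases k) (auto simp: fun_eq_iff)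
next
  case (Cons d ds)
  then obtain k' where k: "k = Suc k'" by (cases k) auto
  define b1 where "b1 = (b \<or> take 1 es \<noteq> [d])"
  define s1 where "s1 = s(4 := bits ds @ rest, 9 := bits [d] @ s 9,
    7 := bits (take 1 es) @ s 7, 8 := bits (drop 1 es), 10 := flag b1)"
  define s2 where "s2 = s1(4 := rest, 9 := rev (bits ds) @ s1 9,
      7 := rev (bits (take (length ds) (drop 1 es))) @ s1 7, 8 := bits (drop (length ds) (drop 1 es)),
      10 := flag (b1 \<or> take (length ds) (drop 1 es) \<noteq> ds))"
  have 1: "den N compare_digit s = Some s1"
    unfolding s1_def b1_def using Cons.prems by (intro den_compare_digit)
  have 2: "loop_den k' (den N compare_digit) 4 {1, 2} s1 = Some s2"
    unfolding s2_def using Cons.prems k by (intro Cons.IH) (auto simp: s1_def)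
  have "hd0 (s 4) \<in> {1, 2}"
    using Cons.prems by simp
  then have "loop_den k (den N compare_digit) 4 {1, 2} s = Some s2"
    using 1 2 unfolding k loop_den.simps by simp
  also have "s2 = s(4 := rest, 9 := rev (bits (d # ds)) @ s 9,
      7 := rev (bits (take (length (d # ds)) es)) @ s 7, 8 := bits (drop (length (d # ds)) es),
      10 := flag (b \<or> take (length (d # ds)) es \<noteq> d # ds))"
    by (cases es) (auto simp: s2_def s1_def b1_def fun_eq_iff)
  finally show ?case .
qed

text \<open>Digits remaining in 8 reveal that the stored numeral is longer, a case which the loop
  over 4 cannot notice. The digits in 7 then return on top of them, restoring 8 for the next
  comparison.\<close>

definition compare_entry :: cmd where
  "compare_entry =
     WhileTop 4 {1, 2} compare_digit ;;
     IfTop 8 {1, 2} (raise 10) Skip ;;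
     transfer [1, 2] 7 8 ;;
     IfTop 10 {1} Skip
       (IfTop 4 {4} (IfTop 11 {4} Skip (raise 5)) (IfTop 11 {5} Skip (raise 5))) ;;
     discard [1] 10 ;; move [4, 5] 4 9"

lemma den_compare_entry:
  assumes s: "s 4 = bits ds @ end_sym b # rest" "s 8 = bits es" "s 11 = [end_sym c]" "s 7 = []" "s 10 = []"
    "s 5 = flag f"
    and N: "length ds \<le> N" "length es \<le> N" "1 \<le> N"
  shows "den N compare_entry s = Some (s(4 := rest, 9 := rev (entry_syms (b, ds)) @ s 9,
    5 := flag (f \<or> (ds = es \<and> b \<noteq> c))))"
proof -
  let ?n = "length ds"
  define s1 where "s1 = s(4 := end_sym b # rest, 9 := rev (bits ds) @ s 9,
    7 := rev (bits (take ?n es)), 8 := bits (drop ?n es), 10 := flag (take ?n es \<noteq> ds))"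
  define s2 where "s2 = s1(10 := flag (ds \<noteq> es))"
  define s3 where "s3 = s(4 := end_sym b # rest, 9 := rev (bits ds) @ s 9, 10 := flag (ds \<noteq> es))"
  define s4 where "s4 = s3(5 := flag (f \<or> (ds = es \<and> b \<noteq> c)))"
  define s5 where "s5 = s4(10 := [])"
  have "loop_den N (den N compare_digit) 4 {1, 2} s = Some (s(4 := end_sym b # rest, 9 := rev (bits ds) @ s 9,
      7 := rev (bits (take (length ds) es)) @ s 7, 8 := bits (drop (length ds) es),
      10 := flag (False \<or> take (length ds) es \<noteq> ds)))"
    using s N by (intro loop_compare) auto
  then have 1: "den N (WhileTop 4 {1, 2} compare_digit) s = Some s1"
    by (simp add: s1_def s)
  have 2: "den N (IfTop 8 {1, 2} (raise 10) Skip) s1 = Some s2"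
  proof (cases "drop ?n es")
    case Nil
    then have "take ?n es = es" by simp
    with Nil show ?thesis by (auto simp: s1_def s2_def fun_eq_iff)
  next
    case (Cons e es')
    then have "ds \<noteq> es" by auto
    moreover have "hd0 (s1 8) \<in> {1, 2}" using Cons by (simp add: s1_def)
    moreover have "den N (raise 10) s1 = Some (s1(10 := flag True))"
      by (rule den_raise[of _ _ "take ?n es \<noteq> ds"]) (simp add: s1_def)
    ultimately show ?thesis by (simp add: s2_def)
  qed
  have "den N (transfer [1, 2] 7 8) s2 = Some (s2(7 := [], 8 := rev (rev (bits (take ?n es))) @ s2 8))"
    using N set_bits[of "take ?n es"] by (intro den_transfer) (auto simp: s2_def s1_def)
  also have "s2(7 := [], 8 := rev (rev (bits (take ?n es))) @ s2 8) = s3"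
    using s by (auto simp: s3_def s2_def s1_def fun_eq_iff simp flip: bits_append)
  finally have 3: "den N (transfer [1, 2] 7 8) s2 = Some s3" .
  have r: "den N (raise 5) s3 = Some (s3(5 := [1]))"
    using den_raise[of s3 5 f N] s by (simp add: s3_def)
  have 4: "den N (IfTop 10 {1} Skip
       (IfTop 4 {4} (IfTop 11 {4} Skip (raise 5)) (IfTop 11 {5} Skip (raise 5)))) s3 = Some s4"
    using s r by (cases b; cases c) (auto simp: s3_def s4_def fun_eq_iff)
  have "den N (discard [1] 10) s4 = Some (s4(10 := []))"
    using N by (intro den_discard[of _ _ _ _ "flag (ds \<noteq> es)"]) (auto simp: s4_def s3_def)
  then have 5: "den N (discard [1] 10) s4 = Some s5"
    by (simp add: s5_def)
  have 6: "den N (move [4, 5] 4 9) s5 = Some (s5(9 := end_sym b # s5 9, 4 := rest))"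
    by (rule den_move) (auto simp: s5_def s4_def s3_def end_sym_def)
  have "den N compare_entry s = Some (s5(9 := end_sym b # s5 9, 4 := rest))"
    unfolding compare_entry_def by (rule den_Seq 1 2 3 4 5 6)+
  also have "s5(9 := end_sym b # s5 9, 4 := rest) =
      s(4 := rest, 9 := rev (entry_syms (b, ds)) @ s 9, 5 := flag (f \<or> (ds = es \<and> b \<noteq> c)))"
    using s by (auto simp: s5_def s4_def s3_def fun_eq_iff)
  finally show ?thesis .
qed

text \<open>Every entry contributes at least its end symbol, so the number of symbols bounds the
  number of iterations. The condition on \<open>rest\<close> makes the loop stop at a separator or
  at the bottom of the stack.\<close>

lemma loop_compare_entries:
  assumes rest: "hd0 rest \<notin> {1, 2, 4, 5}" and N: "length es \<le> N" "1 \<le> N"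
  shows "s 4 = entries_syms E @ rest \<Longrightarrow> s 8 = bits es \<Longrightarrow> s 11 = [end_sym c] \<Longrightarrow> s 7 = [] \<Longrightarrow> s 10 = [] \<Longrightarrow>
    s 5 = flag f \<Longrightarrow> length (entries_syms E) \<le> k \<Longrightarrow> k \<le> N \<Longrightarrow>
    loop_den k (den N compare_entry) 4 {1, 2, 4, 5} s = Some (s(4 := rest, 9 := rev (entries_syms E) @ s 9,
      5 := flag (f \<or> \<not> (\<forall>e \<in> set E. snd e = es \<longrightarrow> fst e = c))))"
proof (induction E arbitrary: k s f)
  case Nil
  then show ?case using rest by (cases k) (auto simp: fun_eq_iff)
next
  case (Cons e E)
  obtain b ds where e: "e = (b, ds)" by (cases e)
  from Cons.prems e obtain k' where k: "k = Suc k'" by (cases k) auto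
  define f1 where "f1 = (f \<or> (ds = es \<and> b \<noteq> c))"
  define s1 where "s1 = s(4 := entries_syms E @ rest, 9 := rev (entry_syms (b, ds)) @ s 9, 5 := flag f1)"
  define s2 where "s2 = s1(4 := rest, 9 := rev (entries_syms E) @ s1 9,
      5 := flag (f1 \<or> \<not> (\<forall>e \<in> set E. snd e = es \<longrightarrow> fst e = c)))"
  have 1: "den N compare_entry s = Some s1"
    unfolding s1_def f1_def using Cons.prems e N by (intro den_compare_entry) auto
  have 2: "loop_den k' (den N compare_entry) 4 {1, 2, 4, 5} s1 = Some s2"
    unfolding s2_def using Cons.prems k e by (intro Cons.IH) (auto simp: s1_def)
  have "hd0 (s 4) \<in> {1, 2, 4, 5}"
    using Cons.prems e by (cases ds) (auto simp: end_sym_def)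
  then have "loop_den k (den N compare_entry) 4 {1, 2, 4, 5} s = Some s2"
    using 1 2 unfolding k loop_den.simps by simp
  also have "s2 = s(4 := rest, 9 := rev (entries_syms (e # E)) @ s 9,
      5 := flag (f \<or> \<not> (\<forall>e \<in> set (e # E). snd e = es \<longrightarrow> fst e = c)))"
    using e by (auto simp: s2_def s1_def f1_def fun_eq_iff)
  finally show ?case .
qed

text \<open>Two transfers bring the digits into 8 in their original order. The entries passed over
  come back from 9 in their original order too, without the one just treated; repeating this
  compares all pairs.\<close>

definition check_entry :: cmd where
  "check_entry =
     transfer [1, 2] 4 7 ;; transfer [1, 2] 7 8 ;; move [4, 5] 4 11 ;;
     WhileTop 4 {1, 2, 4, 5} compare_entry ;;
     transfer [1, 2, 4, 5] 9 4 ;; discard [1, 2] 8 ;; Pop 11"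

definition check :: cmd where
  "check = WhileTop 4 {1, 2, 4, 5} check_entry"

definition temps_empty :: "store \<Rightarrow> bool" where
  "temps_empty s \<longleftrightarrow> s 7 = [] \<and> s 8 = [] \<and> s 9 = [] \<and> s 10 = [] \<and> s 11 = []"

lemma den_check_entry:
  assumes s: "s 4 = bits es @ end_sym c # entries_syms E @ rest" "temps_empty s" "s 5 = flag f"
    and rest: "hd0 rest \<notin> {1, 2, 4, 5}" and N: "length es + 1 + length (entries_syms E) \<le> N"
  shows "den N check_entry s = Some (s(4 := entries_syms E @ rest,
    5 := flag (f \<or> \<not> (\<forall>e \<in> set E. snd e = es \<longrightarrow> fst e = c))))"
proof -
  let ?f = "flag (f \<or> \<not> (\<forall>e \<in> set E. snd e = es \<longrightarrow> fst e = c))"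
  have t: "s 7 = []" "s 8 = []" "s 9 = []" "s 10 = []" "s 11 = []"
    using s(2) by (simp_all add: temps_empty_def)
  define s1 where "s1 = s(4 := end_sym c # entries_syms E @ rest, 7 := rev (bits es))"
  define s2 where "s2 = s1(7 := [], 8 := bits es)"
  define s3 where "s3 = s2(11 := [end_sym c], 4 := entries_syms E @ rest)"
  define s4 where "s4 = s3(4 := rest, 9 := rev (entries_syms E), 5 := ?f)"
  define s5 where "s5 = s4(9 := [], 4 := entries_syms E @ rest)"
  define s6 where "s6 = s5(8 := [])"
  have "den N (transfer [1, 2] 4 7) s = Some (s(4 := end_sym c # entries_syms E @ rest, 7 := rev (bits es) @ s 7))"
    using s N set_bits[of es] by (intro den_transfer) auto
  then have 1: "den N (transfer [1, 2] 4 7) s = Some s1"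
    by (simp add: s1_def t)
  have "den N (transfer [1, 2] 7 8) s1 = Some (s1(7 := [], 8 := rev (rev (bits es)) @ s1 8))"
    using N set_bits[of es] by (intro den_transfer) (auto simp: s1_def)
  then have 2: "den N (transfer [1, 2] 7 8) s1 = Some s2"
    by (simp add: s2_def s1_def t)
  have "den N (move [4, 5] 4 11) s2 = Some (s2(11 := end_sym c # s2 11, 4 := entries_syms E @ rest))"
    by (rule den_move) (auto simp: s2_def s1_def end_sym_def)
  then have 3: "den N (move [4, 5] 4 11) s2 = Some s3"
    by (simp add: s3_def s2_def s1_def t)
  have "loop_den N (den N compare_entry) 4 {1, 2, 4, 5} s3 =
      Some (s3(4 := rest, 9 := rev (entries_syms E) @ s3 9, 5 := ?f))"
    using rest N s t by (intro loop_compare_entries) (auto simp: s3_def s2_def s1_def)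
  then have 4: "den N (WhileTop 4 {1, 2, 4, 5} compare_entry) s3 = Some s4"
    by (simp add: s4_def s3_def s2_def s1_def t)
  have "den N (transfer [1, 2, 4, 5] 9 4) s4 = Some (s4(9 := [], 4 := rev (rev (entries_syms E)) @ s4 4))"
    using N set_entries_syms[of E] by (intro den_transfer) (auto simp: s4_def)
  then have 5: "den N (transfer [1, 2, 4, 5] 9 4) s4 = Some s5"
    by (simp add: s5_def s4_def)
  have "den N (discard [1, 2] 8) s5 = Some (s5(8 := []))"
    using N set_bits[of es] by (intro den_discard[of _ _ _ _ "bits es"])
      (auto simp: s5_def s4_def s3_def s2_def s1_def)
  then have 6: "den N (discard [1, 2] 8) s5 = Some s6"
    by (simp add: s6_def)
  have 7: "den N (Pop 11) s6 = Some (s6(11 := tl (s6 11)))"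
    by simp
  have "den N check_entry s = Some (s6(11 := tl (s6 11)))"
    unfolding check_entry_def by (rule den_Seq 1 2 3 4 5 6 7)+
  also have "s6(11 := tl (s6 11)) = s(4 := entries_syms E @ rest, 5 := ?f)"
    using t unfolding s6_def s5_def s4_def s3_def s2_def s1_def by (intro ext) simp
  finally show ?thesis .
qed

lemma loop_check:
  assumes rest: "hd0 rest \<notin> {1, 2, 4, 5}"
  shows "s 4 = entries_syms E @ rest \<Longrightarrow> temps_empty s \<Longrightarrow> s 5 = flag f \<Longrightarrow>
    length (entries_syms E) \<le> k \<Longrightarrow> k \<le> N \<Longrightarrow>
    loop_den k (den N check_entry) 4 {1, 2, 4, 5} s = Some (s(4 := rest, 5 := flag (f \<or> \<not> consistent E)))"
proof (induction E arbitrary: k s f)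
  case Nil
  then show ?case using rest by (cases k) (auto simp: fun_eq_iff)
next
  case (Cons e E)
  obtain c es where e: "e = (c, es)" by (cases e)
  from Cons.prems e obtain k' where k: "k = Suc k'" by (cases k) auto
  define f1 where "f1 = (f \<or> \<not> (\<forall>e \<in> set E. snd e = es \<longrightarrow> fst e = c))"
  define s1 where "s1 = s(4 := entries_syms E @ rest, 5 := flag f1)"
  have 1: "den N check_entry s = Some s1"
    unfolding s1_def f1_def using Cons.prems e rest by (intro den_check_entry) auto
  have 2: "loop_den k' (den N check_entry) 4 {1, 2, 4, 5} s1 = Some (s1(4 := rest, 5 := flag (f1 \<or> \<not> consistent E)))"
    using Cons.prems k e by (intro Cons.IH) (auto simp: s1_def temps_empty_def)
  have "hd0 (s 4) \<in> {1, 2, 4, 5}"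
    using Cons.prems e by (cases es) (auto simp: end_sym_def)
  then have "loop_den k (den N check_entry) 4 {1, 2, 4, 5} s = Some (s1(4 := rest, 5 := flag (f1 \<or> \<not> consistent E)))"
    using 1 2 unfolding k loop_den.simps by simp
  also have "s1(4 := rest, 5 := flag (f1 \<or> \<not> consistent E)) = s(4 := rest, 5 := flag (f \<or> \<not> consistent (e # E)))"
    using e by (auto simp: s1_def f1_def fun_eq_iff)
  finally show ?case .
qed

lemma den_check:
  assumes "s 4 = entries_syms E @ rest" "hd0 rest \<notin> {1, 2, 4, 5}" "temps_empty s" "s 5 = flag f"
    "length (entries_syms E) \<le> N"
  shows "den N check s = Some (s(4 := rest, 5 := flag (f \<or> \<not> consistent E)))"
  unfolding check_def den.simps(8) using assms by (intro loop_check) auto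

lemma wf_check [simp]: "wf_cmd check"
  by (simp add: check_def check_entry_def compare_entry_def compare_digit_def)

section \<open>A verifier for satisfiability\<close>

text \<open>
  The formula is evaluated in one pass from left to right. The frames are the operators whose
  arguments are not yet complete; a binary operator whose first argument is known becomes the
  identity or a constant. Box formulas have the constant value true. Every literal is assigned a
  guessed truth value, and the guesses for the world under consideration are collected; a diamond
  opens a new segment for its world, which is checked for consistency and dropped at the end of
  the argument.
\<close>

datatype frame = FConj | FDisj | FId | FNeg | FConst bool | FDia | FDone bool

datatype vstate =
  VState (inp: "bool list") (guess: "bool list") (frames: "frame list") (segs: "entry list list")
    (failed: bool)

fun frame_sym :: "frame \<Rightarrow> nat" where
  "frame_sym FConj = 1"
| "frame_sym FDisj = 2"
| "frame_sym FId = 3"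
| "frame_sym FNeg = 4"
| "frame_sym (FConst b) = (if b then 6 else 5)"
| "frame_sym FDia = 7"
| "frame_sym (FDone b) = (if b then 9 else 8)"

fun segs_syms :: "entry list list \<Rightarrow> nat list" where
  "segs_syms [] = []"
| "segs_syms (E # Es) = entries_syms E @ (if Es = [] then [] else 6 # segs_syms Es)"

definition vstore :: "vstate \<Rightarrow> store" where
  "vstore st = (\<lambda>v. if v = 1 then bits (guess st) else if v = 2 then bits (inp st)
     else if v = 3 then map frame_sym (frames st) else if v = 4 then segs_syms (segs st)
     else if v = 5 then flag (failed st) else [])"

text \<open>A connective decided by its first argument still waits for the second one under
  \<open>FConst\<close>: the literals there have to be read, consume guesses and enter the
  segments.\<close>

fun reduce :: "bool \<Rightarrow> frame list \<Rightarrow> entry list list \<Rightarrow> bool \<Rightarrow> frame list \<times> entry list list \<times> bool" where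
  "reduce v [] C f = ([FDone v], C, f)"
| "reduce v (FConj # K) C f = ((if v then FId else FConst False) # K, C, f)"
| "reduce v (FDisj # K) C f = ((if v then FConst True else FId) # K, C, f)"
| "reduce v (FId # K) C f = reduce v K C f"
| "reduce v (FNeg # K) C f = reduce (\<not> v) K C f"
| "reduce v (FConst b # K) C f = reduce b K C f"
| "reduce v (FDia # K) C f = reduce v K (tl C) (f \<or> \<not> consistent (hd C))"
| "reduce v (FDone b # K) C f = (FDone v # FDone b # K, C, f)"

definition complete :: "bool \<Rightarrow> vstate \<Rightarrow> vstate" where
  "complete v st = (case reduce v (frames st) (segs st) (failed st) of
     (K, C, f) \<Rightarrow> VState (inp st) (guess st) K C f)"

definition fail :: "vstate \<Rightarrow> vstate" where
  "fail st = VState (inp st) (guess st) (frames st) (segs st) True"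

definition read :: "(vstate \<Rightarrow> vstate) \<Rightarrow> (vstate \<Rightarrow> vstate) \<Rightarrow> vstate \<Rightarrow> vstate" where
  "read F G st = (case inp st of [] \<Rightarrow> fail st
     | b # x \<Rightarrow> (if b then G else F) (VState x (guess st) (frames st) (segs st) (failed st)))"

definition open_frame :: "frame \<Rightarrow> vstate \<Rightarrow> vstate" where
  "open_frame k st = VState (inp st) (guess st) (k # frames st)
     (if k = FDia then [] # segs st else segs st) (failed st)"

fun read_digits :: "bool list \<Rightarrow> bool list \<times> bool list \<times> bool" where
  "read_digits [] = ([], [], False)"
| "read_digits (False # x) = ([], x, True)"
| "read_digits [True] = ([], [], False)"
| "read_digits (True # d # x) = (case read_digits x of (ds, y, ok) \<Rightarrow> (d # ds, y, ok))"

text \<open>An exhausted certificate supplies \<open>False\<close>. The digits are pushed one by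
  one, hence \<open>rev\<close>. A numeral ending in the digit 0 is rejected because
  \<open>binary\<close> does not produce it.\<close>

definition read_atom :: "bool \<Rightarrow> vstate \<Rightarrow> vstate" where
  "read_atom pv st =
     (let b = (guess st \<noteq> [] \<and> hd (guess st)); r = read_digits (inp st);
          ds = fst r; ok = (snd (snd r) \<and> (ds = [] \<or> last ds))
      in complete (b = pv) (VState (fst (snd r)) (tl (guess st)) (frames st)
           (((b, rev ds) # hd (segs st)) # tl (segs st)) (failed st \<or> \<not> ok)))"

definition guard :: "oper set \<Rightarrow> oper \<Rightarrow> (vstate \<Rightarrow> vstate) \<Rightarrow> vstate \<Rightarrow> vstate" where
  "guard S p F = (if p \<in> S then F else fail)"

text \<open>The decision tree of the four-bit tags of \<open>encode\<close>; tags without a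
  constructor lead to \<open>fail\<close>.\<close>

definition token :: "oper set \<Rightarrow> vstate \<Rightarrow> vstate" where
  "token S =
     read
       (read
         (read (read (read_atom True) (guard S OpAtNeg (read_atom False)))
               (read (guard S OpTrue (complete True)) (guard S OpFalse (complete False))))
         (read (read (guard S OpNeg (open_frame FNeg)) (guard S OpBox (open_frame (FConst True))))
               (read (guard S OpDia (open_frame FDia)) fail)))
       (read
         (read (read (guard S OpConj (open_frame FConj)) (guard S OpDisj (open_frame FDisj))) fail)
         fail)"

text \<open>Input after a complete formula is an error. A bit is consumed nevertheless, so that the
  loop over the input terminates.\<close>

definition vstep :: "oper set \<Rightarrow> vstate \<Rightarrow> vstate" where
  "vstep S st = (case frames st of
     FDone b # K \<Rightarrow> VState (tl (inp st)) (guess st) (frames st) (segs st) True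
   | _ \<Rightarrow> token S st)"

primrec vrun :: "oper set \<Rightarrow> nat \<Rightarrow> vstate \<Rightarrow> vstate" where
  "vrun S 0 st = st"
| "vrun S (Suc k) st = (if inp st = [] then st else vrun S k (vstep S st))"

definition accepting :: "vstate \<Rightarrow> bool" where
  "accepting st \<longleftrightarrow> \<not> failed st \<and> consistent (hd (segs st)) \<and> frames st \<noteq> [] \<and> hd (frames st) = FDone True"

definition verifies :: "oper set \<Rightarrow> bool list \<Rightarrow> bool list \<Rightarrow> bool" where
  "verifies S x u \<longleftrightarrow> accepting (vrun S (length x) (VState x u [] [[]] False))"

subsection \<open>The verifier as a program\<close>

definition complete_prog :: cmd where
  "complete_prog =
     WhileTop 3 {3, 4, 5, 6, 7} (
       IfTop 3 {4} (IfTop 6 {1} (Pop 6 ;; Push 6 2) (Pop 6 ;; Push 6 1)) (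
       IfTop 3 {5} (Pop 6 ;; Push 6 1) (
       IfTop 3 {6} (Pop 6 ;; Push 6 2) (
       IfTop 3 {7} (check ;; Pop 4) Skip))) ;;
       Pop 3) ;;
     IfTop 3 {1} (Pop 3 ;; IfTop 6 {2} (Push 3 3) (Push 3 5)) (
     IfTop 3 {2} (Pop 3 ;; IfTop 6 {2} (Push 3 6) (Push 3 3)) (
     IfTop 6 {2} (Push 3 9) (Push 3 8))) ;;
     Pop 6"

definition read_prog :: "cmd \<Rightarrow> cmd \<Rightarrow> cmd" where
  "read_prog c d = IfTop 2 {1} (Pop 2 ;; c) (IfTop 2 {2} (Pop 2 ;; d) (raise 5))"

definition open_prog :: "frame \<Rightarrow> cmd" where
  "open_prog k = Push 3 (frame_sym k) ;; (if k = FDia then Push 4 6 else Skip)"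

definition value_prog :: "bool \<Rightarrow> cmd" where
  "value_prog v = Push 6 (if v then 2 else 1) ;; complete_prog"

definition atom_prog :: "bool \<Rightarrow> cmd" where
  "atom_prog pv =
     IfTop 1 {2} (Push 4 5 ;; Push 6 (if pv then 2 else 1)) (Push 4 4 ;; Push 6 (if pv then 1 else 2)) ;;
     Pop 1 ;;
     WhileTop 2 {2} (Pop 2 ;; IfTop 2 {1, 2} (move [1, 2] 2 4) (raise 5)) ;;
     IfTop 2 {1} (Pop 2) (raise 5) ;;
     IfTop 4 {1} (raise 5) Skip ;;
     complete_prog"

definition guard_prog :: "oper set \<Rightarrow> oper \<Rightarrow> cmd \<Rightarrow> cmd" where
  "guard_prog S p c = (if p \<in> S then c else raise 5)"

definition token_prog :: "oper set \<Rightarrow> cmd" where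
  "token_prog S =
     read_prog
       (read_prog
         (read_prog (read_prog (atom_prog True) (guard_prog S OpAtNeg (atom_prog False)))
               (read_prog (guard_prog S OpTrue (value_prog True)) (guard_prog S OpFalse (value_prog False))))
         (read_prog (read_prog (guard_prog S OpNeg (open_prog FNeg)) (guard_prog S OpBox (open_prog (FConst True))))
               (read_prog (guard_prog S OpDia (open_prog FDia)) (raise 5))))
       (read_prog
         (read_prog (read_prog (guard_prog S OpConj (open_prog FConj)) (guard_prog S OpDisj (open_prog FDisj))) (raise 5))
         (raise 5))"

definition verifier_prog :: "oper set \<Rightarrow> cmd" where
  "verifier_prog S =
     transfer [1, 2] 1 7 ;; Pop 1 ;; transfer [1, 2] 7 2 ;;
     WhileTop 2 {1, 2} (IfTop 3 {8, 9} (raise 5 ;; Pop 2) (token_prog S)) ;;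
     check ;; IfTop 3 {9} Skip (raise 5)"

lemma wf_verifier_prog: "wf_cmd (verifier_prog S)"
  by (simp add: verifier_prog_def token_prog_def read_prog_def guard_prog_def atom_prog_def
      value_prog_def open_prog_def complete_prog_def)

section \<open>The program simulates the verifier\<close>

definition dias :: "frame list \<Rightarrow> nat" where
  "dias K = length (filter (\<lambda>k. k = FDia) K)"

text \<open>The slack \<open>k\<close> counts the bits of the current token that have been read.\<close>

definition fits :: "nat \<Rightarrow> nat \<Rightarrow> vstate \<Rightarrow> bool" where
  "fits N k st \<longleftrightarrow> length (segs st) = Suc (dias (frames st)) \<and>
     length (frames st) + length (inp st) + k \<le> N \<and> length (segs_syms (segs st)) + length (inp st) + k < N"

lemma segs_syms_tl: "length (segs_syms (tl C)) \<le> length (segs_syms C)"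
  by (cases C) auto

lemma vstore_simps [simp]:
  "vstore st 1 = bits (guess st)" "vstore st (Suc 0) = bits (guess st)" "vstore st 2 = bits (inp st)"
  "vstore st 3 = map frame_sym (frames st)" "vstore st 4 = segs_syms (segs st)"
  "vstore st 5 = flag (failed st)" "vstore st 6 = []" "vstore st 7 = []" "vstore st 8 = []"
  "vstore st 9 = []" "vstore st 10 = []" "vstore st 11 = []"
  by (simp_all add: vstore_def)

lemma vstore_updates:
  "(vstore st)(1 := bits u) = vstore (VState (inp st) u (frames st) (segs st) (failed st))"
  "(vstore st)(Suc 0 := bits u) = vstore (VState (inp st) u (frames st) (segs st) (failed st))"
  "(vstore st)(2 := bits x) = vstore (VState x (guess st) (frames st) (segs st) (failed st))"
  "(vstore st)(3 := map frame_sym K) = vstore (VState (inp st) (guess st) K (segs st) (failed st))"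
  "(vstore st)(4 := segs_syms C) = vstore (VState (inp st) (guess st) (frames st) C (failed st))"
  "(vstore st)(5 := flag f) = vstore (VState (inp st) (guess st) (frames st) (segs st) f)"
  by (simp_all add: vstore_def fun_eq_iff)

definition value_sym :: "bool \<Rightarrow> nat" where
  "value_sym v = (if v then 2 else 1)"

definition vvstore :: "bool \<Rightarrow> vstate \<Rightarrow> store" where
  "vvstore v st = (vstore st)(6 := [value_sym v])"

lemma vvstore_simps [simp]:
  "vvstore v st 1 = bits (guess st)" "vvstore v st (Suc 0) = bits (guess st)" "vvstore v st 2 = bits (inp st)"
  "vvstore v st 3 = map frame_sym (frames st)" "vvstore v st 4 = segs_syms (segs st)"
  "vvstore v st 5 = flag (failed st)" "vvstore v st 6 = [value_sym v]" "vvstore v st 7 = []" "vvstore v st 8 = []"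
  "vvstore v st 9 = []" "vvstore v st 10 = []" "vvstore v st 11 = []"
  by (simp_all add: vvstore_def)

lemma vvstore_updates:
  "(vvstore v st)(1 := bits u) = vvstore v (VState (inp st) u (frames st) (segs st) (failed st))"
  "(vvstore v st)(Suc 0 := bits u) = vvstore v (VState (inp st) u (frames st) (segs st) (failed st))"
  "(vvstore v st)(2 := bits x) = vvstore v (VState x (guess st) (frames st) (segs st) (failed st))"
  "(vvstore v st)(3 := map frame_sym K) = vvstore v (VState (inp st) (guess st) K (segs st) (failed st))"
  "(vvstore v st)(4 := segs_syms C) = vvstore v (VState (inp st) (guess st) (frames st) C (failed st))"
  "(vvstore v st)(5 := flag f) = vvstore v (VState (inp st) (guess st) (frames st) (segs st) f)"
  "(vvstore v st)(6 := [value_sym b]) = vvstore b st"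
  by (simp_all add: vstore_def vvstore_def fun_eq_iff)

definition complete_body :: cmd where
  "complete_body =
       IfTop 3 {4} (IfTop 6 {1} (Pop 6 ;; Push 6 2) (Pop 6 ;; Push 6 1)) (
       IfTop 3 {5} (Pop 6 ;; Push 6 1) (
       IfTop 3 {6} (Pop 6 ;; Push 6 2) (
       IfTop 3 {7} (check ;; Pop 4) Skip))) ;;
       Pop 3"

definition unary_frame :: "frame \<Rightarrow> bool" where
  "unary_frame k \<longleftrightarrow> frame_sym k \<in> {3, 4, 5, 6, 7}"

lemma den_complete_body:
  assumes K: "frames st = k # K" "unary_frame k" and len: "length (segs st) = Suc (dias (frames st))"
    and N: "length (segs_syms (segs st)) \<le> N"
  shows "den N complete_body (vvstore v st) = Some (vvstore
    (case k of FNeg \<Rightarrow> \<not> v | FConst b \<Rightarrow> b | _ \<Rightarrow> v)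
    (VState (inp st) (guess st) K (if k = FDia then tl (segs st) else segs st)
      (failed st \<or> (k = FDia \<and> \<not> consistent (hd (segs st))))))"
proof -
  let ?v = "case k of FNeg \<Rightarrow> \<not> v | FConst b \<Rightarrow> b | _ \<Rightarrow> v"
  define st1 where "st1 = VState (inp st) (guess st) (k # K) (if k = FDia then tl (segs st) else segs st)
      (failed st \<or> (k = FDia \<and> \<not> consistent (hd (segs st))))"
  have 1: "den N (IfTop 3 {4} (IfTop 6 {1} (Pop 6 ;; Push 6 2) (Pop 6 ;; Push 6 1)) (
       IfTop 3 {5} (Pop 6 ;; Push 6 1) (
       IfTop 3 {6} (Pop 6 ;; Push 6 2) (
       IfTop 3 {7} (check ;; Pop 4) Skip)))) (vvstore v st) = Some (vvstore ?v st1)"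
  proof (cases "k = FDia")
    case True
    \<comment> \<open>An open diamond guarantees a second segment, so the checked one is followed by
      the separator 6, which \<open>Pop 4\<close> then removes.\<close>
    then obtain E E' C where C: "segs st = E # E' # C"
      using len K by (cases "segs st"; cases "tl (segs st)") (auto simp: dias_def)
    have "den N check (vvstore v st) = Some ((vvstore v st)(4 := 6 # segs_syms (E' # C),
        5 := flag (failed st \<or> \<not> consistent E)))"
      using C N by (intro den_check) (auto simp: temps_empty_def)
    moreover have "den N (Pop 4) ((vvstore v st)(4 := 6 # segs_syms (E' # C),
        5 := flag (failed st \<or> \<not> consistent E))) = Some (vvstore v st1)"
      using True C K by (simp add: st1_def vvstore_def vstore_def fun_eq_iff)
    ultimately have "den N (check ;; Pop 4) (vvstore v st) = Some (vvstore v st1)"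
      by (rule den_Seq)
    with True K show ?thesis by simp
  next
    case False
    then have st1: "st1 = st"
      using K by (cases st) (simp add: st1_def)
    from K(2) False show ?thesis
      unfolding st1 using K(1)
      by (cases k; cases v) (auto simp: unary_frame_def vvstore_def value_sym_def fun_eq_iff split: if_splits)
  qed
  have "den N (Pop 3) (vvstore ?v st1) = Some ((vvstore ?v st1)(3 := map frame_sym K))"
    by (simp add: st1_def)
  with 1 have "den N complete_body (vvstore v st) = Some ((vvstore ?v st1)(3 := map frame_sym K))"
    unfolding complete_body_def by (rule den_Seq)
  then show ?thesis
    unfolding vvstore_updates by (simp add: st1_def)
qed

text \<open>Each iteration removes one frame that \<open>reduce\<close> passes through recursively,
  so the number of frames is enough fuel, and the value of \<open>complete\<close> is the loop
  invariant.\<close>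

lemma den_complete_prog:
  assumes "length (segs st) = Suc (dias (frames st))" "length (frames st) \<le> N"
    "length (segs_syms (segs st)) \<le> N"
  shows "den N complete_prog (vvstore v st) = Some (vstore (complete v st))"
proof -
  have loop: "\<exists>v' st'. loop_den k (den N complete_body) 3 {3, 4, 5, 6, 7} (vvstore v st) = Some (vvstore v' st') \<and>
      (frames st' = [] \<or> \<not> unary_frame (hd (frames st'))) \<and> complete v' st' = complete v st"
    if "length (segs st) = Suc (dias (frames st))" "length (frames st) \<le> k"
      "length (segs_syms (segs st)) \<le> N" for k v st
    using that
  proof (induction k arbitrary: v st)
    case 0
    then show ?case by (intro exI[of _ v] exI[of _ st]) simp
  next
    case (Suc k)
    show ?case
    proof (cases "frames st \<noteq> [] \<and> unary_frame (hd (frames st))")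
      case False
      then have "hd0 (vvstore v st 3) \<notin> {3, 4, 5, 6, 7}"
        by (cases "frames st") (auto simp: unary_frame_def)
      then have "loop_den (Suc k) (den N complete_body) 3 {3, 4, 5, 6, 7} (vvstore v st) = Some (vvstore v st)"
        by simp
      with False show ?thesis by blast
    next
      case True
      then obtain f K where K: "frames st = f # K" "unary_frame f"
        by (cases "frames st") auto
      let ?v = "case f of FNeg \<Rightarrow> \<not> v | FConst b \<Rightarrow> b | _ \<Rightarrow> v"
      define st1 where "st1 = VState (inp st) (guess st) K (if f = FDia then tl (segs st) else segs st)
        (failed st \<or> (f = FDia \<and> \<not> consistent (hd (segs st))))"
      have 1: "den N complete_body (vvstore v st) = Some (vvstore ?v st1)"
        unfolding st1_def using K Suc.prems by (intro den_complete_body)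
      have len: "length (segs st1) = Suc (dias (frames st1))"
        using Suc.prems K by (auto simp: st1_def dias_def)
      have sz: "length (segs_syms (segs st1)) \<le> N" "length (frames st1) \<le> k"
        using Suc.prems K segs_syms_tl[of "segs st"] by (auto simp: st1_def)
      obtain v' st' where *: "loop_den k (den N complete_body) 3 {3, 4, 5, 6, 7} (vvstore ?v st1) = Some (vvstore v' st')"
        "frames st' = [] \<or> \<not> unary_frame (hd (frames st'))" "complete v' st' = complete ?v st1"
        using Suc.IH[OF len sz(2) sz(1), of ?v] by blast
      have "hd0 (vvstore v st 3) \<in> {3, 4, 5, 6, 7}"
        using K by (simp add: unary_frame_def)
      then have "loop_den (Suc k) (den N complete_body) 3 {3, 4, 5, 6, 7} (vvstore v st) = Some (vvstore v' st')"
        using 1 *(1) by simp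
      moreover have "complete ?v st1 = complete v st"
        using K by (cases f) (auto simp: complete_def st1_def unary_frame_def split: if_splits)
      ultimately show ?thesis using * by metis
    qed
  qed
  obtain v' st' where 1: "den N (WhileTop 3 {3, 4, 5, 6, 7} complete_body) (vvstore v st) = Some (vvstore v' st')"
    and st': "frames st' = [] \<or> \<not> unary_frame (hd (frames st'))" and c: "complete v' st' = complete v st"
    using loop[of st N v] assms by auto
  have 2: "den N (IfTop 3 {1} (Pop 3 ;; IfTop 6 {2} (Push 3 3) (Push 3 5)) (
     IfTop 3 {2} (Pop 3 ;; IfTop 6 {2} (Push 3 6) (Push 3 3)) (
     IfTop 6 {2} (Push 3 9) (Push 3 8)))) (vvstore v' st') = Some (vvstore v' (complete v' st'))"
  proof (cases "frames st'")
    case Nil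
    then show ?thesis
      by (auto simp: complete_def value_sym_def vvstore_def vstore_def fun_eq_iff)
  next
    case (Cons f K)
    then show ?thesis
      using st' by (cases f) (auto simp: unary_frame_def complete_def value_sym_def vvstore_def vstore_def fun_eq_iff
          split: if_splits)
  qed
  have 3: "den N (Pop 6) (vvstore v' (complete v' st')) = Some (vstore (complete v' st'))"
    by (simp add: vvstore_def vstore_def fun_eq_iff)
  show ?thesis
    unfolding complete_prog_def complete_body_def[symmetric] c[symmetric]
    by (rule den_Seq 1 2 3)+
qed

definition simulates :: "nat \<Rightarrow> nat \<Rightarrow> cmd \<Rightarrow> (vstate \<Rightarrow> vstate) \<Rightarrow> bool" where
  "simulates N k c F \<longleftrightarrow> (\<forall>st. fits N k st \<longrightarrow> den N c (vstore st) = Some (vstore (F st)))"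

lemma simulates_fail: "simulates N k (raise 5) fail"
  unfolding simulates_def
proof (intro allI impI)
  fix st
  have "den N (raise 5) (vstore st) = Some ((vstore st)(5 := flag True))"
    by (rule den_raise[of _ _ "failed st"]) simp
  then show "den N (raise 5) (vstore st) = Some (vstore (fail st))"
    unfolding vstore_updates by (simp add: fail_def)
qed

lemma simulates_read:
  assumes "simulates N (Suc k) c F" "simulates N (Suc k) d G"
  shows "simulates N k (read_prog c d) (read F G)"
  unfolding simulates_def
proof (intro allI impI)
  fix st
  assume st: "fits N k st"
  show "den N (read_prog c d) (vstore st) = Some (vstore (read F G st))"
  proof (cases "inp st")
    case Nil
    then show ?thesis
      using simulates_fail[of N k] st by (simp add: simulates_def read_prog_def read_def)
  next
    case (Cons b x)
    define st1 where "st1 = VState x (guess st) (frames st) (segs st) (failed st)"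
    have "fits N (Suc k) st1"
      using st Cons by (simp add: fits_def st1_def)
    then have 2: "den N c (vstore st1) = Some (vstore (F st1))" "den N d (vstore st1) = Some (vstore (G st1))"
      using assms by (auto simp: simulates_def)
    have "den N (Pop 2) (vstore st) = Some ((vstore st)(2 := bits x))"
      using Cons by simp
    then have 1: "den N (Pop 2) (vstore st) = Some (vstore st1)"
      unfolding vstore_updates by (simp add: st1_def)
    show ?thesis
      using den_Seq[OF 1 2(1)] den_Seq[OF 1 2(2)] Cons
      by (simp add: read_prog_def read_def st1_def del: den.simps(6))
  qed
qed

lemma simulates_guard: "simulates N k c F \<Longrightarrow> simulates N k (guard_prog S p c) (guard S p F)"
  by (simp add: guard_prog_def guard_def simulates_fail)

lemma simulates_complete: "simulates N k (value_prog v) (complete v)"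
  unfolding simulates_def
proof (intro allI impI)
  fix st
  assume st: "fits N k st"
  have "den N (Push 6 (if v then 2 else 1)) (vstore st) = Some (vvstore v st)"
    by (simp add: vvstore_def value_sym_def fun_eq_iff)
  moreover have "den N complete_prog (vvstore v st) = Some (vstore (complete v st))"
    using st by (intro den_complete_prog) (auto simp: fits_def)
  ultimately show "den N (value_prog v) (vstore st) = Some (vstore (complete v st))"
    unfolding value_prog_def by (rule den_Seq)
qed

lemma simulates_open: "simulates N k (open_prog f) (open_frame f)"
  unfolding simulates_def
proof (intro allI impI)
  fix st
  assume "fits N k st"
  then have "segs st \<noteq> []" by (auto simp: fits_def)
  then show "den N (open_prog f) (vstore st) = Some (vstore (open_frame f st))"
    by (auto simp: open_prog_def open_frame_def vstore_def fun_eq_iff)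
qed

lemma read_digits_length: "read_digits x = (ds, y, ok) \<Longrightarrow> length y + 2 * length ds \<le> length x"
  by (induction x arbitrary: ds rule: read_digits.induct) (auto split: prod.splits)

text \<open>On a truncated numeral the flag depends on whether the input breaks off before or after
  the marker of a digit, and is left open here: the empty input makes the subsequent test for the
  terminator raise it anyway.\<close>

lemma loop_read_digits:
  assumes "length (inp st) \<le> k" "segs st = ((b, es) # E) # C" "read_digits (inp st) = (ds, y, ok)"
  shows "\<exists>z f. loop_den k (den N (Pop 2 ;; IfTop 2 {1, 2} (move [1, 2] 2 4) (raise 5))) 2 {2} (vvstore v st) =
      Some (vvstore v (VState z (guess st) (frames st) (((b, rev ds @ es) # E) # C) f)) \<and>
      (if ok then z = False # y \<and> f = failed st else z = [] \<and> y = [])"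
  using assms
proof (induction "inp st" arbitrary: st k es ds rule: read_digits.induct)
  case 1
  then show ?case
    by (intro exI[of _ "[]"] exI[of _ "failed st"]) (cases k; cases st; auto)
next
  case (2 x)
  then show ?case
    by (intro exI[of _ "False # x"] exI[of _ "failed st"]) (cases k; cases st; auto)
next
  case 3
  then obtain k' where k: "k = Suc k'" by (cases k) auto
  let ?c = "Pop 2 ;; IfTop 2 {1, 2} (move [1, 2] 2 4) (raise 5)"
  have x: "inp st = [True]" "ds = []" "y = []" "\<not> ok"
    using 3 by (metis read_digits.simps(3) prod.inject)+
  define st1 where "st1 = VState [] (guess st) (frames st) (segs st) (failed st)"
  have "den N (Pop 2) (vvstore v st) = Some ((vvstore v st)(2 := bits []))"
    using x by simp
  then have 1: "den N (Pop 2) (vvstore v st) = Some (vvstore v st1)"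
    unfolding vvstore_updates st1_def .
  have "den N (raise 5) (vvstore v st1) = Some ((vvstore v st1)(5 := flag True))"
    by (rule den_raise[of _ _ "failed st1"]) simp
  then have "den N (IfTop 2 {1, 2} (move [1, 2] 2 4) (raise 5)) (vvstore v st1) = Some ((vvstore v st1)(5 := flag True))"
    by (simp add: st1_def)
  with 1 have "den N ?c (vvstore v st) = Some ((vvstore v st1)(5 := flag True))"
    by (rule den_Seq)
  then have "den N ?c (vvstore v st) = Some (vvstore v (VState [] (guess st) (frames st) (segs st) True))"
    unfolding vvstore_updates by (simp add: st1_def)
  then have "loop_den k (den N ?c) 2 {2} (vvstore v st) = Some (vvstore v (VState [] (guess st) (frames st) (segs st) True))"
    using x unfolding k loop_den.simps by (cases k') simp_all
  with x 3(3) show ?case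
    by (intro exI[of _ "[]"] exI[of _ True]) (simp del: den.simps)
next
  case (4 d x)
  then obtain k' where k: "k = Suc k'" by (cases k) auto
  let ?c = "Pop 2 ;; IfTop 2 {1, 2} (move [1, 2] 2 4) (raise 5)"
  obtain ds' where ds': "read_digits x = (ds', y, ok)" "ds = d # ds'"
    using 4(3,5) by (metis (no_types, lifting) "4.hyps"(2) prod.inject read_digits.simps(4) case_prod_conv surj_pair)
  define st0 where "st0 = VState (d # x) (guess st) (frames st) (segs st) (failed st)"
  define st1 where "st1 = VState x (guess st) (frames st) (((b, d # es) # E) # C) (failed st)"
  have x: "inp st = True # d # x" using 4 by simp
  have "den N (Pop 2) (vvstore v st) = Some ((vvstore v st)(2 := bits (d # x)))"
    using x by simp
  then have 1: "den N (Pop 2) (vvstore v st) = Some (vvstore v st0)"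
    unfolding vvstore_updates st0_def .
  have "den N (move [1, 2] 2 4) (vvstore v st0) =
      Some ((vvstore v st0)(4 := (if d then 2 else 1) # vvstore v st0 4, 2 := bits x))"
    by (rule den_move) (simp_all add: st0_def)
  moreover have "(vvstore v st0)(4 := (if d then 2 else 1) # vvstore v st0 4, 2 := bits x) = vvstore v st1"
    using 4(4) by (simp add: st0_def st1_def vvstore_def vstore_def fun_eq_iff)
  ultimately have "den N (IfTop 2 {1, 2} (move [1, 2] 2 4) (raise 5)) (vvstore v st0) = Some (vvstore v st1)"
    by (simp add: st0_def)
  with 1 have 2: "den N ?c (vvstore v st) = Some (vvstore v st1)"
    by (rule den_Seq)
  have "\<exists>z f. loop_den k' (den N ?c) 2 {2} (vvstore v st1) =
      Some (vvstore v (VState z (guess st1) (frames st1) (((b, rev ds' @ d # es) # E) # C) f)) \<and>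
      (if ok then z = False # y \<and> f = failed st1 else z = [] \<and> y = [])"
  proof (rule "4.hyps"(1))
    show "length (inp st1) \<le> k'"
      using "4.prems"(1) x k by (simp add: st1_def)
  qed (use ds' in \<open>simp_all add: st1_def\<close>)
  then obtain z f where zf: "loop_den k' (den N ?c) 2 {2} (vvstore v st1) =
      Some (vvstore v (VState z (guess st) (frames st) (((b, rev ds @ es) # E) # C) f))"
    "if ok then z = False # y \<and> f = failed st else z = [] \<and> y = []"
    using ds' by (auto simp: st1_def)
  have "loop_den k (den N ?c) 2 {2} (vvstore v st) = loop_den k' (den N ?c) 2 {2} (vvstore v st1)"
    using x 2 unfolding k loop_den.simps by simp
  with zf show ?case by metis
qed

lemma simulates_atom: "simulates N k (atom_prog pv) (read_atom pv)"
  unfolding simulates_def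
proof (intro allI impI)
  fix st
  assume st: "fits N k st"
  then obtain E C where C: "segs st = E # C"
    by (cases "segs st") (auto simp: fits_def)
  obtain ds y ok where r: "read_digits (inp st) = (ds, y, ok)"
    by (cases "read_digits (inp st)") auto
  note len = read_digits_length[OF r]
  define b where "b = (guess st \<noteq> [] \<and> hd (guess st))"
  let ?v = "b = pv"
  define st1 where "st1 = VState (inp st) (guess st) (frames st) (((b, []) # E) # C) (failed st)"
  define st2 where "st2 = VState (inp st) (tl (guess st)) (frames st) (((b, []) # E) # C) (failed st)"
  define st4 where "st4 = VState y (tl (guess st)) (frames st) (((b, rev ds) # E) # C) (failed st \<or> \<not> ok)"
  define st5 where "st5 = VState y (tl (guess st)) (frames st) (((b, rev ds) # E) # C)
    (failed st \<or> \<not> (ok \<and> (ds = [] \<or> last ds)))"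
  have 1: "den N (IfTop 1 {2} (Push 4 5 ;; Push 6 (if pv then 2 else 1)) (Push 4 4 ;; Push 6 (if pv then 1 else 2)))
      (vstore st) = Some (vvstore ?v st1)"
    using C by (cases "guess st") (auto simp: st1_def b_def vvstore_def vstore_def value_sym_def end_sym_def fun_eq_iff)
  have "den N (Pop 1) (vvstore ?v st1) = Some ((vvstore ?v st1)(1 := bits (tl (guess st))))"
    by (cases "guess st") (simp_all add: st1_def)
  then have 2: "den N (Pop 1) (vvstore ?v st1) = Some (vvstore ?v st2)"
    unfolding vvstore_updates by (simp add: st1_def st2_def)
  obtain z f where 3: "den N (WhileTop 2 {2} (Pop 2 ;; IfTop 2 {1, 2} (move [1, 2] 2 4) (raise 5))) (vvstore ?v st2) =
      Some (vvstore ?v (VState z (guess st2) (frames st2) (((b, rev ds @ []) # E) # C) f))"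
    and z: "if ok then z = False # y \<and> f = failed st2 else z = [] \<and> y = []"
    using loop_read_digits[of st2 N b "[]" E C ds y ok N ?v] st r
    unfolding den.simps(8) by (auto simp: st2_def fits_def)
  define st3 where "st3 = VState z (guess st2) (frames st2) (((b, rev ds) # E) # C) f"
  have 3: "den N (WhileTop 2 {2} (Pop 2 ;; IfTop 2 {1, 2} (move [1, 2] 2 4) (raise 5))) (vvstore ?v st2) =
      Some (vvstore ?v st3)"
    using 3 by (simp add: st3_def)
  have 4: "den N (IfTop 2 {1} (Pop 2) (raise 5)) (vvstore ?v st3) = Some (vvstore ?v st4)"
  proof (cases ok)
    case True
    have "den N (Pop 2) (vvstore ?v st3) = Some ((vvstore ?v st3)(2 := bits y))"
      using True z by (simp add: st3_def)
    then have "den N (Pop 2) (vvstore ?v st3) = Some (vvstore ?v st4)"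
      unfolding vvstore_updates using True z by (simp add: st3_def st4_def st2_def)
    with True z show ?thesis by (simp add: st3_def)
  next
    case False
    have "den N (raise 5) (vvstore ?v st3) = Some ((vvstore ?v st3)(5 := flag True))"
      by (rule den_raise[of _ _ "failed st3"]) simp
    then have "den N (raise 5) (vvstore ?v st3) = Some (vvstore ?v st4)"
      unfolding vvstore_updates using False z by (simp add: st3_def st4_def st2_def)
    with False z show ?thesis by (simp add: st3_def)
  qed
  have top: "hd0 (vvstore ?v st4 4) = 1 \<longleftrightarrow> \<not> (ds = [] \<or> last ds)"
    by (cases ds rule: rev_cases) (auto simp: st4_def)
  have 5: "den N (IfTop 4 {1} (raise 5) Skip) (vvstore ?v st4) = Some (vvstore ?v st5)"
  proof (cases "ds = [] \<or> last ds")
    case True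
    with top show ?thesis by (simp add: st4_def st5_def)
  next
    case False
    have "den N (raise 5) (vvstore ?v st4) = Some ((vvstore ?v st4)(5 := flag True))"
      by (rule den_raise[of _ _ "failed st4"]) simp
    then have "den N (raise 5) (vvstore ?v st4) = Some (vvstore ?v st5)"
      unfolding vvstore_updates using False by (simp add: st4_def st5_def)
    with False top show ?thesis by simp
  qed
  \<comment> \<open>The segment has grown by the digits and one end symbol. The digits are paid for
    by the bits read, and the end symbol by the strict inequality in \<open>fits\<close>.\<close>
  have 6: "den N complete_prog (vvstore ?v st5) = Some (vstore (complete ?v st5))"
    using st C len by (intro den_complete_prog) (auto simp: st5_def fits_def)
  have "den N (atom_prog pv) (vstore st) = Some (vstore (complete ?v st5))"
    unfolding atom_prog_def by (rule den_Seq 1 2 3 4 5 6)+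
  also have "complete ?v st5 = read_atom pv st"
    by (simp add: read_atom_def Let_def r C st5_def b_def)
  finally show "den N (atom_prog pv) (vstore st) = Some (vstore (read_atom pv st))" .
qed

lemma simulates_token: "simulates N 0 (token_prog S) (token S)"
  unfolding token_prog_def token_def
  by (intro simulates_read simulates_guard simulates_atom simulates_complete simulates_open simulates_fail)

section \<open>Bounds on the stacks and termination\<close>

lemma reduce_sizes:
  "reduce v K C f = (K', C', f') \<Longrightarrow> length C = Suc (dias K) \<Longrightarrow>
     length C' = Suc (dias K') \<and> length K' \<le> Suc (length K) \<and> length (segs_syms C') \<le> length (segs_syms C)"
proof (induction v K C f rule: reduce.induct)
  case (7 v K C f)
  then have "length (tl C) = Suc (dias K)" by (simp add: dias_def)
  with 7 segs_syms_tl[of C] show ?case by fastforce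
qed (auto simp: dias_def split: if_splits)

text \<open>The slack is spent here: a frame or symbol pushed by a token is paid for by a bit of
  that token, so that the same \<open>N\<close> bounds the stacks throughout the run.\<close>

definition preserves :: "nat \<Rightarrow> nat \<Rightarrow> (vstate \<Rightarrow> vstate) \<Rightarrow> bool" where
  "preserves N k F \<longleftrightarrow> (\<forall>st. fits N k st \<longrightarrow> fits N 0 (F st) \<and> length (inp (F st)) \<le> length (inp st))"

lemma preserves_fail: "preserves N k fail"
  by (auto simp: preserves_def fail_def fits_def)

lemma preserves_complete: "preserves N (Suc k) (complete v)"
  unfolding preserves_def
proof (intro allI impI)
  fix st
  assume st: "fits N (Suc k) st"
  obtain K C f where r: "reduce v (frames st) (segs st) (failed st) = (K, C, f)"
    by (cases "reduce v (frames st) (segs st) (failed st)") auto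
  from reduce_sizes[OF r] st show "fits N 0 (complete v st) \<and> length (inp (complete v st)) \<le> length (inp st)"
    by (auto simp: complete_def r fits_def)
qed

lemma preserves_open: "preserves N (Suc k) (open_frame f)"
  by (auto simp: preserves_def open_frame_def fits_def dias_def)

text \<open>A digit takes two bits of input but only one symbol of the segment. Of the two bits of
  slack, one pays for the end symbol and the other for the frame that \<open>complete\<close> may
  push.\<close>

lemma preserves_atom: "preserves N (Suc (Suc k)) (read_atom pv)"
  unfolding preserves_def
proof (intro allI impI)
  fix st
  assume st: "fits N (Suc (Suc k)) st"
  then obtain E C where C: "segs st = E # C"
    by (cases "segs st") (auto simp: fits_def)
  obtain ds y ok where r: "read_digits (inp st) = (ds, y, ok)"
    by (cases "read_digits (inp st)") auto
  note len = read_digits_length[OF r]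
  define b where "b = (guess st \<noteq> [] \<and> hd (guess st))"
  define st1 where "st1 = VState y (tl (guess st)) (frames st) (((b, rev ds) # E) # C)
    (failed st \<or> \<not> (ok \<and> (ds = [] \<or> last ds)))"
  have a: "read_atom pv st = complete (b = pv) st1"
    by (simp add: read_atom_def Let_def r C st1_def b_def)
  have "fits N (Suc k) st1"
    using st C len by (auto simp: fits_def st1_def)
  then have "fits N 0 (complete (b = pv) st1) \<and> length (inp (complete (b = pv) st1)) \<le> length (inp st1)"
    using preserves_complete by (simp add: preserves_def)
  with len show "fits N 0 (read_atom pv st) \<and> length (inp (read_atom pv st)) \<le> length (inp st)"
    unfolding a by (simp add: st1_def)
qed

lemma preserves_guard: "preserves N k F \<Longrightarrow> preserves N k (guard S p F)"
  by (simp add: guard_def preserves_fail)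

lemma read_Cons:
  assumes "preserves N (Suc k) F" "preserves N (Suc k) G" "fits N k st" "inp st \<noteq> []"
  shows "fits N 0 (read F G st) \<and> length (inp (read F G st)) < length (inp st)"
proof -
  obtain b x where x: "inp st = b # x" using assms(4) by (cases "inp st") auto
  define st1 where "st1 = VState x (guess st) (frames st) (segs st) (failed st)"
  have "fits N (Suc k) st1"
    using assms(3) x by (simp add: fits_def st1_def)
  then have "fits N 0 (F st1) \<and> length (inp (F st1)) \<le> length x" "fits N 0 (G st1) \<and> length (inp (G st1)) \<le> length x"
    using assms(1,2) by (auto simp: preserves_def st1_def)
  then show ?thesis
    using x by (auto simp: read_def st1_def)
qed

lemma preserves_read:
  assumes "preserves N (Suc k) F" "preserves N (Suc k) G"
  shows "preserves N k (read F G)"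
  unfolding preserves_def
proof (intro allI impI)
  fix st
  assume st: "fits N k st"
  show "fits N 0 (read F G st) \<and> length (inp (read F G st)) \<le> length (inp st)"
  proof (cases "inp st = []")
    case True
    with st show ?thesis by (auto simp: read_def fail_def fits_def)
  next
    case False
    with read_Cons[OF assms st] show ?thesis by simp
  qed
qed

lemma token_Cons:
  assumes "fits N 0 st" "inp st \<noteq> []"
  shows "fits N 0 (token S st) \<and> length (inp (token S st)) < length (inp st)"
  unfolding token_def
  by (rule read_Cons[OF _ _ assms];
      intro preserves_read preserves_guard preserves_atom preserves_complete preserves_open preserves_fail)

lemma vstep_Cons:
  assumes "fits N 0 st" "inp st \<noteq> []"
  shows "fits N 0 (vstep S st)" "length (inp (vstep S st)) < length (inp st)"
proof -
  have "fits N 0 (VState (tl (inp st)) (guess st) (frames st) (segs st) True)"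
    using assms(1) by (auto simp: fits_def)
  then show "fits N 0 (vstep S st)" "length (inp (vstep S st)) < length (inp st)"
    using token_Cons[OF assms, of S] assms(2)
    by (auto simp: vstep_def split: list.split frame.split)
qed

lemma den_vstep:
  assumes "fits N 0 st" "inp st \<noteq> []"
  shows "den N (IfTop 3 {8, 9} (raise 5 ;; Pop 2) (token_prog S)) (vstore st) = Some (vstore (vstep S st))"
proof -
  have tok: "den N (token_prog S) (vstore st) = Some (vstore (token S st))"
    using simulates_token[of N S] assms(1) by (simp add: simulates_def)
  show ?thesis
  proof (cases "\<exists>b K. frames st = FDone b # K")
    case True
    then obtain b K where K: "frames st = FDone b # K" by blast
    have "den N (raise 5) (vstore st) = Some (vstore (fail st))"
      using simulates_fail[of N 0] assms(1) by (simp add: simulates_def)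
    moreover have "den N (Pop 2) (vstore (fail st)) = Some ((vstore (fail st))(2 := bits (tl (inp st))))"
      using assms(2) by (cases "inp st") (simp_all add: fail_def)
    ultimately have "den N (raise 5 ;; Pop 2) (vstore st) = Some ((vstore (fail st))(2 := bits (tl (inp st))))"
      by (rule den_Seq)
    then show ?thesis
      unfolding vstore_updates using K by (simp add: vstep_def fail_def)
  next
    case False
    then have "vstep S st = token S st" "hd0 (map frame_sym (frames st)) \<notin> {8, 9}"
      by (auto simp: vstep_def split: list.split frame.split)
        (cases "frames st"; cases "hd (frames st)"; auto split: if_splits)+
    with tok show ?thesis by simp
  qed
qed

lemma loop_vstep:
  assumes "fits N 0 st" "length (inp st) \<le> k"
  shows "loop_den k (den N (IfTop 3 {8, 9} (raise 5 ;; Pop 2) (token_prog S))) 2 {1, 2} (vstore st) =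
    Some (vstore (vrun S k st)) \<and> fits N 0 (vrun S k st) \<and> inp (vrun S k st) = []"
  using assms
proof (induction k arbitrary: st)
  case 0
  then show ?case by simp
next
  case (Suc k)
  show ?case
  proof (cases "inp st = []")
    case True
    with Suc.prems show ?thesis by simp
  next
    case False
    then have "hd0 (vstore st 2) \<in> {1, 2}"
      by (cases "inp st") simp_all
    moreover note den_vstep[OF Suc.prems(1) False, of S]
    moreover have "length (inp (vstep S st)) \<le> k"
      using vstep_Cons(2)[OF Suc.prems(1) False, of S] Suc.prems(2) by simp
    note Suc.IH[OF vstep_Cons(1)[OF Suc.prems(1) False, of S] this]
    ultimately show ?thesis
      using False unfolding loop_den.simps by (simp del: den.simps)
  qed
qed

text \<open>Every step consumes input. This allows \<open>verifies\<close> to count steps by the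
  length of the formula, while the program runs with the larger fuel \<open>N\<close>.\<close>

lemma vrun_fuel:
  assumes "fits N 0 st" "length (inp st) \<le> k"
  shows "vrun S k st = vrun S (length (inp st)) st"
  using assms
proof (induction "length (inp st)" arbitrary: k st rule: less_induct)
  case less
  show ?case
  proof (cases "inp st")
    case Nil
    then show ?thesis by (cases k) auto
  next
    case (Cons b y)
    then obtain k' where k: "k = Suc k'" using less by (cases k) auto
    have ne: "inp st \<noteq> []" using Cons by simp
    note v = vstep_Cons[OF less.prems(1) ne, of S]
    have "vrun S k' (vstep S st) = vrun S (length (inp (vstep S st))) (vstep S st)"
      using v less.prems Cons k by (intro less.hyps) auto
    moreover have "vrun S (length y) (vstep S st) = vrun S (length (inp (vstep S st))) (vstep S st)"
      using v Cons by (intro less.hyps) auto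
    ultimately show ?thesis by (simp add: k Cons)
  qed
qed

text \<open>Linear fuel suffices, since by \<open>fits\<close> the stacks never outgrow the input.
  The certificate stays in variable 1, the formula moves to 2, and the pair is accepted if the flag
  in 5 is down at the end.\<close>

lemma polytime_verifies: "polytime_rel (verifies S)"
proof (rule polytime_relI[OF wf_verifier_prog])
  show "(1 :: nat) \<le> 5" by simp
  fix x u
  let ?N = "poly [:1, 1:] (length (pair x u))"
  have pair: "length (pair x u) = Suc (length x + length u)"
    by (simp add: pair_def)
  then have N: "?N = length x + length u + 2"
    by simp
  define st where "st = VState x u [] [[]] False"
  have s0: "input_store (pair x u) 1 = bits x @ 3 # bits u"
    by (simp add: input_store_def pair_def)
  define s1 where "s1 = (input_store (pair x u))(1 := 3 # bits u, 7 := rev (bits x))"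
  define s2 where "s2 = (input_store (pair x u))(1 := bits u, 7 := rev (bits x))"
  have "den ?N (transfer [1, 2] 1 7) (input_store (pair x u)) =
      Some ((input_store (pair x u))(1 := 3 # bits u, 7 := rev (bits x) @ input_store (pair x u) 7))"
    using s0 set_bits[of x] by (intro den_transfer) (auto simp: pair)
  then have 1: "den ?N (transfer [1, 2] 1 7) (input_store (pair x u)) = Some s1"
    by (simp add: s1_def input_store_def)
  have 2: "den ?N (Pop 1) s1 = Some s2"
    by (simp add: s1_def s2_def fun_eq_iff)
  have "den ?N (transfer [1, 2] 7 2) s2 = Some (s2(7 := [], 2 := rev (rev (bits x)) @ s2 2))"
    using set_bits[of x] by (intro den_transfer) (auto simp: pair s2_def)
  also have "s2(7 := [], 2 := rev (rev (bits x)) @ s2 2) = vstore st"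
    by (auto simp: s2_def st_def vstore_def input_store_def fun_eq_iff)
  finally have 3: "den ?N (transfer [1, 2] 7 2) s2 = Some (vstore st)" .
  define st' where "st' = vrun S ?N st"
  have fits: "fits ?N 0 st"
    by (simp add: fits_def st_def dias_def pair)
  have loop: "den ?N (WhileTop 2 {1, 2} (IfTop 3 {8, 9} (raise 5 ;; Pop 2) (token_prog S))) (vstore st) = Some (vstore st')"
    and fits': "fits ?N 0 st'"
    unfolding den.simps(8) st'_def using loop_vstep[OF fits, of ?N S] by (simp_all add: st_def pair)
  from fits' obtain E C where C: "segs st' = E # C"
    by (cases "segs st'") (auto simp: fits_def)
  define s3 where "s3 = (vstore st')(4 := if C = [] then [] else 6 # segs_syms C, 5 := flag (failed st' \<or> \<not> consistent E))"
  have 4: "den ?N check (vstore st') = Some s3"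
    unfolding s3_def using C fits' by (intro den_check) (auto simp: temps_empty_def fits_def)
  have acc: "verifies S x u \<longleftrightarrow> accepting st'"
    unfolding verifies_def st'_def using vrun_fuel[OF fits, of ?N S] by (simp add: st_def pair)
  have top: "hd0 (s3 3) = 9 \<longleftrightarrow> frames st' \<noteq> [] \<and> hd (frames st') = FDone True"
    by (cases "frames st'"; cases "hd (frames st')") (auto simp: s3_def)
  have 5: "den ?N (IfTop 3 {9} Skip (raise 5)) s3 =
      Some (if frames st' \<noteq> [] \<and> hd (frames st') = FDone True then s3 else s3(5 := flag True))"
    using top den_raise[of s3 5 "failed st' \<or> \<not> consistent E" ?N] by (simp add: s3_def)
  have "den ?N (verifier_prog S) (input_store (pair x u)) =
      Some (if frames st' \<noteq> [] \<and> hd (frames st') = FDone True then s3 else s3(5 := flag True))"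
    unfolding verifier_prog_def by (rule den_Seq 1 2 3 loop 4 5)+
  then show "\<exists>s. den ?N (verifier_prog S) (input_store (pair x u)) = Some s \<and>
      (verifies S x u \<longleftrightarrow> hd0 (s 5) \<in> {0})"
    unfolding acc by (auto simp: accepting_def C s3_def)
qed

subsection \<open>Accepted inputs are formulas\<close>

definition vfinal :: "oper set \<Rightarrow> vstate \<Rightarrow> vstate" where
  "vfinal S st = vrun S (length (inp st)) st"

definition balanced :: "vstate \<Rightarrow> bool" where
  "balanced st \<longleftrightarrow> length (segs st) = Suc (dias (frames st))"

lemma balanced_fits: "balanced st \<Longrightarrow> \<exists>N. fits N 0 st"
  by (rule exI[of _ "Suc (length (frames st) + length (inp st) + length (segs_syms (segs st)))"])
    (simp add: balanced_def fits_def)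

lemma vfinal_Nil: "inp st = [] \<Longrightarrow> vfinal S st = st"
  by (simp add: vfinal_def)

lemma vfinal_vstep:
  assumes "balanced st" "inp st \<noteq> []"
  shows "vfinal S st = vfinal S (vstep S st)" "balanced (vstep S st)"
    "length (inp (vstep S st)) < length (inp st)"
proof -
  obtain N where N: "fits N 0 st" using balanced_fits[OF assms(1)] by blast
  note v = vstep_Cons[OF N assms(2), of S]
  show "length (inp (vstep S st)) < length (inp st)" by (rule v(2))
  show "balanced (vstep S st)" using v(1) by (simp add: fits_def balanced_def)
  obtain k where k: "length (inp st) = Suc k" using assms(2) by (cases "inp st") auto
  then have "vfinal S st = vrun S k (vstep S st)"
    using assms(2) by (simp add: vfinal_def)
  also have "\<dots> = vfinal S (vstep S st)"
    unfolding vfinal_def using v k by (intro vrun_fuel[of N]) auto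
  finally show "vfinal S st = vfinal S (vstep S st)" .
qed

lemma vstep_token: "(\<And>b K. frames st \<noteq> FDone b # K) \<Longrightarrow> vstep S st = token S st"
  by (auto simp: vstep_def split: list.split frame.split)

lemma token_simps:
  "token S (VState (False # False # False # False # x) u K C f) = read_atom True (VState x u K C f)"
  "token S (VState (False # False # False # True # x) u K C f) = guard S OpAtNeg (read_atom False) (VState x u K C f)"
  "token S (VState (False # False # True # False # x) u K C f) = guard S OpTrue (complete True) (VState x u K C f)"
  "token S (VState (False # False # True # True # x) u K C f) = guard S OpFalse (complete False) (VState x u K C f)"
  "token S (VState (False # True # False # False # x) u K C f) = guard S OpNeg (open_frame FNeg) (VState x u K C f)"
  "token S (VState (False # True # False # True # x) u K C f) = guard S OpBox (open_frame (FConst True)) (VState x u K C f)"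
  "token S (VState (False # True # True # False # x) u K C f) = guard S OpDia (open_frame FDia) (VState x u K C f)"
  "token S (VState (True # False # False # False # x) u K C f) = guard S OpConj (open_frame FConj) (VState x u K C f)"
  "token S (VState (True # False # False # True # x) u K C f) = guard S OpDisj (open_frame FDisj) (VState x u K C f)"
  by (simp_all add: token_def read_def)

lemma reduce_failed: "reduce v K C f = (K', C', f') \<Longrightarrow> f \<Longrightarrow> f'"
  by (induction v K C f rule: reduce.induct) auto

definition keeps_failure :: "(vstate \<Rightarrow> vstate) \<Rightarrow> bool" where
  "keeps_failure F \<longleftrightarrow> (\<forall>st. failed st \<longrightarrow> failed (F st))"

lemma keeps_failure_complete: "keeps_failure (complete v)"
  using reduce_failed by (fastforce simp: keeps_failure_def complete_def split: prod.split)

lemma keeps_failure_atom: "keeps_failure (read_atom pv)"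
  using keeps_failure_complete by (auto simp: keeps_failure_def read_atom_def Let_def)

lemma keeps_failure_open: "keeps_failure (open_frame k)"
  by (auto simp: keeps_failure_def open_frame_def)

lemma keeps_failure_fail: "keeps_failure fail"
  by (auto simp: keeps_failure_def fail_def)

lemma keeps_failure_guard: "keeps_failure F \<Longrightarrow> keeps_failure (guard S p F)"
  by (simp add: guard_def keeps_failure_fail)

lemma keeps_failure_read: "keeps_failure F \<Longrightarrow> keeps_failure G \<Longrightarrow> keeps_failure (read F G)"
  by (auto simp: keeps_failure_def read_def fail_def split: list.split)

lemma keeps_failure_token: "keeps_failure (token S)"
  unfolding token_def
  by (intro keeps_failure_read keeps_failure_guard keeps_failure_atom keeps_failure_complete
      keeps_failure_open keeps_failure_fail)

lemma vrun_failed: "failed st \<Longrightarrow> failed (vrun S k st)"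
proof (induction k arbitrary: st)
  case (Suc k)
  have "failed (vstep S st)"
    using keeps_failure_token[of S] Suc.prems
    by (auto simp: vstep_def keeps_failure_def split: list.split frame.split)
  with Suc show ?case by simp
qed simp

lemma read_digits_delimit: "read_digits (delimit ds @ x) = (ds, x, True)"
  by (induction ds) auto

lemma read_digits_ok: "read_digits x = (ds, y, True) \<Longrightarrow> x = delimit ds @ y"
  by (induction x arbitrary: ds rule: read_digits.induct) (auto split: prod.splits)

lemma last_binary: "binary p = [] \<or> last (binary p)"
proof (induction p rule: less_induct)
  case (less p)
  show ?case
  proof (cases "p = 0")
    case False
    then have "binary (p div 2) = [] \<or> last (binary (p div 2))"
      by (intro less) auto
    moreover have "binary (p div 2) = [] \<Longrightarrow> odd p"
      using False binary_pos[of "p div 2"] by (cases "p div 2 = 0") (auto elim: oddE evenE)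
    ultimately show ?thesis
      using binary_pos[OF False] by auto
  qed (simp add: binary_0)
qed

text \<open>The number of formulas still to be read.\<close>

definition need :: "frame list \<Rightarrow> nat" where
  "need K = Suc (length (filter (\<lambda>k. k = FConj \<or> k = FDisj) K))"

definition no_done :: "frame list \<Rightarrow> bool" where
  "no_done K \<longleftrightarrow> (\<forall>b. FDone b \<notin> set K)"

lemma reduce_need:
  "reduce v K C f = (K', C', f') \<Longrightarrow> no_done K \<Longrightarrow>
     need K = 1 \<and> (\<exists>b. K' = [FDone b]) \<or> need K = Suc (need K') \<and> no_done K'"
  by (induction v K C f rule: reduce.induct) (auto simp: need_def no_done_def split: if_splits)

lemma token_cases:
  assumes ok: "\<not> failed (token S (VState x u K C f))" and C: "C \<noteq> []"
  obtains (leaf) a y u' C' f' v where "a \<in> lang S" "x = encode a @ y" "length C' = length C"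
      "token S (VState x u K C f) = complete v (VState y u' K C' f')"
  | (unary) g t y k C' where "\<And>a. a \<in> lang S \<Longrightarrow> g a \<in> lang S" "\<And>a. encode (g a) = t @ encode a"
      "x = t @ y" "k \<in> {FNeg, FConst True, FDia}" "token S (VState x u K C f) = VState y u (k # K) C' f"
  | (binary) g t y k where "\<And>a b. a \<in> lang S \<Longrightarrow> b \<in> lang S \<Longrightarrow> g a b \<in> lang S"
      "\<And>a b. encode (g a b) = t @ encode a @ encode b" "x = t @ y" "k \<in> {FConj, FDisj}"
      "token S (VState x u K C f) = VState y u (k # K) C f"
proof -
  have guard: "p \<in> S \<and> guard S p F = F" if "\<not> failed (guard S p F st)" for p F st
    using that by (auto simp: guard_def fail_def split: if_splits)
  have atom: "\<exists>p y u' C' f' v. z = delimit (binary p) @ y \<and> length C' = length C \<and>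
      read_atom pv (VState z u K C f) = complete v (VState y u' K C' f')"
    if nf: "\<not> failed (read_atom pv (VState z u K C f))" for pv z
  proof -
    obtain ds y ok where r: "read_digits z = (ds, y, ok)" by (cases "read_digits z") auto
    define b where "b = (u \<noteq> [] \<and> hd u)"
    have a: "read_atom pv (VState z u K C f) = complete (b = pv) (VState y (tl u) K
        (((b, rev ds) # hd C) # tl C) (f \<or> \<not> (ok \<and> (ds = [] \<or> last ds))))"
      by (simp add: read_atom_def Let_def r b_def)
    have "\<not> (f \<or> \<not> (ok \<and> (ds = [] \<or> last ds)))"
      using nf keeps_failure_complete[of "b = pv"] unfolding a keeps_failure_def by (metis vstate.sel(5))
    \<comment> \<open>The terminator and the last digit have been checked, so the digits read are
      the numeral of \<open>unbinary ds\<close>.\<close>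
    then have "ok" "ds = [] \<or> last ds" by auto
    then have "z = delimit (binary (unbinary ds)) @ y"
      using read_digits_ok[of z ds y] r binary_unbinary[of ds] by simp
    moreover have "length (((b, rev ds) # hd C) # tl C) = length C"
      using C by simp
    ultimately show ?thesis using a by blast
  qed
  have short: "failed (token S (VState x u K C f))" if "length x < 4"
    using that by (auto simp: token_def read_def fail_def less_Suc_eq numeral_eq_Suc length_Suc_conv)
  then obtain b1 b2 b3 b4 z where x: "x = b1 # b2 # b3 # b4 # z"
    using ok by (cases x; cases "tl x"; cases "tl (tl x)"; cases "tl (tl (tl x))") auto
  note t = ok[unfolded x]
  consider "x = False # False # False # False # z" | "x = False # False # False # True # z"
    | "x = False # False # True # False # z" | "x = False # False # True # True # z"
    | "x = False # True # False # False # z" | "x = False # True # False # True # z"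
    | "x = False # True # True # False # z" | "x = True # False # False # False # z"
    | "x = True # False # False # True # z"
    using t by (cases b1; cases b2; cases b3; cases b4) (auto simp: x token_def read_def fail_def)
  then show thesis
  proof cases
    case 1
    with ok have nf: "\<not> failed (read_atom True (VState z u K C f))" by (simp add: token_simps)
    from atom[OF nf] obtain p y u' C' f' v where "z = delimit (binary p) @ y" "length C' = length C"
      "read_atom True (VState z u K C f) = complete v (VState y u' K C' f')" by blast
    then show thesis
      using 1 by (intro leaf[of "Atom p"]) (auto simp: token_simps lang_def)
  next
    case 2
    with ok guard[of OpAtNeg "read_atom False"] have S: "OpAtNeg \<in> S"
      and nf: "\<not> failed (read_atom False (VState z u K C f))" and g: "guard S OpAtNeg (read_atom False) = read_atom False"
      by (fastforce simp: token_simps)+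
    from atom[OF nf] obtain p y u' C' f' v where "z = delimit (binary p) @ y" "length C' = length C"
      "read_atom False (VState z u K C f) = complete v (VState y u' K C' f')" by blast
    then show thesis
      using 2 S by (intro leaf[of "NAtom p"]) (auto simp: token_simps lang_def g)
  next
    case 3
    with ok have "OpTrue \<in> S \<and> guard S OpTrue (complete True) = complete True"
      by (intro guard) (simp add: token_simps)
    with 3 show thesis by (intro leaf[of Top z C True u f]) (auto simp: token_simps lang_def)
  next
    case 4
    with ok have "OpFalse \<in> S \<and> guard S OpFalse (complete False) = complete False"
      by (intro guard) (simp add: token_simps)
    with 4 show thesis by (intro leaf[of Bot z C False u f]) (auto simp: token_simps lang_def)
  next
    case 5
    with ok have "OpNeg \<in> S \<and> guard S OpNeg (open_frame FNeg) = open_frame FNeg"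
      by (intro guard) (simp add: token_simps)
    with 5 show thesis
      by (intro unary[of Neg "[False, True, False, False]" z FNeg C]) (auto simp: token_simps lang_def open_frame_def)
  next
    case 6
    with ok have "OpBox \<in> S \<and> guard S OpBox (open_frame (FConst True)) = open_frame (FConst True)"
      by (intro guard) (simp add: token_simps)
    with 6 show thesis
      by (intro unary[of Box "[False, True, False, True]" z "FConst True" C]) (auto simp: token_simps lang_def open_frame_def)
  next
    case 7
    with ok have "OpDia \<in> S \<and> guard S OpDia (open_frame FDia) = open_frame FDia"
      by (intro guard) (simp add: token_simps)
    with 7 show thesis
      by (intro unary[of Dia "[False, True, True, False]" z FDia "[] # C"]) (auto simp: token_simps lang_def open_frame_def)
  next
    case 8
    with ok have "OpConj \<in> S \<and> guard S OpConj (open_frame FConj) = open_frame FConj"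
      by (intro guard) (simp add: token_simps)
    with 8 show thesis
      by (intro binary[of Conj "[True, False, False, False]" z FConj]) (auto simp: token_simps lang_def open_frame_def)
  next
    case 9
    with ok have "OpDisj \<in> S \<and> guard S OpDisj (open_frame FDisj) = open_frame FDisj"
      by (intro guard) (simp add: token_simps)
    with 9 show thesis
      by (intro binary[of Disj "[True, False, False, True]" z FDisj]) (auto simp: token_simps lang_def open_frame_def)
  qed
qed

text \<open>\<open>sat_problem\<close> contains encodings only, so malformed input must never be
  accepted. A leaf lowers the number of expected formulas by one, a unary operator keeps it and a
  binary one raises it by one; failure is permanent, so none of the tokens was rejected.\<close>

lemma accepted_formulas:
  assumes "no_done K" "length C = Suc (dias K)" "st = vfinal S (VState x u K C f)" "\<not> failed st"
    "frames st \<noteq> []" "hd (frames st) = FDone True"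
  shows "\<exists>as. set as \<subseteq> lang S \<and> length as = need K \<and> x = concat (map encode as)"
  using assms
proof (induction "length x" arbitrary: x u K C f rule: less_induct)
  case less
  let ?st = "VState x u K C f"
  have x: "x \<noteq> []"
    using less.prems by (cases K) (auto simp: vfinal_Nil no_done_def)
  have bal: "balanced ?st" using less.prems by (simp add: balanced_def)
  have tok: "vstep S ?st = token S ?st"
    using less.prems(1) by (intro vstep_token) (auto simp: no_done_def)
  have fin: "st = vfinal S (token S ?st)" "balanced (token S ?st)" "length (inp (token S ?st)) < length x"
    using vfinal_vstep[OF bal, of S] x less.prems(3) tok by auto
  have nf: "\<not> failed (token S ?st)"
    using vrun_failed less.prems(4) unfolding fin(1) vfinal_def by blast
  have C: "C \<noteq> []" using less.prems by auto
  show ?case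
    using nf C
  proof (cases rule: token_cases)
    case (leaf a y u' C' f' v)
    obtain K1 C1 f1 where r: "reduce v K C' f' = (K1, C1, f1)" by (cases "reduce v K C' f'") auto
    have t: "token S ?st = VState y u' K1 C1 f1"
      using leaf(4) r by (simp add: complete_def)
    from reduce_need[OF r less.prems(1)] show ?thesis
    proof
      assume 1: "need K = 1 \<and> (\<exists>b. K1 = [FDone b])"
      \<comment> \<open>With the last formula complete, any remaining bit would cause a permanent
        failure.\<close>
      have "y = []"
      proof (rule ccontr)
        assume "y \<noteq> []"
        then have "vfinal S (token S ?st) = vfinal S (vstep S (token S ?st))"
          using fin(2) by (intro vfinal_vstep) (simp_all add: t)
        moreover have "failed (vstep S (token S ?st))"
          using 1 by (auto simp: t vstep_def)
        ultimately show False
          using vrun_failed less.prems(4) unfolding fin(1) vfinal_def by metis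
      qed
      with 1 leaf show ?thesis by (intro exI[of _ "[a]"]) simp
    next
      assume 2: "need K = Suc (need K1) \<and> no_done K1"
      have "\<exists>as. set as \<subseteq> lang S \<and> length as = need K1 \<and> y = concat (map encode as)"
        using fin 2 less.prems(4-6) by (intro less.hyps[of y K1 C1 u' f1]) (simp_all add: t balanced_def)
      then obtain as where "set as \<subseteq> lang S" "length as = need K1" "y = concat (map encode as)" by blast
      with 2 leaf show ?thesis by (intro exI[of _ "a # as"]) simp
    qed
  next
    case (unary g t y k C')
    have "no_done (k # K)" using unary(4) less.prems(1) by (auto simp: no_done_def)
    then have "\<exists>as. set as \<subseteq> lang S \<and> length as = need (k # K) \<and> y = concat (map encode as)"
      using fin less.prems(4-6) by (intro less.hyps[of y "k # K" C' u f]) (simp_all add: unary(5) balanced_def)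
    moreover have "need (k # K) = need K" using unary(4) by (auto simp: need_def)
    ultimately obtain as where as: "set as \<subseteq> lang S" "length as = need K" "y = concat (map encode as)" by auto
    then obtain a as' where "as = a # as'" by (cases as) (auto simp: need_def)
    with as unary show ?thesis by (intro exI[of _ "g a # as'"]) auto
  next
    case (binary g t y k)
    have "no_done (k # K)" using binary(4) less.prems(1) by (auto simp: no_done_def)
    then have "\<exists>as. set as \<subseteq> lang S \<and> length as = need (k # K) \<and> y = concat (map encode as)"
      using fin less.prems(4-6) by (intro less.hyps[of y "k # K" C u f]) (simp_all add: binary(5) balanced_def)
    moreover have "need (k # K) = Suc (need K)" using binary(4) by (auto simp: need_def)
    ultimately obtain as where as: "set as \<subseteq> lang S" "length as = Suc (need K)" "y = concat (map encode as)" by auto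
    then obtain a b as' where "as = a # b # as'" by (cases as; cases "tl as") (auto simp: need_def)
    with as binary show ?thesis by (intro exI[of _ "g a b # as'"]) auto
  qed
qed

lemma verifies_formula:
  assumes "verifies S x u"
  shows "\<exists>a \<in> lang S. x = encode a"
proof -
  define st where "st = vfinal S (VState x u [] [[]] False)"
  have "accepting st"
    using assms by (simp add: verifies_def vfinal_def st_def)
  then have "\<exists>as. set as \<subseteq> lang S \<and> length as = need [] \<and> x = concat (map encode as)"
    by (intro accepted_formulas[of "[]" "[[]]" st S x u False])
      (auto simp: accepting_def no_done_def dias_def st_def)
  then obtain as where as: "set as \<subseteq> lang S" "length as = 1" "x = concat (map encode as)"
    by (auto simp: need_def)
  then obtain a where "as = [a]" by (cases as) auto
  with as show ?thesis by (intro bexI[of _ a]) auto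
qed

subsection \<open>The value computed by the verifier\<close>

text \<open>Value, guesses for the current world, remaining guesses, and whether all inner worlds are consistent.\<close>

fun evaluate :: "fm \<Rightarrow> bool list \<Rightarrow> bool \<times> entry list \<times> bool list \<times> bool" where
  "evaluate (Atom p) u = (let b = (u \<noteq> [] \<and> hd u) in (b, [(b, rev (binary p))], tl u, True))"
| "evaluate (NAtom p) u = (let b = (u \<noteq> [] \<and> hd u) in (\<not> b, [(b, rev (binary p))], tl u, True))"
| "evaluate Top u = (True, [], u, True)"
| "evaluate Bot u = (False, [], u, True)"
| "evaluate (Neg a) u = (case evaluate a u of (v, E, u', ok) \<Rightarrow> (\<not> v, E, u', ok))"
| "evaluate (Conj a b) u = (case evaluate a u of (v, E, u', ok) \<Rightarrow>
     case evaluate b u' of (v', E', u'', ok') \<Rightarrow> (v \<and> v', E' @ E, u'', ok \<and> ok'))"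
| "evaluate (Disj a b) u = (case evaluate a u of (v, E, u', ok) \<Rightarrow>
     case evaluate b u' of (v', E', u'', ok') \<Rightarrow> (v \<or> v', E' @ E, u'', ok \<and> ok'))"
| "evaluate (Box a) u = (case evaluate a u of (v, E, u', ok) \<Rightarrow> (True, E, u', ok))"
| "evaluate (Dia a) u = (case evaluate a u of (v, E, u', ok) \<Rightarrow> (v, [], u', ok \<and> consistent E))"

lemma vfinal_token:
  assumes "no_done K" "length C = dias K" "x \<noteq> []"
  shows "vfinal S (VState x u K (E # C) f) = vfinal S (token S (VState x u K (E # C) f))"
proof -
  have "vstep S (VState x u K (E # C) f) = token S (VState x u K (E # C) f)"
    using assms by (intro vstep_token) (auto simp: no_done_def)
  with vfinal_vstep(1)[of "VState x u K (E # C) f" S] assms show ?thesis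
    by (simp add: balanced_def)
qed

text \<open>Stated for arbitrary frames and remaining input, so that the second argument of a
  connective can be read under the frame \<open>FId\<close> or \<open>FConst\<close> that the first
  one leaves behind.\<close>

lemma vfinal_encode:
  assumes "a \<in> lang S" "no_done K" "length C = dias K" "evaluate a u = (v, E', u', ok)"
  shows "vfinal S (VState (encode a @ x) u K (E # C) f) =
    vfinal S (complete v (VState x u' K ((E' @ E) # C) (f \<or> \<not> ok)))"
  using assms
proof (induction a arbitrary: x u K E C f v E' u' ok)
  case (Atom p)
  then show ?case
    using last_binary[of p]
    by (auto simp: vfinal_token token_simps read_atom_def Let_def read_digits_delimit)
next
  case (NAtom p)
  then show ?case
    using last_binary[of p]
    by (auto simp: vfinal_token token_simps guard_def lang_def read_atom_def Let_def read_digits_delimit)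
next
  case Top
  then show ?case
    by (auto simp: vfinal_token token_simps guard_def lang_def)
next
  case Bot
  then show ?case
    by (auto simp: vfinal_token token_simps guard_def lang_def)
next
  case (Neg a)
  obtain w where ev: "evaluate a u = (w, E', u', ok)" "v = (\<not> w)"
    using Neg.prems(4) by (auto split: prod.splits)
  have l: "a \<in> lang S" "OpNeg \<in> S" "no_done (FNeg # K)" "length C = dias (FNeg # K)"
    using Neg.prems by (auto simp: lang_def no_done_def dias_def)
  show ?case
    using Neg.prems Neg.IH[OF l(1,3,4) ev(1), of x E f] l(2)
    by (simp add: vfinal_token token_simps guard_def open_frame_def complete_def ev(2))
next
  case (Box a)
  obtain w where ev: "evaluate a u = (w, E', u', ok)" "v = True"
    using Box.prems(4) by (auto split: prod.splits)
  have l: "a \<in> lang S" "OpBox \<in> S" "no_done (FConst True # K)" "length C = dias (FConst True # K)"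
    using Box.prems by (auto simp: lang_def no_done_def dias_def)
  show ?case
    using Box.prems Box.IH[OF l(1,3,4) ev(1), of x E f] l(2)
    by (simp add: vfinal_token token_simps guard_def open_frame_def complete_def ev(2))
next
  case (Dia a)
  obtain F ok' where ev: "evaluate a u = (v, F, u', ok')" "E' = []" "ok = (ok' \<and> consistent F)"
    using Dia.prems(4) by (auto split: prod.splits)
  have l: "a \<in> lang S" "OpDia \<in> S" "no_done (FDia # K)" "length (E # C) = dias (FDia # K)"
    using Dia.prems by (auto simp: lang_def no_done_def dias_def)
  show ?case
    using Dia.prems Dia.IH[OF l(1,3,4) ev(1), of x "[]" f] l(2)
    by (simp add: vfinal_token token_simps guard_def open_frame_def complete_def ev(2,3))
next
  case (Conj a b)
  obtain w1 E1 u1 ok1 w2 E2 ok2 where ev: "evaluate a u = (w1, E1, u1, ok1)" "evaluate b u1 = (w2, E2, u', ok2)"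
    "v = (w1 \<and> w2)" "E' = E2 @ E1" "ok = (ok1 \<and> ok2)"
    using Conj.prems(4) by (auto split: prod.splits)
  let ?k = "if w1 then FId else FConst False"
  have l: "a \<in> lang S" "b \<in> lang S" "OpConj \<in> S" "no_done (FConj # K)" "length C = dias (FConj # K)"
    "no_done (?k # K)" "length C = dias (?k # K)"
    using Conj.prems by (auto simp: lang_def no_done_def dias_def)
  have "vfinal S (VState (encode (Conj a b) @ x) u K (E # C) f) =
      vfinal S (VState (encode a @ encode b @ x) u (FConj # K) (E # C) f)"
    using Conj.prems l(3) by (simp add: vfinal_token token_simps guard_def open_frame_def)
  also have "\<dots> = vfinal S (VState (encode b @ x) u1 (?k # K) ((E1 @ E) # C) (f \<or> \<not> ok1))"
    using Conj.IH(1)[OF l(1,4,5) ev(1), of "encode b @ x" E f] by (simp add: complete_def)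
  also have "\<dots> = vfinal S (complete w2 (VState x u' (?k # K) ((E2 @ E1 @ E) # C) ((f \<or> \<not> ok1) \<or> \<not> ok2)))"
    by (rule Conj.IH(2)[OF l(2,6,7) ev(2)])
  also have "\<dots> = vfinal S (complete v (VState x u' K ((E' @ E) # C) (f \<or> \<not> ok)))"
    by (simp add: complete_def ev(3-5) disj_assoc)
  finally show ?case .
next
  case (Disj a b)
  obtain w1 E1 u1 ok1 w2 E2 ok2 where ev: "evaluate a u = (w1, E1, u1, ok1)" "evaluate b u1 = (w2, E2, u', ok2)"
    "v = (w1 \<or> w2)" "E' = E2 @ E1" "ok = (ok1 \<and> ok2)"
    using Disj.prems(4) by (auto split: prod.splits)
  let ?k = "if w1 then FConst True else FId"
  have l: "a \<in> lang S" "b \<in> lang S" "OpDisj \<in> S" "no_done (FDisj # K)" "length C = dias (FDisj # K)"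
    "no_done (?k # K)" "length C = dias (?k # K)"
    using Disj.prems by (auto simp: lang_def no_done_def dias_def)
  have "vfinal S (VState (encode (Disj a b) @ x) u K (E # C) f) =
      vfinal S (VState (encode a @ encode b @ x) u (FDisj # K) (E # C) f)"
    using Disj.prems l(3) by (simp add: vfinal_token token_simps guard_def open_frame_def)
  also have "\<dots> = vfinal S (VState (encode b @ x) u1 (?k # K) ((E1 @ E) # C) (f \<or> \<not> ok1))"
    using Disj.IH(1)[OF l(1,4,5) ev(1), of "encode b @ x" E f] by (simp add: complete_def)
  also have "\<dots> = vfinal S (complete w2 (VState x u' (?k # K) ((E2 @ E1 @ E) # C) ((f \<or> \<not> ok1) \<or> \<not> ok2)))"
    by (rule Disj.IH(2)[OF l(2,6,7) ev(2)])
  also have "\<dots> = vfinal S (complete v (VState x u' K ((E' @ E) # C) (f \<or> \<not> ok)))"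
    by (simp add: complete_def ev(3-5) disj_assoc)
  finally show ?case .
qed

lemma verifies_encode:
  assumes "a \<in> lang S" "evaluate a u = (v, E, u', ok)"
  shows "verifies S (encode a) u \<longleftrightarrow> v \<and> ok \<and> consistent E"
proof -
  have "vfinal S (VState (encode a) u [] [[]] False) = VState [] u' [FDone v] [E] (\<not> ok)"
    using vfinal_encode[OF assms(1) _ _ assms(2), of "[]" "[]" "[]" "[]" False]
    by (simp add: no_done_def dias_def complete_def vfinal_Nil)
  then show ?thesis
    by (auto simp: verifies_def vfinal_def accepting_def)
qed

subsection \<open>Satisfiability\<close>

definition agrees :: "(bool list \<Rightarrow> bool) \<Rightarrow> entry list \<Rightarrow> bool" where
  "agrees \<alpha> E \<longleftrightarrow> (\<forall>(b, ds) \<in> set E. \<alpha> ds = b)"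

lemma agrees_simps [simp]: "agrees \<alpha> []" "agrees \<alpha> ((b, ds) # E) \<longleftrightarrow> \<alpha> ds = b \<and> agrees \<alpha> E"
  "agrees \<alpha> (E @ E') \<longleftrightarrow> agrees \<alpha> E \<and> agrees \<alpha> E'"
  by (auto simp: agrees_def)

lemma consistent_agrees: "consistent E \<longleftrightarrow> (\<exists>\<alpha>. agrees \<alpha> E)"
proof
  assume "consistent E"
  then have "agrees (\<lambda>ds. (True, ds) \<in> set E) E"
    unfolding consistent_iff agrees_def by (auto; metis fst_conv snd_conv)
  then show "\<exists>\<alpha>. agrees \<alpha> E" by blast
next
  assume "\<exists>\<alpha>. agrees \<alpha> E"
  then obtain \<alpha> where "agrees \<alpha> E" ..
  then have "\<forall>e \<in> set E. fst e = \<alpha> (snd e)"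
    by (auto simp: agrees_def)
  then show "consistent E" by (simp add: consistent_iff)
qed

definition end_val :: "(bool list \<Rightarrow> bool) \<Rightarrow> nat \<Rightarrow> nat set" where
  "end_val \<alpha> p = (if \<alpha> (rev (binary p)) then {0} else {})"

definition world_val :: "(nat \<Rightarrow> 'w set) \<Rightarrow> 'w \<Rightarrow> bool list \<Rightarrow> bool" where
  "world_val V w ds \<longleftrightarrow> (\<exists>p. binary p = rev ds \<and> w \<in> V p)"

lemma world_val_binary: "world_val V w (rev (binary p)) \<longleftrightarrow> w \<in> V p"
  using binary_inject by (auto simp: world_val_def)

text \<open>At a world without successors every box is true, which is the value that
  \<open>evaluate\<close> gives it. The agreement is an equivalence and therefore also passes
  through \<open>Neg\<close>.\<close>

lemma evaluate_end:
  assumes "OpDia \<notin> opers a" "evaluate a u = (v, E, u', ok)"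
  shows "ok \<and> (agrees \<alpha> E \<longrightarrow> (holds {} (end_val \<alpha>) 0 a \<longleftrightarrow> v))"
  using assms
  by (induction a arbitrary: u v E u' ok) (fastforce simp: Let_def end_val_def split: prod.splits if_splits)+

text \<open>A world that carries its own valuation and successors; models of subformulas can thus be
  grown along the formula and joined by appending lists of successors.\<close>

datatype tree = Tree "bool list \<Rightarrow> bool" "tree list"

definition tree_rel :: "(tree \<times> tree) set" where
  "tree_rel = {(s, t). \<exists>\<alpha> ts. s = Tree \<alpha> ts \<and> t \<in> set ts}"

definition tree_val :: "nat \<Rightarrow> tree set" where
  "tree_val p = {t. \<exists>\<alpha> ts. t = Tree \<alpha> ts \<and> \<alpha> (rev (binary p))}"

text \<open>Without negation and boxes, truth is preserved when successors are added, so that the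
  successors for different diamonds can be collected.\<close>

lemma evaluate_tree:
  assumes "OpNeg \<notin> opers a" "OpBox \<notin> opers a" "evaluate a u = (v, E, u', ok)" "ok" "v" "agrees \<alpha> E"
  shows "\<exists>ts. \<forall>ts'. set ts \<subseteq> set ts' \<longrightarrow> holds tree_rel tree_val (Tree \<alpha> ts') a"
  using assms
proof (induction a arbitrary: u v E u' ok \<alpha>)
  case (Conj a b)
  obtain w1 E1 u1 ok1 w2 E2 ok2 where ev: "evaluate a u = (w1, E1, u1, ok1)" "evaluate b u1 = (w2, E2, u', ok2)"
    "v = (w1 \<and> w2)" "E = E2 @ E1" "ok = (ok1 \<and> ok2)"
    using Conj.prems(3) by (auto split: prod.splits)
  obtain ts1 where 1: "\<forall>ts'. set ts1 \<subseteq> set ts' \<longrightarrow> holds tree_rel tree_val (Tree \<alpha> ts') a"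
    using Conj.IH(1)[OF _ _ ev(1), of \<alpha>] Conj.prems ev by auto
  obtain ts2 where 2: "\<forall>ts'. set ts2 \<subseteq> set ts' \<longrightarrow> holds tree_rel tree_val (Tree \<alpha> ts') b"
    using Conj.IH(2)[OF _ _ ev(2), of \<alpha>] Conj.prems ev by auto
  from 1 2 show ?case by (intro exI[of _ "ts1 @ ts2"]) auto
next
  case (Disj a b)
  obtain w1 E1 u1 ok1 w2 E2 ok2 where ev: "evaluate a u = (w1, E1, u1, ok1)" "evaluate b u1 = (w2, E2, u', ok2)"
    "v = (w1 \<or> w2)" "E = E2 @ E1" "ok = (ok1 \<and> ok2)"
    using Disj.prems(3) by (auto split: prod.splits)
  show ?case
  proof (cases w1)
    case True
    then obtain ts where "\<forall>ts'. set ts \<subseteq> set ts' \<longrightarrow> holds tree_rel tree_val (Tree \<alpha> ts') a"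
      using Disj.IH(1)[OF _ _ ev(1), of \<alpha>] Disj.prems ev by auto
    then show ?thesis by auto
  next
    case False
    then obtain ts where "\<forall>ts'. set ts \<subseteq> set ts' \<longrightarrow> holds tree_rel tree_val (Tree \<alpha> ts') b"
      using Disj.IH(2)[OF _ _ ev(2), of \<alpha>] Disj.prems ev by auto
    then show ?thesis by auto
  qed
next
  case (Dia a)
  obtain F ok' where ev: "evaluate a u = (v, F, u', ok')" "E = []" "ok = (ok' \<and> consistent F)"
    using Dia.prems(3) by (auto split: prod.splits)
  then obtain \<beta> where "agrees \<beta> F"
    using Dia.prems(4) consistent_agrees by blast
  then obtain ts where ts: "\<forall>ts'. set ts \<subseteq> set ts' \<longrightarrow> holds tree_rel tree_val (Tree \<beta> ts') a"
    using Dia.IH[OF _ _ ev(1), of \<beta>] Dia.prems ev by auto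
  have "holds tree_rel tree_val (Tree \<alpha> ts') (Dia a)" if "Tree \<beta> ts \<in> set ts'" for ts'
    using ts that by (auto simp: tree_rel_def)
  then show ?case by (intro exI[of _ "[Tree \<beta> ts]"]) auto
qed (auto simp: Let_def tree_val_def)

section \<open>Certificates read off a model\<close>

fun atoms :: "fm \<Rightarrow> nat" where
  "atoms (Atom p) = 1"
| "atoms (NAtom p) = 1"
| "atoms (Neg a) = atoms a"
| "atoms (Conj a b) = atoms a + atoms b"
| "atoms (Disj a b) = atoms a + atoms b"
| "atoms (Box a) = atoms a"
| "atoms (Dia a) = atoms a"
| "atoms _ = 0"

lemma atoms_encode: "atoms a \<le> length (encode a)"
  by (induction a) auto

text \<open>All literals, including those below a box, are guessed according to the single
  assignment \<open>\<alpha>\<close>, so the guesses agree with it. The arbitrary rest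
  \<open>r\<close> lets the guesses for two arguments be concatenated.\<close>

lemma guess_end:
  assumes "OpDia \<notin> opers a"
  shows "\<exists>u E. length u = atoms a \<and> agrees \<alpha> E \<and>
    (\<forall>r. evaluate a (u @ r) = (holds {} (end_val \<alpha>) 0 a, E, r, True))"
  using assms
proof (induction a)
  case (Atom p)
  then show ?case
    by (intro exI[of _ "[\<alpha> (rev (binary p))]"] exI[of _ "[(\<alpha> (rev (binary p)), rev (binary p))]"])
      (simp add: end_val_def Let_def)
next
  case (NAtom p)
  then show ?case
    by (intro exI[of _ "[\<alpha> (rev (binary p))]"] exI[of _ "[(\<alpha> (rev (binary p)), rev (binary p))]"])
      (simp add: end_val_def Let_def)
next
  case (Conj a b)
  then obtain u1 E1 u2 E2 where "length u1 = atoms a \<and> agrees \<alpha> E1 \<and>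
      (\<forall>r. evaluate a (u1 @ r) = (holds {} (end_val \<alpha>) 0 a, E1, r, True))"
    "length u2 = atoms b \<and> agrees \<alpha> E2 \<and>
      (\<forall>r. evaluate b (u2 @ r) = (holds {} (end_val \<alpha>) 0 b, E2, r, True))"
    by auto
  then show ?case by (intro exI[of _ "u1 @ u2"] exI[of _ "E2 @ E1"]) simp
next
  case (Disj a b)
  then obtain u1 E1 u2 E2 where "length u1 = atoms a \<and> agrees \<alpha> E1 \<and>
      (\<forall>r. evaluate a (u1 @ r) = (holds {} (end_val \<alpha>) 0 a, E1, r, True))"
    "length u2 = atoms b \<and> agrees \<alpha> E2 \<and>
      (\<forall>r. evaluate b (u2 @ r) = (holds {} (end_val \<alpha>) 0 b, E2, r, True))"
    by auto
  then show ?case by (intro exI[of _ "u1 @ u2"] exI[of _ "E2 @ E1"]) simp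
next
  case (Neg a)
  then obtain u E where "length u = atoms a \<and> agrees \<alpha> E \<and>
      (\<forall>r. evaluate a (u @ r) = (holds {} (end_val \<alpha>) 0 a, E, r, True))" by auto
  then show ?case by (intro exI[of _ u] exI[of _ E]) simp
next
  case (Box a)
  then obtain u E where "length u = atoms a \<and> agrees \<alpha> E \<and>
      (\<forall>r. evaluate a (u @ r) = (holds {} (end_val \<alpha>) 0 a, E, r, True))" by auto
  then show ?case by (intro exI[of _ u] exI[of _ E]) simp
qed (auto intro!: exI[of _ "[]"])

text \<open>Only one implication is available: for a diamond that is false at \<open>w\<close> the
  guesses are made at \<open>w\<close> itself, where its argument may well be true. Without
  \<open>Neg\<close> this implication is preserved.\<close>

lemma guess_model:
  assumes "OpNeg \<notin> opers a" "OpBox \<notin> opers a"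
  shows "\<exists>u E v. length u = atoms a \<and> agrees (world_val V w) E \<and>
    (\<forall>r. evaluate a (u @ r) = (v, E, r, True)) \<and> (holds R V w a \<longrightarrow> v)"
  using assms
proof (induction a arbitrary: w)
  case (Atom p)
  then show ?case
    by (intro exI[of _ "[w \<in> V p]"] exI[of _ "[(w \<in> V p, rev (binary p))]"] exI[of _ "w \<in> V p"])
      (simp add: world_val_binary Let_def)
next
  case (NAtom p)
  then show ?case
    by (intro exI[of _ "[w \<in> V p]"] exI[of _ "[(w \<in> V p, rev (binary p))]"] exI[of _ "w \<notin> V p"])
      (simp add: world_val_binary Let_def)
next
  case (Conj a b)
  obtain u1 E1 v1 where "length u1 = atoms a \<and> agrees (world_val V w) E1 \<and>
      (\<forall>r. evaluate a (u1 @ r) = (v1, E1, r, True)) \<and> (holds R V w a \<longrightarrow> v1)"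
    using Conj.IH(1)[of w] Conj.prems by auto
  moreover obtain u2 E2 v2 where "length u2 = atoms b \<and> agrees (world_val V w) E2 \<and>
      (\<forall>r. evaluate b (u2 @ r) = (v2, E2, r, True)) \<and> (holds R V w b \<longrightarrow> v2)"
    using Conj.IH(2)[of w] Conj.prems by auto
  ultimately show ?case by (intro exI[of _ "u1 @ u2"] exI[of _ "E2 @ E1"] exI[of _ "v1 \<and> v2"]) simp
next
  case (Disj a b)
  obtain u1 E1 v1 where "length u1 = atoms a \<and> agrees (world_val V w) E1 \<and>
      (\<forall>r. evaluate a (u1 @ r) = (v1, E1, r, True)) \<and> (holds R V w a \<longrightarrow> v1)"
    using Disj.IH(1)[of w] Disj.prems by auto
  moreover obtain u2 E2 v2 where "length u2 = atoms b \<and> agrees (world_val V w) E2 \<and>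
      (\<forall>r. evaluate b (u2 @ r) = (v2, E2, r, True)) \<and> (holds R V w b \<longrightarrow> v2)"
    using Disj.IH(2)[of w] Disj.prems by auto
  ultimately show ?case by (intro exI[of _ "u1 @ u2"] exI[of _ "E2 @ E1"] exI[of _ "v1 \<or> v2"]) auto
next
  case (Dia a)
  \<comment> \<open>A false diamond also opens a segment, whose guesses must be consistent; any
    world provides such guesses, and \<open>w\<close> is at hand.\<close>
  define w' where "w' = (if holds R V w (Dia a) then SOME x. (w, x) \<in> R \<and> holds R V x a else w)"
  have w': "holds R V w (Dia a) \<longrightarrow> holds R V w' a"
    unfolding w'_def by (auto intro: someI2)
  obtain u E v where u: "length u = atoms a \<and> agrees (world_val V w') E \<and>
      (\<forall>r. evaluate a (u @ r) = (v, E, r, True)) \<and> (holds R V w' a \<longrightarrow> v)"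
    using Dia.IH[of w'] Dia.prems by auto
  then have "consistent E" using consistent_agrees by blast
  with u w' show ?case by (intro exI[of _ u] exI[of _ "[]"] exI[of _ v]) simp
qed (auto intro!: exI[of _ "[]"])

lemma holds_propositional:
  assumes "OpBox \<notin> opers a" "OpDia \<notin> opers a"
  shows "holds R V w a \<longleftrightarrow> holds {} (end_val (world_val V w)) 0 a"
  using assms by (induction a) (auto simp: end_val_def world_val_binary)

text \<open>Dropping all successors makes every box true, and without \<open>Neg\<close> a formula
  is monotone in its boxed subformulas.\<close>

lemma holds_end:
  assumes "OpNeg \<notin> opers a" "OpDia \<notin> opers a" "holds R V w a"
  shows "holds {} (end_val (world_val V w)) 0 a"
  using assms by (induction a) (auto simp: end_val_def world_val_binary)

lemma kripke_end: "kripke_model {0} {} (end_val \<alpha>)"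
  by (auto simp: kripke_model_def end_val_def)

text \<open>The condition on \<open>S\<close> covers three kinds of languages: propositional ones,
  those with boxes but without general negation and diamonds, and those with diamonds but without
  general negation and boxes. The first two are settled by a world without successors, the third by
  trees.\<close>

lemma satisfiable_iff_verifies:
  assumes a: "a \<in> lang S"
    and S: "OpDia \<notin> S \<and> (OpNeg \<notin> S \<or> OpBox \<notin> S) \<or> OpNeg \<notin> S \<and> OpBox \<notin> S"
  shows "satisfiable a \<longleftrightarrow> (\<exists>u. length u \<le> length (encode a) \<and> verifies S (encode a) u)"
proof
  assume "satisfiable a"
  then obtain R w and V :: "nat \<Rightarrow> nat set" where w: "holds R V w a"
    unfolding satisfiable_def by blast
  have ops: "opers a \<subseteq> S" using a by (simp add: lang_def)
  have "\<exists>u E. length u = atoms a \<and> agrees (world_val V w) E \<and> evaluate a u = (True, E, [], True)"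
  proof (cases "OpDia \<notin> S \<and> (OpNeg \<notin> S \<or> OpBox \<notin> S)")
    case True
    then have "holds {} (end_val (world_val V w)) 0 a"
      using w ops holds_end[of a R V w] holds_propositional[of a R V w] by blast
    moreover have "OpDia \<notin> opers a" using True ops by blast
    ultimately show ?thesis
      using guess_end[of a "world_val V w"] by (metis append_Nil2)
  next
    case False
    then have "OpNeg \<notin> opers a" "OpBox \<notin> opers a" using S ops by blast+
    then show ?thesis
      using guess_model[of a V w R] w by (metis append_Nil2)
  qed
  then obtain u E where u: "length u = atoms a" "agrees (world_val V w) E" "evaluate a u = (True, E, [], True)"
    by blast
  then have "verifies S (encode a) u"
    using verifies_encode[OF a u(3)] consistent_agrees by blast
  with u(1) atoms_encode[of a] show "\<exists>u. length u \<le> length (encode a) \<and> verifies S (encode a) u"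
    by (intro exI[of _ u]) simp
next
  assume "\<exists>u. length u \<le> length (encode a) \<and> verifies S (encode a) u"
  then obtain u where u: "verifies S (encode a) u" by blast
  obtain v E u' ok where ev: "evaluate a u = (v, E, u', ok)" by (cases "evaluate a u") auto
  with u verifies_encode[OF a ev] have ok: "v" "ok" "consistent E" by auto
  then obtain \<alpha> where \<alpha>: "agrees \<alpha> E" using consistent_agrees by blast
  have ops: "opers a \<subseteq> S" using a by (simp add: lang_def)
  show "satisfiable a"
  proof (cases "OpDia \<in> S")
    case False
    then have "holds {} (end_val \<alpha>) 0 a"
      using evaluate_end[of a u v E u' ok \<alpha>] ev \<alpha> ok ops by blast
    then show ?thesis
      by (intro satisfiableI[OF kripke_end, of 0]) auto
  next
    case True
    then obtain ts where "holds tree_rel tree_val (Tree \<alpha> ts) a"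
      using evaluate_tree[OF _ _ ev ok(2,1) \<alpha>] S ops by blast
    \<comment> \<open>The worlds are all trees at once; \<open>satisfiableI\<close> carries the
      model over to natural numbers.\<close>
    then show ?thesis
      by (intro satisfiableI[of UNIV tree_rel tree_val "Tree \<alpha> ts"]) (auto simp: kripke_model_def)
  qed
qed

lemma sat_problem_in_NP:
  assumes "OpDia \<notin> S \<and> (OpNeg \<notin> S \<or> OpBox \<notin> S) \<or> OpNeg \<notin> S \<and> OpBox \<notin> S"
  shows "sat_problem S \<in> NP"
proof -
  have "x \<in> sat_problem S \<longleftrightarrow> (\<exists>u. length u \<le> length x \<and> verifies S x u)" for x
  proof
    assume "x \<in> sat_problem S"
    then show "\<exists>u. length u \<le> length x \<and> verifies S x u"
      using satisfiable_iff_verifies[OF _ assms] by (auto simp: sat_problem_def)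
  next
    assume u: "\<exists>u. length u \<le> length x \<and> verifies S x u"
    then obtain a where a: "a \<in> lang S" "x = encode a"
      using verifies_formula by blast
    with u have "satisfiable a"
      using satisfiable_iff_verifies[OF a(1) assms] by blast
    with a show "x \<in> sat_problem S"
      by (auto simp: sat_problem_def)
  qed
  then have "polytime_rel (verifies S) \<and>
      (\<forall>x. x \<in> sat_problem S \<longleftrightarrow> (\<exists>u. length u \<le> poly [:0, 1:] (length x) \<and> verifies S x u))"
    using polytime_verifies by simp
  then show ?thesis unfolding NP_def by blast
qed

section \<open>The connectives of the three kinds of languages\<close>

lemma connectives_neg_disj:
  assumes "{OpNeg, OpDisj} \<subseteq> S"
  shows "connectives S (\<lambda>a b. Neg (Disj (Neg a) (Neg b))) Disj (\<lambda>p. Neg (Atom p))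
    ([False, True, False, False] @ [True, False, False, True] @ [False, True, False, False])
    [False, True, False, False] [True, False, False, True] []
    ([False, True, False, False] @ [False, False, False, False])"
  using assms by unfold_locales (auto simp: lang_def)

text \<open>The De Morgan form uses each argument once, so it is again a prefix, an infix and the
  two arguments; the infix is the tag of the inner \<open>Neg\<close> of the second
  argument.\<close>

lemma connectives_neg_conj:
  assumes "{OpNeg, OpConj} \<subseteq> S"
  shows "connectives S Conj (\<lambda>a b. Neg (Conj (Neg a) (Neg b))) (\<lambda>p. Neg (Atom p))
    [True, False, False, False] []
    ([False, True, False, False] @ [True, False, False, False] @ [False, True, False, False])
    [False, True, False, False]
    ([False, True, False, False] @ [False, False, False, False])"
  using assms by unfold_locales (auto simp: lang_def)

lemma connectives_positive:
  assumes "{OpAtNeg, OpConj, OpDisj} \<subseteq> S"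
  shows "connectives S Conj Disj NAtom [True, False, False, False] [] [True, False, False, True] []
    [False, False, False, True]"
  using assms by unfold_locales (auto simp: lang_def)

theorem theorem8:
  fixes S :: "oper set"
  shows
    "(S \<subseteq> {OpNeg, OpAtNeg, OpConj, OpDisj, OpTrue, OpFalse} \<and>
        ({OpNeg, OpDisj} \<subseteq> S \<or> {OpNeg, OpConj} \<subseteq> S)
      \<longrightarrow> NP_complete (sat_problem S)) \<and>
     ({OpAtNeg, OpConj, OpDisj} \<subseteq> S \<and>
        (S \<subseteq> {OpAtNeg, OpConj, OpDisj, OpBox, OpTrue, OpFalse} \<or>
         S \<subseteq> {OpAtNeg, OpConj, OpDisj, OpDia, OpTrue, OpFalse})
      \<longrightarrow> NP_complete (sat_problem S))"
proof (intro conjI impI; elim conjE)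
  assume "S \<subseteq> {OpNeg, OpAtNeg, OpConj, OpDisj, OpTrue, OpFalse}"
  then have "sat_problem S \<in> NP"
    by (intro sat_problem_in_NP) blast
  moreover assume "{OpNeg, OpDisj} \<subseteq> S \<or> {OpNeg, OpConj} \<subseteq> S"
  then have "\<forall>A \<in> NP. polytime_reducible A (sat_problem S)"
    using connectives.NP_reducible[OF connectives_neg_disj]
      connectives.NP_reducible[OF connectives_neg_conj] by blast
  ultimately show "NP_complete (sat_problem S)"
    by (simp add: NP_complete_def)
next
  assume "S \<subseteq> {OpAtNeg, OpConj, OpDisj, OpBox, OpTrue, OpFalse} \<or>
    S \<subseteq> {OpAtNeg, OpConj, OpDisj, OpDia, OpTrue, OpFalse}"
  then have "sat_problem S \<in> NP"
    by (intro sat_problem_in_NP) blast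
  moreover assume "{OpAtNeg, OpConj, OpDisj} \<subseteq> S"
  then have "\<forall>A \<in> NP. polytime_reducible A (sat_problem S)"
    using connectives.NP_reducible[OF connectives_positive] by blast
  ultimately show "NP_complete (sat_problem S)"
    by (simp add: NP_complete_def)
qed

end
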